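(* Let $(A,B)$ be a pair of real random variables and let $\alpha>0$. Suppose that (1) $A\ge 0$ a.s. and the conditional law of $\log A$ given $A>0$ is non-arithmetic; (2) $\mathbb{E}A^{\alpha}=1$ and $\rho:=\mathbb{E}[A^{\alpha}\log A]<\infty$; (3) the function $L_1(x):=x^{\alpha}\mathbb{P}(B<-x)$ is slowly varying, $\mathbb{E}B_-^{\alpha}=\infty$, and $\mathbb{E}B_+^{\alpha-\varepsilon}<\infty$ for all $\varepsilon\in(0,\alpha)$; (4) $\mathbb{E}[A^{\eta}B_-^{\alpha-\eta}]<\infty$ for some $\eta\in(0,\alpha)\cap(0,1]$. Let $R$ be the (unique in law) solution of $R\stackrel{d}{=}AR+B$ with $R$ and $(A,B)$ independent. Then, as $x\to\infty$, $$x^{\alpha}\,\mathbb{P}(R<-x)\sim\frac1\rho\int_0^x\frac{L_1(t)}{t}\,dt .$$ If, in addition to (1)–(4), the function $L(x):=x^{\alpha}\mathbb{P}(B>x)$ is slowly varying, $\mathbb{E}B_+^{\alpha}=\infty$, $\mathbb{E}B_-^{\alpha-\varepsilon}<\infty$ for all $\varepsilon\in(0,\alpha)$, and $\mathbb{E}[A^{\eta'}B_+^{\alpha-\eta'}]<\infty$ for some $\eta'\in(0,\alpha)\cap(0,1]$, then both $$x^{\alpha}\,\mathbb{P}(R>x)\sim\frac1\rho\int_0^x\frac{L(t)}{t}\,dt\quad\text{and}\quad x^{\alpha}\,\mathbb{P}(R<-x)\sim\frac1\rho\int_0^x\frac{L_1(t)}{t}\,dt$$ hold as $x\to\infty$ (with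 possibly different slowly varying functions $L$ and $L_1$).
   Context: $a_+=\max\{a,0\}$ and $a_-=\max\{-a,0\}$. $f(x)\sim g(x)$ means $\lim_{x\to\infty}f(x)/g(x)=1$. A measurable $L:(0,\infty)\to(0,\infty)$ is slowly varying if $L(\lambda x)/L(x)\to1$ as $x\to\infty$ for every $\lambda>0$. A law on $\mathbb{R}$ is arithmetic if it is supported in $d\mathbb{Z}$ for some $d>0$, and non-arithmetic otherwise. The convention $0^\alpha\log 0=0$ is used. The assumptions guarantee $\mathbb{E}\log|A|<0$ and $\mathbb{E}\log^+|B|<\infty$, under which a solution $R$ of $R\stackrel{d}{=}AR+B$ ($R$ independent of $(A,B)$) exists and is unique in law. *)

theory Defs
  imports "HOL-Probability.Probability" "HOL-Library.Landau_Symbols"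
begin

definition slowly_varying :: "(real \<Rightarrow> real) \<Rightarrow> bool" where
  "slowly_varying L \<longleftrightarrow>
     L \<in> borel_measurable (restrict_space borel {0<..}) \<and>
     (\<forall>x>0. L x > 0) \<and>
     (\<forall>c>0. ((\<lambda>x. L (c * x) / L x) \<longlongrightarrow> 1) at_top)"

text \<open>Almost sure membership in \<open>d\<int>\<close> is support in \<open>d\<int>\<close>, since that set is closed; a point mass
  is arithmetic.\<close>

definition arithmetic_law :: "real measure \<Rightarrow> bool" where
  "arithmetic_law \<mu> \<longleftrightarrow> (\<exists>d>0. AE x in \<mu>. \<exists>k::int. x = d * of_int k)"

definition pos_part :: "real \<Rightarrow> real" where
  "pos_part a = max a 0"

definition neg_part :: "real \<Rightarrow> real" where
  "neg_part a = max (- a) 0"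

text \<open>The library's \<open>indep_var\<close> requires both variables to have the same value type, which
  excludes a real variable against a pair. The following asks that the generated
  \<open>\<sigma>\<close>-algebras be independent.\<close>

definition indep_rv ::
    "'a measure \<Rightarrow> 'b measure \<Rightarrow> ('a \<Rightarrow> 'b) \<Rightarrow> 'c measure \<Rightarrow> ('a \<Rightarrow> 'c) \<Rightarrow> bool" where
  "indep_rv M S X T Y \<longleftrightarrow>
     prob_space.indep_set M
       {X -` U \<inter> space M | U. U \<in> sets S}
       {Y -` V \<inter> space M | V. V \<in> sets T}"

text \<open>\<open>R\<close> lives on the same probability space as \<open>(A, B)\<close>, is independent of this pair, and
  has the same law as \<open>A R + B\<close>.\<close>

definition solves_affine_eq ::
    "'a measure \<Rightarrow> ('a \<Rightarrow> real) \<Rightarrow> ('a \<Rightarrow> real) \<Rightarrow> ('a \<Rightarrow> real) \<Rightarrow> bool" where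
  "solves_affine_eq M A B R \<longleftrightarrow>
     R \<in> borel_measurable M \<and>
     indep_rv M borel R (borel \<Otimes>\<^sub>M borel) (\<lambda>\<omega>. (A \<omega>, B \<omega>)) \<and>
     distr M borel R = distr M borel (\<lambda>\<omega>. A \<omega> * R \<omega> + B \<omega>)"

end

(* Let V_x(z) = min(z^+, x)^alpha. With S(x) = E V_x(R) and T(x) = E V_x(B), stationarity gives
   S(x) - E[A^alpha S(x/A)] = E[V_x(AR + B) - V_x(AR)], and the right-hand side is asymptotic to
   T(x) = alpha int_0^x L(t)/t dt, which is slowly varying. A Lyapunov function of the form
   min(z^alpha, x^(alpha/2) z^(alpha/2)) shows that x^alpha P(R > x) = O(T(x)), so the functions
   y |-> (S(x e^y) - S(x)) / T(x) are locally equicontinuous; every limit F of them satisfies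
   E[A^alpha (F(y) - F(y - log A))] = 1. Its increments are therefore bounded harmonic functions of
   the random walk with step log A under the law tilted by A^alpha, hence constant by the
   Choquet-Deny theorem, and F(y) = y / rho. Monotonicity of P(R > x) then gives the tail of R. The
   lower tail is the upper tail for (A, -B, -R). *)

theory Submission
  imports Defs "HOL-Complex_Analysis.Great_Picard"
begin

subsection \<open>Truncated powers\<close>

text \<open>The tail of R can jump, so equicontinuity fails for it; its truncated moment S
  integrates r(t)/t and is therefore Lipschitz in ln x, with a constant of order T. As E B_+^alpha
  is infinite, T tends to infinity, and every contribution bounded in x drops out; this is how the
  mixed moment of A and B_+ disposes of the interaction between A R and B_+. Nothing comparable is
  assumed about A together with B_-: the natural bound for lowering A R by B_- is of size A^(alpha -
  eta) B_-^eta, a critical case in which Hoelder would ask for E B_-^alpha. That effect is bounded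
  instead by T times a logarithm of B_-/A, integrable against A^alpha, and is o(T) by dominated
  convergence. The Lyapunov function must bend at x because E A^alpha = 1 leaves z^alpha without
  drift, while every smaller positive exponent contracts strictly. Harmonic functions are constant
  only if bounded: slow variation of T gives the limits F a global Lipschitz constant, which bounds
  their increments.\<close>

lemma powr_less_weighted_mean:
  fixes u c :: real
  assumes "0 < u" "u \<noteq> 1" "0 < c" "c < 1"
  shows "u powr c < (1 - c) + c * u"
proof -
  have strict: "1 + ln w < w" if "0 < w" "w \<noteq> 1" for w :: real
    using ln_le_minus_one[OF that(1)] ln_eq_minus_one[of w] that by fastforce
  have ne: "u powr s \<noteq> 1" if "s \<noteq> 0" for s using assms that by (simp add: powr_eq_one_iff_gen)
  have "1 + (- c) * ln u < u powr (- c)" "1 + (1 - c) * ln u < u powr (1 - c)"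
    using strict[of "u powr (- c)"] strict[of "u powr (1 - c)"] ne[of "- c"] ne[of "1 - c"] assms
    by (auto simp: ln_powr)
  then have "(1 - c) * (1 + (- c) * ln u) + c * (1 + (1 - c) * ln u)
      < (1 - c) * u powr (- c) + c * u powr (1 - c)"
    using assms by (intro add_strict_mono mult_strict_left_mono) auto
  then have "u powr c * 1 < u powr c * ((1 - c) * u powr (- c) + c * u powr (1 - c))"
    using assms by (intro mult_strict_left_mono) (auto simp: algebra_simps)
  also have "\<dots> = (1 - c) * (u powr c * u powr (- c)) + c * (u powr c * u powr (1 - c))"
    by (simp add: algebra_simps)
  also have "\<dots> = (1 - c) + c * u"
    using assms by (simp flip: powr_add)
  finally show ?thesis by simp
qed

lemma powr_le_weighted_mean:
  fixes u c :: real
  assumes "0 \<le> u" "0 < c" "c \<le> 1"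
  shows "u powr c \<le> (1 - c) + c * u"
proof (cases "u = 0 \<or> u = 1 \<or> c = 1")
  case False
  then show ?thesis using powr_less_weighted_mean[of u c] assms by simp
qed (use assms in auto)

text \<open>The chord of \<open>exp\<close> over [0, \<alpha>] treats exponents below and above 1
  together; enlarging \<open>t = b / a\<close> to \<open>t powr \<eta>\<close> gives the form of the
  mixed moment.\<close>

lemma powr_add_diff_le:
  fixes a b \<alpha> \<eta> :: real
  assumes "0 \<le> b" "b \<le> a" "0 < \<alpha>" "0 < \<eta>" "\<eta> \<le> 1"
  shows "(a + b) powr \<alpha> - a powr \<alpha> \<le> exp \<alpha> * (b powr \<eta> * a powr (\<alpha> - \<eta>))"
proof (cases "b = 0")
  case False
  then have b: "0 < b" and a: "0 < a" using assms by auto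
  define t where "t = b / a"
  have t: "0 < t" "t \<le> 1" using a b assms by (auto simp: t_def)
  have "(1 + t) powr \<alpha> = exp (\<alpha> * ln (1 + t))" using t by (simp add: powr_def)
  also have "\<dots> \<le> exp (\<alpha> * t)"
    using ln_add_one_self_le_self[of t] t assms by simp
  also have "\<dots> \<le> 1 + t * exp \<alpha>"
  proof -
    have "exp ((1 - t) * 0 + t * \<alpha>) \<le> (1 - t) * exp 0 + t * exp \<alpha>"
      using convex_onD[OF exp_convex, of t 0 \<alpha>] t by simp
    then show ?thesis using t by (simp add: mult.commute)
  qed
  also have "t * exp \<alpha> \<le> t powr \<eta> * exp \<alpha>"
    using t assms powr_mono'[of \<eta> 1 t] by simp
  finally have *: "(1 + t) powr \<alpha> - 1 \<le> t powr \<eta> * exp \<alpha>" by simp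
  have "(a + b) powr \<alpha> - a powr \<alpha> = a powr \<alpha> * ((1 + t) powr \<alpha> - 1)"
  proof -
    have "a + b = a * (1 + t)" using a by (simp add: t_def field_simps)
    moreover have "(a * (1 + t)) powr \<alpha> = a powr \<alpha> * (1 + t) powr \<alpha>"
      using a t by (simp add: powr_mult)
    ultimately show ?thesis by (simp add: right_diff_distrib)
  qed
  also have "\<dots> \<le> a powr \<alpha> * (t powr \<eta> * exp \<alpha>)"
    using * by (intro mult_left_mono) auto
  also have "\<dots> = exp \<alpha> * (b powr \<eta> * a powr (\<alpha> - \<eta>))"
    using a b by (simp add: t_def powr_divide powr_diff)
  finally show ?thesis .
qed (use assms in auto)

lemma powr_le_mixed:
  fixes a b \<alpha> \<eta> :: real
  assumes "0 \<le> a" "a \<le> b" "0 < \<eta>" "\<eta> \<le> \<alpha>"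
  shows "a powr \<alpha> \<le> a powr \<eta> * b powr (\<alpha> - \<eta>)"
proof -
  have "a powr \<alpha> = a powr \<eta> * a powr (\<alpha> - \<eta>)"
    by (simp flip: powr_add)
  also have "\<dots> \<le> a powr \<eta> * b powr (\<alpha> - \<eta>)"
    using assms by (intro mult_left_mono powr_mono2) auto
  finally show ?thesis .
qed

text \<open>After division by \<open>b powr \<alpha>\<close> this is Bernoulli's inequality in
  \<open>t = a / b\<close> for \<alpha> above 1 and \<open>1 - t \<le> (1 - t) powr \<alpha>\<close>
  for \<alpha> at most 1; the constant \<open>1 + \<alpha>\<close> covers both.\<close>

lemma powr_diff_shift_le:
  fixes a b \<alpha> \<eta> :: real
  assumes "0 \<le> a" "0 \<le> b" "0 < \<alpha>" "0 < \<eta>" "\<eta> \<le> 1" "\<eta> \<le> \<alpha>"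
  shows "b powr \<alpha> - max (b - a) 0 powr \<alpha> \<le> (1 + \<alpha>) * (a powr \<eta> * b powr (\<alpha> - \<eta>))"
proof (cases "a \<le> b")
  case False
  have "b powr \<alpha> \<le> a powr \<eta> * b powr (\<alpha> - \<eta>)"
  proof -
    have "b powr \<alpha> = b powr \<eta> * b powr (\<alpha> - \<eta>)" by (simp flip: powr_add)
    also have "\<dots> \<le> a powr \<eta> * b powr (\<alpha> - \<eta>)"
      using assms False by (intro mult_right_mono powr_mono2) auto
    finally show ?thesis .
  qed
  moreover have "0 \<le> \<alpha> * (a powr \<eta> * b powr (\<alpha> - \<eta>))" using assms by simp
  moreover have "max (b - a) 0 powr \<alpha> = 0" using False by simp
  ultimately show ?thesis unfolding distrib_right by linarith
next
  case ab: True
  show ?thesis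
  proof (cases "b = 0 \<or> a = 0")
    case True then show ?thesis using assms ab by auto
  next
    case False
    then have b: "0 < b" and a: "0 < a" using assms by auto
    define t where "t = a / b"
    have t: "0 < t" "t \<le> 1" using a b ab by (auto simp: t_def)
    have "1 - (1 - t) powr \<alpha> \<le> (1 + \<alpha>) * t"
    proof (cases "\<alpha> \<le> 1")
      case True
      have "(1 - t) powr 1 \<le> (1 - t) powr \<alpha>" using t assms True by (intro powr_mono') auto
      moreover have "0 \<le> \<alpha> * t" using assms t by simp
      ultimately show ?thesis using t by (simp add: algebra_simps)
    next
      case False
      show ?thesis
      proof (cases "t = 1")
        case False
        then have t1: "t < 1" using t by simp
        \<comment> \<open>Bernoulli's inequality, read off from the weighted mean inequality with
          weight 1/\<alpha> at the point \<open>(1 - t) powr \<alpha>\<close>.\<close>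
        have "((1 - t) powr \<alpha>) powr (1 / \<alpha>) \<le> (1 - 1 / \<alpha>) + 1 / \<alpha> * (1 - t) powr \<alpha>"
          using t1 \<open>\<not> \<alpha> \<le> 1\<close> by (intro powr_le_weighted_mean) auto
        then have "\<alpha> * (1 - t) \<le> \<alpha> * ((1 - 1 / \<alpha>) + 1 / \<alpha> * (1 - t) powr \<alpha>)"
          using t1 assms by (intro mult_left_mono) (auto simp: powr_powr)
        then show ?thesis using t assms by (simp add: algebra_simps)
      qed (use assms in auto)
    qed
    also have "\<dots> \<le> (1 + \<alpha>) * t powr \<eta>"
      using t assms powr_mono'[of \<eta> 1 t] by (intro mult_left_mono) auto
    finally have *: "1 - (1 - t) powr \<alpha> \<le> (1 + \<alpha>) * t powr \<eta>" .
    have "b powr \<alpha> - max (b - a) 0 powr \<alpha> = b powr \<alpha> * (1 - (1 - t) powr \<alpha>)"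
    proof -
      have "max (b - a) 0 = b * (1 - t)" using b ab by (simp add: t_def field_simps)
      moreover have "(b * (1 - t)) powr \<alpha> = b powr \<alpha> * (1 - t) powr \<alpha>"
        using b t by (simp add: powr_mult)
      ultimately show ?thesis by (simp add: right_diff_distrib)
    qed
    also have "\<dots> \<le> b powr \<alpha> * ((1 + \<alpha>) * t powr \<eta>)" using * by (intro mult_left_mono) auto
    also have "\<dots> = (1 + \<alpha>) * (a powr \<eta> * b powr (\<alpha> - \<eta>))"
      using a b by (simp add: t_def powr_divide powr_diff)
    finally show ?thesis .
  qed
qed

section \<open>The truncated power and its increments\<close>

definition trunc_powr :: "real \<Rightarrow> real \<Rightarrow> real \<Rightarrow> real" where
  "trunc_powr \<alpha> x z = min (max z 0) x powr \<alpha>"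

lemma trunc_powr_measurable [measurable]:
  "(\<lambda>z. trunc_powr \<alpha> (f z) (g z)) \<in> borel_measurable N"
  if [measurable]: "f \<in> borel_measurable N" "g \<in> borel_measurable N"
  unfolding trunc_powr_def by measurable

lemma trunc_powr_nonneg [simp]: "0 \<le> trunc_powr \<alpha> x z"
  by (simp add: trunc_powr_def)

lemma trunc_powr_le: "0 \<le> \<alpha> \<Longrightarrow> 0 \<le> x \<Longrightarrow> trunc_powr \<alpha> x z \<le> x powr \<alpha>"
  unfolding trunc_powr_def by (intro powr_mono2) auto

lemma trunc_powr_le_powr: "0 \<le> \<alpha> \<Longrightarrow> 0 \<le> x \<Longrightarrow> trunc_powr \<alpha> x z \<le> max z 0 powr \<alpha>"
  unfolding trunc_powr_def by (intro powr_mono2) auto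

lemma trunc_powr_nonpos [simp]: "z \<le> 0 \<Longrightarrow> 0 \<le> x \<Longrightarrow> trunc_powr \<alpha> x z = 0"
  by (simp add: trunc_powr_def max_def min_def)

lemma trunc_powr_mono:
  "0 \<le> \<alpha> \<Longrightarrow> 0 \<le> x \<Longrightarrow> x \<le> y \<Longrightarrow> z \<le> w \<Longrightarrow> trunc_powr \<alpha> x z \<le> trunc_powr \<alpha> y w"
  unfolding trunc_powr_def by (intro powr_mono2) auto

lemma trunc_powr_scale:
  assumes "0 < c" "0 \<le> x"
  shows "trunc_powr \<alpha> x (c * z) = c powr \<alpha> * trunc_powr \<alpha> (x / c) z"
proof -
  have "max (c * z) 0 = c * max z 0" using assms by (simp add: max_mult_distrib_left)
  then have "min (max (c * z) 0) x = c * min (max z 0) (x / c)"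
    using assms by (simp add: min_mult_distrib_left)
  moreover have "(c * min (max z 0) (x / c)) powr \<alpha> = c powr \<alpha> * min (max z 0) (x / c) powr \<alpha>"
    using assms by (simp add: powr_mult)
  ultimately show ?thesis unfolding trunc_powr_def by simp
qed

text \<open>Truncation is a contraction applied to the power of the positive part, so the estimates
  derived from it hold uniformly in the level \<open>x\<close>.\<close>

lemma trunc_powr_lipschitz:
  assumes "0 \<le> \<alpha>" "0 \<le> x"
  shows "\<bar>trunc_powr \<alpha> x u - trunc_powr \<alpha> x v\<bar> \<le> \<bar>max u 0 powr \<alpha> - max v 0 powr \<alpha>\<bar>"
proof -
  have *: "trunc_powr \<alpha> x z = min (max z 0 powr \<alpha>) (x powr \<alpha>)" for z
  proof (cases "max z 0 \<le> x")
    case True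
    then have "max z 0 powr \<alpha> \<le> x powr \<alpha>" using assms by (intro powr_mono2) auto
    then show ?thesis using True by (simp add: trunc_powr_def min_def)
  next
    case False
    then have "x powr \<alpha> \<le> max z 0 powr \<alpha>" using assms by (intro powr_mono2) auto
    then show ?thesis using False by (auto simp: trunc_powr_def min_def)
  qed
  show ?thesis unfolding * by (auto simp: min_def)
qed

text \<open>The larger summand accounts for its own truncated power, and the rest is a product in
  which the smaller one carries an exponent at most 1: \<eta> if \<open>a\<close> is the smaller,
  \<zeta> if \<open>b\<close> is. Two exponents occur because the integrable mixed moments of A and
  B are not symmetric.\<close>

lemma trunc_powr_add_le:
  assumes "0 \<le> a" "0 \<le> b" "0 < \<alpha>" "0 \<le> x"
    and "0 < \<eta>" "\<eta> \<le> 1" "\<eta> \<le> \<alpha>" and "0 < \<zeta>" "\<zeta> \<le> 1" "\<zeta> \<le> \<alpha>"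
  shows "\<bar>trunc_powr \<alpha> x (a + b) - trunc_powr \<alpha> x a - trunc_powr \<alpha> x b\<bar>
    \<le> (1 + exp \<alpha>) * (a powr \<eta> * b powr (\<alpha> - \<eta>) + b powr \<zeta> * a powr (\<alpha> - \<zeta>))"
proof -
  have *: "\<bar>trunc_powr \<alpha> x (a + b) - trunc_powr \<alpha> x a - trunc_powr \<alpha> x b\<bar>
      \<le> (1 + exp \<alpha>) * (a powr \<eta> * b powr (\<alpha> - \<eta>))"
    if "0 \<le> a" "a \<le> b" "0 < \<eta>" "\<eta> \<le> 1" "\<eta> \<le> \<alpha>" for a b \<eta>
  proof -
    have "\<bar>trunc_powr \<alpha> x (a + b) - trunc_powr \<alpha> x b\<bar> \<le> \<bar>(a + b) powr \<alpha> - b powr \<alpha>\<bar>"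
      using trunc_powr_lipschitz[of \<alpha> x "a + b" b] assms that by simp
    also have "\<dots> = (b + a) powr \<alpha> - b powr \<alpha>"
      using that assms powr_mono2[of \<alpha> b "a + b"] by (simp add: add.commute)
    also have "\<dots> \<le> exp \<alpha> * (a powr \<eta> * b powr (\<alpha> - \<eta>))"
      using that assms by (intro powr_add_diff_le) auto
    finally have 1: "\<bar>trunc_powr \<alpha> x (a + b) - trunc_powr \<alpha> x b\<bar>
      \<le> exp \<alpha> * (a powr \<eta> * b powr (\<alpha> - \<eta>))" .
    have "trunc_powr \<alpha> x a \<le> a powr \<alpha>"
      using trunc_powr_le_powr[of \<alpha> x a] assms that by simp
    also have "\<dots> \<le> a powr \<eta> * b powr (\<alpha> - \<eta>)"
      using that assms by (intro powr_le_mixed) auto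
    finally have 2: "trunc_powr \<alpha> x a \<le> a powr \<eta> * b powr (\<alpha> - \<eta>)" .
    show ?thesis using 1 2 trunc_powr_nonneg[of \<alpha> x a] unfolding distrib_right by linarith
  qed
  have nn: "0 \<le> (1 + exp \<alpha>) * (a powr \<eta> * b powr (\<alpha> - \<eta>))"
    "0 \<le> (1 + exp \<alpha>) * (b powr \<zeta> * a powr (\<alpha> - \<zeta>))"
    by (auto intro!: mult_nonneg_nonneg add_nonneg_nonneg)
  show ?thesis
  proof (cases "a \<le> b")
    case True
    then have "\<bar>trunc_powr \<alpha> x (a + b) - trunc_powr \<alpha> x a - trunc_powr \<alpha> x b\<bar>
      \<le> (1 + exp \<alpha>) * (a powr \<eta> * b powr (\<alpha> - \<eta>))"
      using *[of a b \<eta>] assms by simp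
    then show ?thesis using nn unfolding distrib_left by linarith
  next
    case False
    then have "\<bar>trunc_powr \<alpha> x (b + a) - trunc_powr \<alpha> x b - trunc_powr \<alpha> x a\<bar>
      \<le> (1 + exp \<alpha>) * (b powr \<zeta> * a powr (\<alpha> - \<zeta>))"
      using *[of b a \<zeta>] assms by simp
    then show ?thesis using nn unfolding distrib_left add.commute[of b a] by linarith
  qed
qed

lemma trunc_powr_shift_le:
  assumes "0 \<le> a" "0 \<le> b" "0 < \<alpha>" "0 \<le> x" "0 < \<eta>" "\<eta> \<le> 1" "\<eta> \<le> \<alpha>"
  shows "trunc_powr \<alpha> x b - trunc_powr \<alpha> x (b - a) \<le> (1 + \<alpha>) * (a powr \<eta> * b powr (\<alpha> - \<eta>))"
proof -
  have "trunc_powr \<alpha> x b - trunc_powr \<alpha> x (b - a) \<le> \<bar>b powr \<alpha> - max (b - a) 0 powr \<alpha>\<bar>"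
    using trunc_powr_lipschitz[of \<alpha> x b "b - a"] assms by simp
  also have "\<dots> = b powr \<alpha> - max (b - a) 0 powr \<alpha>"
    using assms powr_mono2[of \<alpha> "max (b - a) 0" b] by simp
  finally show ?thesis using powr_diff_shift_le[of a b \<alpha> \<eta>] assms by simp
qed

text \<open>Together with its lower counterpart this translates between increments of a truncated
  moment and the tail; at the end it recovers the tail of R from S.\<close>

lemma trunc_powr_diff_upper:
  assumes "0 \<le> \<alpha>" "0 < x" "x \<le> y"
  shows "trunc_powr \<alpha> y z - trunc_powr \<alpha> x z \<le> (y powr \<alpha> - x powr \<alpha>) * indicator {x<..} z"
  using assms powr_mono2[of \<alpha> "min z y" y]
  by (auto simp: trunc_powr_def min_def max_def indicator_def split: if_splits)

lemma trunc_powr_diff_lower: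
  assumes "0 \<le> \<alpha>" "0 < x" "x \<le> y"
  shows "(y powr \<alpha> - x powr \<alpha>) * indicator {y<..} z \<le> trunc_powr \<alpha> y z - trunc_powr \<alpha> x z"
  using assms powr_mono2[of \<alpha> x y] powr_mono2[of \<alpha> x z]
  by (auto simp: trunc_powr_def min_def max_def indicator_def split: if_splits)

subsection \<open>Bounded harmonic functions of a random walk\<close>

context prob_space
begin

text \<open>With \<open>v(y) = E (H(y - \<xi>) - H(y))\<^sup>2\<close>, harmonicity gives \<open>v \<le> E v(\<cdot> - \<xi>)\<close>, so each application
  of the averaging operator to \<open>H\<^sup>2\<close> gains at least \<open>v\<close>; as \<open>H\<^sup>2\<close> is bounded, \<open>v = 0\<close>.\<close>

lemma bounded_harmonic_increment_eq_0:
  fixes \<xi> :: "'a \<Rightarrow> real" and H :: "real \<Rightarrow> real"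
  assumes [measurable]: "\<xi> \<in> borel_measurable M" "H \<in> borel_measurable borel"
    and bounded: "\<And>y. \<bar>H y\<bar> \<le> C"
    and harmonic: "\<And>y. H y = (\<integral>w. H (y - \<xi> w) \<partial>M)"
  shows "AE w in M. H (y - \<xi> w) = H y"
proof -
  interpret P: pair_prob_space M M ..
  have int: "integrable M (\<lambda>w. f (z - \<xi> w))"
    if "f \<in> borel_measurable borel" "\<And>y. \<bar>f y\<bar> \<le> K" for f :: "real \<Rightarrow> real" and z K
    using that by (intro integrable_const_bound[where B=K]) auto
  define v where "v z = (\<integral>w. (H (z - \<xi> w) - H z)\<^sup>2 \<partial>M)" for z
  define Q where "Q = rec_nat (\<lambda>z. (H z)\<^sup>2) (\<lambda>_ g z. \<integral>w. g (z - \<xi> w) \<partial>M)"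
  have Q0: "Q 0 = (\<lambda>z. (H z)\<^sup>2)" and QS: "Q (Suc n) = (\<lambda>z. \<integral>w. Q n (z - \<xi> w) \<partial>M)" for n
    by (simp_all add: Q_def)
  have C: "0 \<le> C" using bounded[of 0] by linarith
  have H2: "(H z)\<^sup>2 \<le> C\<^sup>2" for z using bounded[of z] C by (simp add: abs_le_square_iff[symmetric])
  have [measurable]: "v \<in> borel_measurable borel" unfolding v_def by measurable
  have d_bound: "(H z - H z')\<^sup>2 \<le> (2 * C)\<^sup>2" for z z'
    using bounded[of z] bounded[of z'] C by (subst abs_le_square_iff[symmetric]) auto
  have v_nonneg: "0 \<le> v z" for z unfolding v_def by simp
  have v_bound: "v z \<le> (2 * C)\<^sup>2" for z
    unfolding v_def using d_bound
    by (intro integral_le_const integrable_const_bound[where B="(2 * C)\<^sup>2"]) auto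
  have Qm: "Q n \<in> borel_measurable borel \<and> (\<forall>z. \<bar>Q n z\<bar> \<le> C\<^sup>2)" for n
  proof (induction n)
    case 0
    then show ?case using H2 by (simp add: Q0)
  next
    case (Suc n)
    then have [measurable]: "Q n \<in> borel_measurable borel" by simp
    have "\<bar>\<integral>w. Q n (z - \<xi> w) \<partial>M\<bar> \<le> C\<^sup>2" for z
    proof -
      have "\<bar>\<integral>w. Q n (z - \<xi> w) \<partial>M\<bar> \<le> (\<integral>w. \<bar>Q n (z - \<xi> w)\<bar> \<partial>M)"
        by (rule integral_abs_bound)
      also have "\<dots> \<le> C\<^sup>2" using Suc
        by (intro integral_le_const integrable_const_bound[where B="C\<^sup>2"]) auto
      finally show ?thesis .
    qed
    then show ?case by (auto simp: QS)
  qed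
  then have Q_meas [measurable]: "\<And>n. Q n \<in> borel_measurable borel"
    and Q_bound: "\<And>n z. \<bar>Q n z\<bar> \<le> C\<^sup>2" by auto
  have v_eq: "v z = (\<integral>w. (H (z - \<xi> w))\<^sup>2 \<partial>M) - (H z)\<^sup>2" for z
  proof -
    have "v z = (\<integral>w. (H (z - \<xi> w))\<^sup>2 - 2 * H z * H (z - \<xi> w) + (H z)\<^sup>2 \<partial>M)"
      unfolding v_def by (simp add: power2_diff algebra_simps)
    also have "\<dots> = (\<integral>w. (H (z - \<xi> w))\<^sup>2 \<partial>M) - 2 * H z * (\<integral>w. H (z - \<xi> w) \<partial>M) + (H z)\<^sup>2"
      using int[of "\<lambda>z. (H z)\<^sup>2" "C\<^sup>2" z] int[of H C z] H2 bounded by (simp add: prob_space)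
    finally show ?thesis using harmonic[of z] by (simp add: power2_eq_square)
  qed
  have v_sub: "v z \<le> (\<integral>w'. v (z - \<xi> w') \<partial>M)" for z
  proof -
    let ?f = "\<lambda>w w'. (H (z - \<xi> w' - \<xi> w) - H (z - \<xi> w'))\<^sup>2"
    have int2: "integrable (M \<Otimes>\<^sub>M M) (\<lambda>(w, w'). ?f w w')"
      using d_bound by (intro P.integrable_const_bound[where B="(2 * C)\<^sup>2"]) auto
    have "(H (z - \<xi> w) - H z)\<^sup>2 \<le> (\<integral>w'. ?f w w' \<partial>M)" for w
    proof -
      let ?g = "\<lambda>w'. H (z - \<xi> w' - \<xi> w) - H (z - \<xi> w')"
      have i1: "integrable M (\<lambda>w'. H (z - \<xi> w' - \<xi> w))"
        using int[of "\<lambda>y. H (y - \<xi> w)" C z] bounded by simp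
      have i2: "integrable M (\<lambda>w'. H (z - \<xi> w'))" using int[of H C z] bounded by simp
      have i3: "integrable M (\<lambda>w'. (?g w')\<^sup>2)"
        using d_bound by (intro integrable_const_bound[where B="(2 * C)\<^sup>2"]) auto
      \<comment> \<open>Translations commute, so harmonicity at \<open>z\<close> and at
        \<open>z - \<xi> w\<close> writes the increment as a mean over an independent copy. Jensen's
        inequality for the square is then the nonnegativity of a variance.\<close>
      have "H (z - \<xi> w) - H z = (\<integral>w'. ?g w' \<partial>M)"
        using harmonic[of z] harmonic[of "z - \<xi> w"] i1 i2 by (simp add: algebra_simps)
      moreover have "(\<integral>w'. ?g w' \<partial>M)\<^sup>2 \<le> (\<integral>w'. (?g w')\<^sup>2 \<partial>M)"
        using variance_positive[of ?g]
        unfolding variance_eq[OF Bochner_Integration.integrable_diff[OF i1 i2] i3] by linarith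
      ultimately show ?thesis by simp
    qed
    then have "v z \<le> (\<integral>w. (\<integral>w'. ?f w w' \<partial>M) \<partial>M)"
      unfolding v_def using d_bound P.integrable_fst'[OF int2]
      by (intro integral_mono) (auto intro!: integrable_const_bound[where B="(2 * C)\<^sup>2"])
    also have "\<dots> = (\<integral>w'. (\<integral>w. ?f w w' \<partial>M) \<partial>M)"
      using P.Fubini_integral[OF int2] by simp
    finally show ?thesis by (simp add: v_def)
  qed
  have Q_ge: "(H z)\<^sup>2 + real n * v z \<le> Q n z" for n z
  proof (induction n arbitrary: z)
    case (Suc n)
    have "(H z)\<^sup>2 + real (Suc n) * v z \<le> (\<integral>w. (H (z - \<xi> w))\<^sup>2 \<partial>M) + n * (\<integral>w. v (z - \<xi> w) \<partial>M)"
      using v_eq[of z] mult_left_mono[OF v_sub[of z], of "real n"] by (simp add: algebra_simps)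
    also have "\<dots> = (\<integral>w. (H (z - \<xi> w))\<^sup>2 + n * v (z - \<xi> w) \<partial>M)"
      using int[of "\<lambda>z. (H z)\<^sup>2" "C\<^sup>2" z] int[of v "(2 * C)\<^sup>2" z] H2 v_nonneg v_bound by simp
    also have "\<dots> \<le> (\<integral>w. Q n (z - \<xi> w) \<partial>M)"
      using int[of "\<lambda>z. (H z)\<^sup>2" "C\<^sup>2" z] int[of v "(2 * C)\<^sup>2" z] int[OF Q_meas Q_bound, of n z]
        H2 v_nonneg v_bound Suc.IH
      by (intro integral_mono) auto
    finally show ?case by (simp add: QS)
  qed (simp add: Q0)
  have "v y = 0"
  proof (rule ccontr)
    assume "v y \<noteq> 0"
    with v_nonneg[of y] have "0 < v y" by simp
    then obtain n :: nat where "C\<^sup>2 < n * v y"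
      using reals_Archimedean3[of "v y"] by blast
    then show False using Q_ge[of y n] Q_bound[of n y] zero_le_power2[of "H y"] by linarith
  qed
  moreover have "integrable M (\<lambda>w. (H (y - \<xi> w) - H y)\<^sup>2)"
    using d_bound by (intro integrable_const_bound[where B="(2 * C)\<^sup>2"]) auto
  ultimately have "AE w in M. (H (y - \<xi> w) - H y)\<^sup>2 = 0"
    unfolding v_def by (subst (asm) integral_nonneg_eq_0_iff_AE) auto
  then show ?thesis by simp
qed

text \<open>The periods of \<open>H\<close> form a closed subgroup \<open>G\<close> of the line that
  contains almost every value of \<xi>. If \<open>G\<close> has arbitrarily small positive elements
  it is the whole line; otherwise it lies in a lattice, which \<open>non_lattice\<close>
  excludes.\<close>

lemma bounded_continuous_harmonic_const:
  fixes \<xi> :: "'a \<Rightarrow> real" and H :: "real \<Rightarrow> real"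
  assumes meas [measurable]: "\<xi> \<in> borel_measurable M"
    and cont: "continuous_on UNIV H"
    and bounded: "\<And>y. \<bar>H y\<bar> \<le> C"
    and harmonic: "\<And>y. H y = (\<integral>w. H (y - \<xi> w) \<partial>M)"
    and non_lattice: "\<And>d. 0 < d \<Longrightarrow> \<not> (AE w in M. \<exists>k::int. \<xi> w = d * of_int k)"
  shows "H y = H 0"
proof -
  have [measurable]: "H \<in> borel_measurable borel"
    using cont by (rule borel_measurable_continuous_onI)
  define G where "G = {a. \<forall>y. H (y - a) = H y}"
  have AE_G: "AE w in M. \<xi> w \<in> G"
  proof -
    \<comment> \<open>The exceptional null set depends on \<open>y\<close>; countably many
      \<open>y\<close> share one, and continuity of \<open>H\<close> extends the identity from the
      rationals.\<close>
    have "AE w in M. \<forall>y\<in>\<rat>. H (y - \<xi> w) = H y"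
      using bounded_harmonic_increment_eq_0[OF meas _ bounded harmonic]
      by (subst AE_ball_countable) (auto simp: countable_rat)
    then show ?thesis
    proof eventually_elim
      case (elim w)
      have "closed {y. H (y - \<xi> w) = H y}"
        by (intro closed_Collect_eq continuous_on_compose2[OF cont] continuous_intros cont) auto
      moreover have "\<rat> \<subseteq> {y. H (y - \<xi> w) = H y}" using elim by auto
      ultimately have "closure \<rat> \<subseteq> {y. H (y - \<xi> w) = H y}" by (rule closure_minimal[rotated])
      then show ?case unfolding Rats_closure_real G_def by auto
    qed
  qed
  have G_minus: "- a \<in> G" if "a \<in> G" for a
    using that unfolding G_def by (simp, metis add_diff_cancel)
  have G_add: "a + b \<in> G" if "a \<in> G" "b \<in> G" for a b
    using that unfolding G_def by (simp add: diff_diff_eq[symmetric])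
  have G_0: "0 \<in> G" by (simp add: G_def)
  have G_nat: "real n * a \<in> G" if "a \<in> G" for a n
    by (induction n) (use that G_add G_0 in \<open>auto simp: algebra_simps\<close>)
  have G_int: "of_int k * a \<in> G" if "a \<in> G" for a and k :: int
    by (cases k rule: int_cases2) (use that G_nat G_minus in \<open>fastforce+\<close>)
  have G_closed: "closed G"
  proof -
    have "G = (\<Inter>y. {a. H (y - a) = H y})" by (auto simp: G_def)
    then show ?thesis
      by (auto intro!: closed_INT closed_Collect_eq continuous_on_compose2[OF cont] continuous_intros)
  qed
  show ?thesis
  proof (cases "\<forall>e>0. \<exists>g\<in>G. 0 < g \<and> g < e")
    case True
    have "y \<in> closure G" for y
    proof (subst closure_approachable, intro allI impI)
      fix e :: real assume "0 < e"
      then obtain g where g: "g \<in> G" "0 < g" "g < e" using True by blast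
      let ?z = "of_int \<lfloor>y / g\<rfloor> * g"
      have "?z \<le> y" using g floor_divide_lower[of g y] by simp
      moreover have "y < ?z + g"
        using g floor_divide_upper[of g y] by (simp add: algebra_simps)
      ultimately have "dist ?z y < e" using g by (simp add: dist_real_def)
      then show "\<exists>z\<in>G. dist z y < e" using G_int[OF g(1)] by blast
    qed
    then have "y \<in> G" using G_closed by simp
    then have "H (y - y) = H y" unfolding G_def by blast
    then show ?thesis by simp
  next
    case False
    then obtain e where e: "0 < e" "\<And>g. g \<in> G \<Longrightarrow> 0 < g \<Longrightarrow> e \<le> g"
      by (metis not_less)
    have "\<exists>d>0. \<forall>a\<in>G. \<exists>k::int. a = d * of_int k"
    proof (cases "\<exists>g\<in>G. 0 < g")
      case True
      define P where "P = {g \<in> G. 0 < g}"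
      define d where "d = Inf P"
      have P: "P \<noteq> {}" "bdd_below P" using True e by (auto simp: P_def bdd_below_def)
      have P_eq: "P = G \<inter> {e..}" using e by (auto simp: P_def)
      have "closed P" unfolding P_eq using G_closed by auto
      then have "d \<in> P" unfolding d_def using P by (intro closed_contains_Inf)
      then have d: "d \<in> G" "0 < d" by (auto simp: P_def)
      have "\<exists>k::int. a = d * of_int k" if "a \<in> G" for a
      proof -
        let ?k = "\<lfloor>a / d\<rfloor>"
        have m: "a - of_int ?k * d \<in> G"
          using G_add[OF that G_minus[OF G_int[OF d(1), of ?k]]] by simp
        have "0 \<le> a - of_int ?k * d" "a - of_int ?k * d < d"
          using d floor_divide_lower[of d a] floor_divide_upper[of d a] by (auto simp: algebra_simps)
        moreover have "d \<le> a - of_int ?k * d" if "0 < a - of_int ?k * d"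
          using cInf_lower[of "a - of_int ?k * d" P] m that P(2) by (simp add: P_def d_def)
        ultimately have "a = d * of_int ?k" by (force simp: algebra_simps)
        then show ?thesis by blast
      qed
      then show ?thesis using d by blast
    next
      case False
      have "a = 0" if "a \<in> G" for a
        using False that G_minus[OF that] by (metis neg_0_less_iff_less not_less_iff_gr_or_eq)
      \<comment> \<open>The trivial group lies in every lattice; the span 1 is an arbitrary
        choice.\<close>
      then have "\<forall>a\<in>G. \<exists>k::int. a = 1 * of_int k" by (auto intro!: exI[of _ 0])
      then show ?thesis using zero_less_one by blast
    qed
    then obtain d where "0 < d" and d: "\<And>a. a \<in> G \<Longrightarrow> \<exists>k::int. a = d * of_int k" by blast
    have "AE w in M. \<exists>k::int. \<xi> w = d * of_int k" using AE_G by eventually_elim (rule d)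
    then show ?thesis using non_lattice[OF \<open>0 < d\<close>] by blast
  qed
qed

end

subsection \<open>The truncated moment of a slowly varying tail\<close>

lemma ennreal_le_suminf: "f k \<le> (\<Sum>i. f i)" for f :: "nat \<Rightarrow> ennreal"
  using sum_le_suminf[OF summableI, of "{k}" f] by simp

locale slow_tail = prob_space M for M :: "'a measure" +
  fixes B :: "'a \<Rightarrow> real" and \<alpha> :: real
  assumes B_meas [measurable]: "B \<in> borel_measurable M"
    and alpha_pos: "0 < \<alpha>"
    and tail_pos: "\<And>x. 0 < x \<Longrightarrow> 0 < prob {w \<in> space M. x < B w}"
    and tail_slow: "\<And>c. 0 < c \<Longrightarrow>
      ((\<lambda>x. ((c * x) powr \<alpha> * prob {w \<in> space M. c * x < B w}) /
            (x powr \<alpha> * prob {w \<in> space M. x < B w})) \<longlongrightarrow> 1) at_top"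
    and B_plus_moment: "(\<integral>\<^sup>+w. ennreal (max (B w) 0 powr \<alpha>) \<partial>M) = \<infinity>"
begin

abbreviation V :: "real \<Rightarrow> real \<Rightarrow> real" where
  "V \<equiv> trunc_powr \<alpha>"

definition L :: "real \<Rightarrow> real" where
  "L x = x powr \<alpha> * prob {w \<in> space M. x < B w}"

definition T :: "real \<Rightarrow> real" where
  "T x = expectation (\<lambda>w. V x (B w))"

lemma integrable_trunc_powr:
  assumes [measurable]: "X \<in> borel_measurable M" and "0 \<le> x"
  shows "integrable M (\<lambda>w. V x (X w))"
  using assms(2) alpha_pos trunc_powr_le[of \<alpha> x]
  by (intro integrable_const_bound[where B="x powr \<alpha>"]) auto

lemma expectation_trunc_powr_diff:
  assumes [measurable]: "X \<in> borel_measurable M" and "0 < x" "x \<le> y"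
  shows "expectation (\<lambda>w. V y (X w)) - expectation (\<lambda>w. V x (X w))
      \<le> (y powr \<alpha> - x powr \<alpha>) * prob {w \<in> space M. x < X w}" (is ?upper)
    and "(y powr \<alpha> - x powr \<alpha>) * prob {w \<in> space M. y < X w}
      \<le> expectation (\<lambda>w. V y (X w)) - expectation (\<lambda>w. V x (X w))"
      (is ?lower)
proof -
  have int: "integrable M (\<lambda>w. V z (X w))" if "0 < z" for z
    using that by (intro integrable_trunc_powr) auto
  have ind: "expectation (\<lambda>w. (y powr \<alpha> - x powr \<alpha>) * indicator {z<..} (X w))
      = (y powr \<alpha> - x powr \<alpha>) * prob {w \<in> space M. z < X w}" for z
  proof -
    have "expectation (\<lambda>w. indicator {z<..} (X w) :: real)
        = expectation (indicator {w \<in> space M. z < X w})"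
      by (intro Bochner_Integration.integral_cong) (auto simp: indicator_def)
    then show ?thesis by simp
  qed
  have int_ind: "integrable M (\<lambda>w. (y powr \<alpha> - x powr \<alpha>) * indicator {z<..} (X w))" for z
    by (intro integrable_mult_right integrable_const_bound[where B=1]) (auto simp: indicator_def)
  have int_diff: "integrable M (\<lambda>w. V y (X w) - V x (X w))"
    using int assms by simp
  have eq: "expectation (\<lambda>w. V y (X w)) - expectation (\<lambda>w. V x (X w))
      = expectation (\<lambda>w. V y (X w) - V x (X w))"
    using int assms by simp
  show ?upper
    unfolding ind[of x, symmetric] eq using assms alpha_pos
    by (intro integral_mono int_diff int_ind trunc_powr_diff_upper) auto
  show ?lower
    unfolding ind[of y, symmetric] eq using assms alpha_pos
    by (intro integral_mono int_diff int_ind trunc_powr_diff_lower) auto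
qed

section \<open>Comparison of the tail of B with its truncated moment\<close>

lemma L_pos: "0 < x \<Longrightarrow> 0 < L x"
  using tail_pos[of x] by (simp add: L_def)

lemma T_mono: "0 \<le> x \<Longrightarrow> x \<le> y \<Longrightarrow> T x \<le> T y"
  unfolding T_def using alpha_pos
  by (intro integral_mono integrable_trunc_powr trunc_powr_mono) auto

lemma T_nonneg: "0 \<le> T x"
  by (simp add: T_def)

lemma T_diff_le:
  assumes "0 < x" "1 \<le> c"
  shows "T (c * x) - T x \<le> (c powr \<alpha> - 1) * L x"
  using expectation_trunc_powr_diff(1)[OF B_meas, of x "c * x"] assms
  by (simp add: T_def L_def powr_mult algebra_simps)

lemma T_half:
  assumes "0 < x"
  shows "T (x / 2) + (1 - (1/2) powr \<alpha>) * L x \<le> T x"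
  using expectation_trunc_powr_diff(2)[OF B_meas, of "x / 2" x] assms
  by (simp add: T_def L_def powr_divide algebra_simps)

lemma half_powr_less_1: "(1/2::real) powr \<alpha> < 1"
  using powr_less_mono2[of \<alpha> "1/2" 1] alpha_pos by simp

lemma T_pos: "0 < x \<Longrightarrow> 0 < T x"
  using T_half[of x] T_nonneg[of "x / 2"] mult_pos_pos[OF _ L_pos, of "1 - (1/2) powr \<alpha>" x]
    half_powr_less_1 by auto

lemma T_ge_sum:
  assumes "0 < x"
  shows "(1 - (1/2) powr \<alpha>) * (\<Sum>j<n. L (x / 2 ^ j)) \<le> T x"
  using assms
proof (induction n arbitrary: x)
  case (Suc n)
  have "(\<Sum>j<Suc n. L (x / 2 ^ j)) = L x + (\<Sum>j<n. L (x / 2 / 2 ^ j))"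
    by (simp add: sum.lessThan_Suc_shift del: sum.lessThan_Suc)
  then show ?case using Suc.IH[of "x / 2"] T_half[of x] Suc.prems by (simp add: algebra_simps)
qed (simp add: T_nonneg)

text \<open>Each dyadic scale \<open>x / 2 ^ j\<close> contributes a fixed multiple of
  \<open>L (x / 2 ^ j)\<close> to \<open>T x\<close>, and slow variation makes any fixed number of
  these contributions comparable to \<open>L x\<close>. Thus \<open>T x\<close> exceeds every
  multiple of \<open>L x\<close> eventually.\<close>

lemma L_over_T: "((\<lambda>x. L x / T x) \<longlongrightarrow> 0) at_top"
proof (rule tendstoI)
  fix e :: real assume "0 < e"
  define c where "c = 1 - (1/2::real) powr \<alpha>"
  have c: "0 < c" using half_powr_less_1 by (simp add: c_def)
  \<comment> \<open>The factor 2 makes up for the weaker bound \<open>n / 2\<close> on a sum whose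
    limit is \<open>n\<close>.\<close>
  obtain n :: nat where n: "2 / e < n * c"
    using reals_Archimedean3[OF c] by blast
  moreover have "0 < 2 / e" using \<open>0 < e\<close> by simp
  ultimately have "0 < n" by (cases n) auto
  have "((\<lambda>x. \<Sum>j<n. L ((1 / 2 ^ j) * x) / L x) \<longlongrightarrow> (\<Sum>j<n. 1)) at_top"
    using tail_slow unfolding L_def by (intro tendsto_sum tail_slow) simp
  then have "\<forall>\<^sub>F x in at_top. n / 2 < (\<Sum>j<n. L (x / 2 ^ j) / L x)"
    using \<open>0 < n\<close> by (intro order_tendstoD(1)[where y="real n"]) auto
  then show "\<forall>\<^sub>F x in at_top. dist (L x / T x) 0 < e"
    using eventually_gt_at_top[of 0]
  proof eventually_elim
    case (elim x)
    have "n / 2 * L x < (\<Sum>j<n. L (x / 2 ^ j))"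
      using elim L_pos[of x] by (simp flip: sum_divide_distrib add: field_simps)
    then have "c * (n / 2 * L x) \<le> c * (\<Sum>j<n. L (x / 2 ^ j))"
      using c by (intro mult_left_mono) auto
    also have "\<dots> \<le> T x" using T_ge_sum[of x n] elim by (simp add: c_def)
    finally have "(n * c) * L x \<le> 2 * T x" by (simp add: algebra_simps)
    moreover have "2 / e * L x < (n * c) * L x" using n L_pos[of x] elim by (intro mult_strict_right_mono) auto
    ultimately have "2 / e * L x < 2 * T x" by linarith
    then show ?case using T_pos[of x] L_pos[of x] elim \<open>0 < e\<close> by (simp add: field_simps)
  qed
qed

text \<open>For \<open>c \<ge> 1\<close> the increment \<open>T (c * x) - T x\<close> is at most a
  multiple of \<open>L x\<close>, which is o(T x); smaller \<open>c\<close> follow by taking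
  reciprocals at the point \<open>c * x\<close>.\<close>

lemma T_slow:
  assumes "0 < c"
  shows "((\<lambda>x. T (c * x) / T x) \<longlongrightarrow> 1) at_top"
proof -
  have *: "((\<lambda>x. T (c * x) / T x) \<longlongrightarrow> 1) at_top" if "1 \<le> c" for c
  proof (rule tendsto_sandwich)
    show "\<forall>\<^sub>F x in at_top. 1 \<le> T (c * x) / T x"
      using eventually_gt_at_top[of 0]
    proof eventually_elim
      case (elim x)
      have "x \<le> c * x" using elim that by simp
      then show ?case using elim T_mono[of x "c * x"] T_pos[of x] by simp
    qed
    show "\<forall>\<^sub>F x in at_top. T (c * x) / T x \<le> 1 + (c powr \<alpha> - 1) * (L x / T x)"
      using eventually_gt_at_top[of 0]
    proof eventually_elim
      case (elim x)
      then show ?case using T_diff_le[of x c] T_pos[of x] that by (simp add: field_simps)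
    qed
    show "((\<lambda>x. 1 + (c powr \<alpha> - 1) * (L x / T x)) \<longlongrightarrow> 1) at_top"
      by (rule tendsto_eq_intros L_over_T | simp)+
  qed simp
  show ?thesis
  proof (cases "1 \<le> c")
    case False
    have "filterlim (\<lambda>x. c * x) at_top at_top"
      using assms by (simp add: filterlim_tendsto_pos_mult_at_top[OF tendsto_const _ filterlim_ident])
    from filterlim_compose[OF *[of "1 / c"] this]
    have "((\<lambda>x. inverse (T x / T (c * x))) \<longlongrightarrow> inverse 1) at_top"
      using assms False by (intro tendsto_inverse) auto
    then show ?thesis by simp
  qed (rule *)
qed

text \<open>Monotone convergence turns the infinite \<alpha>-moment of B_+ into divergence of
  \<open>T\<close>; after division by \<open>T\<close> all bounded errors vanish.\<close>

lemma T_at_top: "filterlim T at_top at_top"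
proof -
  have "\<exists>x>0. K < T x" for K
  proof (rule ccontr)
    assume "\<not> ?thesis"
    then have K: "T x \<le> K" if "0 < x" for x using that by (metis not_less)
    have "(\<integral>\<^sup>+w. ennreal (max (B w) 0 powr \<alpha>) \<partial>M)
        = (\<integral>\<^sup>+w. (SUP n. ennreal (V (real n) (B w))) \<partial>M)"
    proof (intro nn_integral_cong antisym)
      fix w
      obtain n :: nat where "max (B w) 0 \<le> n" using real_arch_simple by blast
      then have "V (real n) (B w) = max (B w) 0 powr \<alpha>"
        by (simp add: trunc_powr_def min_def)
      then show "ennreal (max (B w) 0 powr \<alpha>) \<le> (SUP n. ennreal (V (real n) (B w)))"
        by (intro SUP_upper2[of n]) auto
      show "(SUP n. ennreal (V (real n) (B w))) \<le> ennreal (max (B w) 0 powr \<alpha>)"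
        using alpha_pos by (intro SUP_least ennreal_leI trunc_powr_le_powr) auto
    qed
    also have "\<dots> = (SUP n. \<integral>\<^sup>+w. ennreal (V (real n) (B w)) \<partial>M)"
      using alpha_pos
      by (intro nn_integral_monotone_convergence_SUP)
        (auto simp: incseq_def le_fun_def intro!: ennreal_leI trunc_powr_mono)
    also have "\<dots> \<le> ennreal K"
    proof (rule SUP_least)
      fix n :: nat
      have "(\<integral>\<^sup>+w. ennreal (V (real n) (B w)) \<partial>M) = ennreal (T n)"
        unfolding T_def by (intro nn_integral_eq_integral integrable_trunc_powr) auto
      also have "\<dots> \<le> ennreal K"
        using T_mono[of n "n + 1"] K[of "n + 1"] by (intro ennreal_leI) auto
      finally show "(\<integral>\<^sup>+w. ennreal (V (real n) (B w)) \<partial>M) \<le> ennreal K" .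
    qed
    finally show False using B_plus_moment by (simp add: top_unique)
  qed
  show ?thesis
  proof (subst filterlim_at_top, intro allI)
    fix K
    obtain x where "0 < x" "K < T x" using \<open>\<And>K. \<exists>x>0. K < T x\<close> by blast
    then show "\<forall>\<^sub>F y in at_top. K \<le> T y"
      using T_mono[of x] by (intro eventually_at_top_linorderI[of x]) (meson less_imp_le order_trans)
  qed
qed

text \<open>Potter's bound, by iterating \<open>T (2 * x) \<le> 2 powr \<epsilon> * T x\<close>; the
  extra factor \<open>2 powr \<epsilon>\<close> pays for rounding \<open>log 2 c\<close> up to an
  integer.\<close>

lemma T_potter:
  assumes "0 < \<epsilon>"
  shows "\<exists>x\<^sub>0\<ge>1. \<forall>x\<ge>x\<^sub>0. \<forall>c\<ge>1. T (c * x) \<le> 2 powr \<epsilon> * c powr \<epsilon> * T x"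
proof -
  have "\<forall>\<^sub>F x in at_top. T (2 * x) / T x < 2 powr \<epsilon>"
    using assms by (intro order_tendstoD(2)[OF T_slow]) auto
  then obtain x\<^sub>1 where x1: "\<And>x. x\<^sub>1 \<le> x \<Longrightarrow> T (2 * x) / T x < 2 powr \<epsilon>"
    by (auto simp: eventually_at_top_linorder)
  define x\<^sub>0 where "x\<^sub>0 = max x\<^sub>1 1"
  have step: "T (2 * x) \<le> 2 powr \<epsilon> * T x" if "x\<^sub>0 \<le> x" for x
    using x1[of x] T_pos[of x] that by (simp add: x\<^sub>0_def field_simps)
  have pow: "T (2 ^ n * x) \<le> (2 powr \<epsilon>) ^ n * T x" if "x\<^sub>0 \<le> x" for x n
  proof (induction n)
    case (Suc n)
    have "x \<le> 2 ^ n * x" using that by (simp add: x\<^sub>0_def)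
    then have "T (2 * (2 ^ n * x)) \<le> 2 powr \<epsilon> * T (2 ^ n * x)"
      using that by (intro step) simp
    also have "\<dots> \<le> 2 powr \<epsilon> * ((2 powr \<epsilon>) ^ n * T x)" using Suc by simp
    finally show ?case by (simp add: algebra_simps)
  qed simp
  show ?thesis
  proof (intro exI[of _ x\<^sub>0] conjI allI impI)
    fix x c :: real assume x: "x\<^sub>0 \<le> x" and c: "1 \<le> c"
    define n where "n = nat \<lceil>log 2 c\<rceil>"
    have n: "log 2 c \<le> n" "n \<le> log 2 c + 1"
      using c zero_le_log_cancel_iff[of 2 c] unfolding n_def by linarith+
    have "c \<le> 2 ^ n" using n c by (simp add: log_le_iff powr_realpow)
    then have "T (c * x) \<le> T (2 ^ n * x)" using x c by (intro T_mono) (auto simp: x\<^sub>0_def)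
    also have "\<dots> \<le> (2 powr \<epsilon>) ^ n * T x" using x by (rule pow)
    also have "(2 powr \<epsilon>) ^ n = 2 powr (\<epsilon> * n)" by (simp add: powr_powr flip: powr_realpow)
    also have "2 powr (\<epsilon> * n) \<le> 2 powr (\<epsilon> * (log 2 c + 1))"
      using n assms by (intro powr_mono) auto
    also have "\<dots> = 2 powr \<epsilon> * c powr \<epsilon>"
      using c by (simp add: powr_add powr_powr[symmetric] distrib_left mult.commute[of \<epsilon> "log 2 c"])
    finally show "T (c * x) \<le> 2 powr \<epsilon> * c powr \<epsilon> * T x"
      using T_nonneg[of x] by (simp add: mult_right_mono)
  qed (simp add: x\<^sub>0_def)
qed

text \<open>Above \<open>x\<close> the integrand is cut into dyadic shells. On the shell at
  \<open>2 ^ k * x\<close> it is a factor 2^(-\<theta> k) below the truncated power of that level,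
  up to a constant, while Potter's bound lets \<open>T (2 ^ k * x)\<close> grow only like
  2^(\<theta> k / 2), so the shells sum geometrically.\<close>

lemma truncated_moment_le_T:
  assumes \<theta>: "0 < \<theta>" "\<theta> < \<alpha>"
  shows "\<exists>C>0. \<exists>x\<^sub>0\<ge>1. \<forall>x\<ge>x\<^sub>0.
    (\<integral>\<^sup>+w. ennreal (min (max (B w) 0 powr \<alpha>) (x powr \<theta> * max (B w) 0 powr (\<alpha> - \<theta>))) \<partial>M)
      \<le> ennreal (C * T x)"
proof -
  obtain x\<^sub>0 where x0: "1 \<le> x\<^sub>0"
    and potter: "\<And>x c. x\<^sub>0 \<le> x \<Longrightarrow> 1 \<le> c \<Longrightarrow> T (c * x) \<le> 2 powr (\<theta>/2) * c powr (\<theta>/2) * T x"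
    using T_potter[of "\<theta> / 2"] \<theta> by auto
  \<comment> \<open>The decay per shell is \<open>q\<^sup>2\<close>; one factor \<open>q\<close> is
    spent on the growth of \<open>T\<close>, the other is the ratio of the geometric series.\<close>
  define q where "q = (2::real) powr (- \<theta> / 2)"
  have q: "0 < q" "q < 1" using \<theta> powr_less_mono[of "- \<theta> / 2" 0 "2::real"] by (auto simp: q_def)
  have two_pow: "(2 ^ k) powr s = 2 powr (s * real k)" for k s
    by (simp add: powr_powr mult.commute flip: powr_realpow)
  have q_pow': "q ^ k = 2 powr (- \<theta> / 2 * real k)" for k
    unfolding q_def by (subst powr_power) (auto simp: mult.commute)
  have q_pow: "q\<^sup>2 ^ k = 2 powr (- \<theta> * real k)" for k
    unfolding power2_eq_square power_mult_distrib q_pow' by (simp flip: powr_add)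
  define C where "C = 2 powr \<alpha> * 2 powr (\<theta>/2) * (1 / (1 - q))"
  have "0 < C" using q by (simp add: C_def)
  have "(\<integral>\<^sup>+w. ennreal (min (max (B w) 0 powr \<alpha>) (x powr \<theta> * max (B w) 0 powr (\<alpha> - \<theta>))) \<partial>M)
      \<le> ennreal (C * T x)" if x: "x\<^sub>0 \<le> x" for x
  proof -
    let ?g = "\<lambda>b. min (max b 0 powr \<alpha>) (x powr \<theta> * max b 0 powr (\<alpha> - \<theta>))"
    have x_pos: "0 < x" using x x0 by simp
    have pw: "\<exists>k::nat. ?g b
        \<le> 2 powr \<alpha> * (q\<^sup>2 ^ k * V (2 ^ k * x) b)" for b
    proof (cases "b \<le> x")
      case True
      have "max b 0 powr \<alpha> \<le> 2 powr \<alpha> * (max b 0 powr \<alpha>)"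
        using alpha_pos ge_one_powr_ge_zero[of 2 \<alpha>] mult_right_mono[of 1 "2 powr \<alpha>" "max b 0 powr \<alpha>"]
        by simp
      then show ?thesis using True x_pos
        by (intro exI[of _ 0]) (simp add: trunc_powr_def min_le_iff_disj)
    next
      case False
      define k where "k = nat \<lfloor>log 2 (b / x)\<rfloor>"
      have b: "x < b" "0 < b" using False x_pos by auto
      have "0 \<le> log 2 (b / x)" using b x_pos by (simp add: zero_le_log_cancel_iff)
      then have k: "k \<le> log 2 (b / x)" "log 2 (b / x) < k + 1"
        unfolding k_def by linarith+
      have k1: "2 ^ k * x \<le> b" using k(1) b x_pos by (simp add: le_log_iff powr_realpow field_simps)
      have k2: "b \<le> 2 * (2 ^ k * x)"
        using k(2) b x_pos by (simp add: log_less_iff powr_add powr_realpow field_simps)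
      have "x powr \<theta> * b powr (\<alpha> - \<theta>) = b powr \<alpha> * (x / b) powr \<theta>"
        using b x_pos by (simp add: powr_divide powr_diff)
      also have "\<dots> \<le> (2 * (2 ^ k * x)) powr \<alpha> * (1 / 2 ^ k) powr \<theta>"
        using b x_pos alpha_pos \<theta> k1 k2 by (intro mult_mono powr_mono2) (auto simp: field_simps)
      also have "\<dots> = 2 powr \<alpha> * ((1 / 2 ^ k) powr \<theta> * (2 ^ k * x) powr \<alpha>)"
        using x_pos by (simp add: powr_mult)
      also have "(1 / 2 ^ k) powr \<theta> = q\<^sup>2 ^ k"
        using q_pow[of k] two_pow[of k "- \<theta>"] by (simp add: powr_divide powr_minus_divide)
      finally have "x powr \<theta> * max b 0 powr (\<alpha> - \<theta>) \<le> 2 powr \<alpha> * (q\<^sup>2 ^ k * V (2 ^ k * x) b)"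
        using b k1 x_pos by (simp add: trunc_powr_def)
      then show ?thesis by (intro exI[of _ k]) (rule min.coboundedI2)
    qed
    have term_le: "q\<^sup>2 ^ k * T (2 ^ k * x) \<le> 2 powr (\<theta>/2) * T x * q ^ k" for k
    proof -
      have "q\<^sup>2 ^ k * T (2 ^ k * x) \<le> q\<^sup>2 ^ k * (2 powr (\<theta>/2) * (2 ^ k) powr (\<theta>/2) * T x)"
        by (rule mult_left_mono[OF potter[OF x]]) simp_all
      also have "\<dots> = 2 powr (\<theta>/2) * T x * q ^ k * (q ^ k * (2 ^ k) powr (\<theta>/2))"
        by (simp add: power2_eq_square power_mult_distrib)
      also have "q ^ k * (2 ^ k) powr (\<theta>/2) = 1"
        using q_pow'[of k] two_pow[of k "\<theta> / 2"] by (simp flip: powr_add)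
      finally show ?thesis by simp
    qed
    define D where "D = 2 powr \<alpha> * 2 powr (\<theta>/2) * T x"
    have D_nonneg: "0 \<le> D" by (simp add: D_def T_nonneg)
    have D_le: "2 powr \<alpha> * (q\<^sup>2 ^ k * T (2 ^ k * x)) \<le> D * q ^ k" for k
      using mult_left_mono[OF term_le, of "2 powr \<alpha>" k] by (simp add: D_def mult.assoc)
    have "(\<integral>\<^sup>+w. ennreal (?g (B w)) \<partial>M)
        \<le> (\<integral>\<^sup>+w. (\<Sum>k. ennreal (2 powr \<alpha> * (q\<^sup>2 ^ k * V (2 ^ k * x) (B w)))) \<partial>M)"
    proof (rule nn_integral_mono)
      fix w
      obtain k :: nat where
        "?g (B w)
          \<le> 2 powr \<alpha> * (q\<^sup>2 ^ k * V (2 ^ k * x) (B w))"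
        using pw by blast
      then have "ennreal (?g (B w))
          \<le> ennreal (2 powr \<alpha> * (q\<^sup>2 ^ k * V (2 ^ k * x) (B w)))"
        by (rule ennreal_leI)
        also have "\<dots> \<le> (\<Sum>k. ennreal (2 powr \<alpha> * (q\<^sup>2 ^ k * V (2 ^ k * x) (B w))))"
        by (rule ennreal_le_suminf)
      finally show "ennreal (?g (B w))
          \<le> (\<Sum>k. ennreal (2 powr \<alpha> * (q\<^sup>2 ^ k * V (2 ^ k * x) (B w))))" .
    qed
    also have "\<dots> = (\<Sum>k. \<integral>\<^sup>+w. ennreal (2 powr \<alpha> * (q\<^sup>2 ^ k * V (2 ^ k * x) (B w))) \<partial>M)"
      by (rule nn_integral_suminf) measurable
    also have "\<dots> = (\<Sum>k. ennreal (2 powr \<alpha> * (q\<^sup>2 ^ k * T (2 ^ k * x))))"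
    proof (intro suminf_cong)
      fix k
      show "(\<integral>\<^sup>+w. ennreal (2 powr \<alpha> * (q\<^sup>2 ^ k * V (2 ^ k * x) (B w))) \<partial>M)
          = ennreal (2 powr \<alpha> * (q\<^sup>2 ^ k * T (2 ^ k * x)))"
        unfolding T_def
          Bochner_Integration.integral_mult_right_zero[symmetric, of "2 powr \<alpha>"]
          Bochner_Integration.integral_mult_right_zero[symmetric, of "q\<^sup>2 ^ k"]
        using x_pos q
        by (intro nn_integral_eq_integral Bochner_Integration.integrable_mult_right
          integrable_trunc_powr B_meas) auto
    qed
    also have "\<dots> \<le> (\<Sum>k. ennreal (D * q ^ k))"
      using D_le by (intro suminf_le ennreal_leI) (auto intro: summableI)
    also have "\<dots> = ennreal (\<Sum>k. D * q ^ k)"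
      using q D_nonneg by (intro suminf_ennreal2 summable_mult summable_geometric mult_nonneg_nonneg) simp_all
    also have "(\<Sum>k. D * q ^ k) = C * T x"
      using q suminf_mult[OF summable_geometric, of q D] by (simp add: C_def D_def suminf_geometric)
    finally show ?thesis .
  qed
  then show ?thesis using \<open>0 < C\<close> x0 by blast
qed

text \<open>Slow variation of the tail supplies the moments of order below \<alpha>: the estimate
  with \<open>\<alpha> - \<theta>\<close> in place of \<theta>, at one fixed level
  \<open>x \<ge> 1\<close>, dominates \<open>max (B w) 0 powr \<theta>\<close> up to an additive
  1.\<close>

lemma integrable_B_plus_powr:
  assumes \<theta>: "0 < \<theta>" "\<theta> < \<alpha>"
  shows "integrable M (\<lambda>w. max (B w) 0 powr \<theta>)"
proof -
  obtain C x where x: "1 \<le> x" and le: "(\<integral>\<^sup>+w. ennreal (min (max (B w) 0 powr \<alpha>)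
      (x powr (\<alpha> - \<theta>) * max (B w) 0 powr (\<alpha> - (\<alpha> - \<theta>)))) \<partial>M) \<le> ennreal (C * T x)"
    using truncated_moment_le_T[of "\<alpha> - \<theta>"] \<theta> by auto
  have "(\<integral>\<^sup>+w. ennreal (max (B w) 0 powr \<theta>) \<partial>M)
      \<le> (\<integral>\<^sup>+w. 1 + ennreal (min (max (B w) 0 powr \<alpha>)
          (x powr (\<alpha> - \<theta>) * max (B w) 0 powr (\<alpha> - (\<alpha> - \<theta>)))) \<partial>M)"
  proof (rule nn_integral_mono)
    fix w
    have "max (B w) 0 powr \<theta> \<le> 1 + min (max (B w) 0 powr \<alpha>) (x powr (\<alpha> - \<theta>) * max (B w) 0 powr \<theta>)"
    proof (cases "max (B w) 0 \<le> 1")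
      case True
      then have "max (B w) 0 powr \<theta> \<le> 1" using \<theta> by (intro powr_le1) auto
      moreover have "0 \<le> min (max (B w) 0 powr \<alpha>) (x powr (\<alpha> - \<theta>) * max (B w) 0 powr \<theta>)" by simp
      ultimately show ?thesis by linarith
    next
      case False
      then have "max (B w) 0 powr \<theta> \<le> max (B w) 0 powr \<alpha>" using \<theta> by (intro powr_mono) auto
      moreover have "1 * max (B w) 0 powr \<theta> \<le> x powr (\<alpha> - \<theta>) * max (B w) 0 powr \<theta>"
        using x \<theta> by (intro mult_right_mono ge_one_powr_ge_zero) auto
      ultimately show ?thesis by (simp add: min_def)
    qed
    then have "ennreal (max (B w) 0 powr \<theta>)
      \<le> ennreal (1 + min (max (B w) 0 powr \<alpha>) (x powr (\<alpha> - \<theta>) * max (B w) 0 powr \<theta>))"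
      by (rule ennreal_leI)
    then show "ennreal (max (B w) 0 powr \<theta>) \<le> 1 + ennreal (min (max (B w) 0 powr \<alpha>)
          (x powr (\<alpha> - \<theta>) * max (B w) 0 powr (\<alpha> - (\<alpha> - \<theta>))))"
      by (subst (asm) ennreal_plus) auto
  qed
  also have "\<dots> \<le> 1 + ennreal (C * T x)"
    using le by (subst nn_integral_add) (auto simp: emeasure_space_1)
  also have "\<dots> < \<infinity>" by simp
  finally show ?thesis by (intro integrableI_bounded) auto
qed

end

subsection \<open>Moments of perpetuities\<close>

lemma powr_add_le:
  fixes a b \<theta> :: real
  assumes "0 \<le> a" "0 \<le> b" "0 < \<theta>" "\<theta> \<le> 1"
  shows "(a + b) powr \<theta> \<le> a powr \<theta> + b powr \<theta>"
proof (cases "a + b = 0")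
  case False
  define s where "s = a + b"
  have s: "0 < s" using False assms by (simp add: s_def)
  have *: "c / s \<le> (c / s) powr \<theta>" if "0 \<le> c" "c \<le> s" for c
    using powr_mono'[of \<theta> 1 "c / s"] that s assms by simp
  have "1 = a / s + b / s" using s by (simp add: s_def flip: add_divide_distrib)
  also have "\<dots> \<le> (a / s) powr \<theta> + (b / s) powr \<theta>"
    using assms by (intro add_mono *) (auto simp: s_def)
  finally have "s powr \<theta> * 1 \<le> s powr \<theta> * ((a / s) powr \<theta> + (b / s) powr \<theta>)"
    by (intro mult_left_mono) auto
  then show ?thesis using s assms by (simp add: powr_divide distrib_left s_def)
qed (use assms in auto)

text \<open>Stationarity is an integral identity with an independent copy \<open>w'\<close> for the
  variable R, so all later arguments take place on the product of M with itself. A is nonnegative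
  everywhere, which lets \<open>A w powr \<alpha>\<close> and scalings by A be used without
  exceptional sets.\<close>

locale perpetuity = prob_space M for M :: "'a measure" +
  fixes A B R :: "'a \<Rightarrow> real" and \<alpha> :: real
  assumes A_meas [measurable]: "A \<in> borel_measurable M"
    and B_meas' [measurable]: "B \<in> borel_measurable M"
    and R_meas [measurable]: "R \<in> borel_measurable M"
    and A_nonneg: "\<And>w. 0 \<le> A w"
    and alpha_pos': "0 < \<alpha>"
    and stationary: "\<And>f :: real \<Rightarrow> ennreal. f \<in> borel_measurable borel \<Longrightarrow>
      (\<integral>\<^sup>+w. f (R w) \<partial>M) = (\<integral>\<^sup>+w. \<integral>\<^sup>+w'. f (A w * R w' + B w) \<partial>M \<partial>M)"
    and A_moment_int: "integrable M (\<lambda>w. A w powr \<alpha>)"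
    and A_moment: "expectation (\<lambda>w. A w powr \<alpha>) = 1"
    and A_log: "integrable M (\<lambda>w. A w powr \<alpha> * ln (A w))"
    and non_lattice: "\<And>d. 0 < d \<Longrightarrow> \<not> (AE w in M. 0 < A w \<longrightarrow> (\<exists>k::int. ln (A w) = d * of_int k))"
    and B_moment: "\<And>\<theta>. 0 < \<theta> \<Longrightarrow> \<theta> < \<alpha> \<Longrightarrow> integrable M (\<lambda>w. \<bar>B w\<bar> powr \<theta>)"
begin

sublocale pair: pair_prob_space M M ..

lemma A_not_AE_1: "\<not> (AE w in M. A w = 1)"
  using non_lattice[of 1] by (auto elim!: contrapos_nn eventually_mono)

text \<open>Strict concavity of u^(\<theta>/\<alpha>) at \<open>u = A w powr \<alpha>\<close>, whose
  mean is 1. Equality would force A = 1 almost surely, a lattice law.\<close>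

lemma A_powr_moment:
  assumes "0 < \<theta>" "\<theta> < \<alpha>"
  shows integrable_A_powr: "integrable M (\<lambda>w. A w powr \<theta>)"
    and expectation_A_powr_less_1: "expectation (\<lambda>w. A w powr \<theta>) < 1"
proof -
  define c where "c = \<theta> / \<alpha>"
  have c: "0 < c" "c < 1" "\<alpha> * c = \<theta>" using assms by (auto simp: c_def)
  define g where "g w = (1 - c) + c * A w powr \<alpha>" for w
  have le: "A w powr \<theta> \<le> g w" for w
    using powr_le_weighted_mean[of "A w powr \<alpha>" c] c by (simp add: g_def powr_powr)
  have g: "integrable M g" "expectation g = 1"
    unfolding g_def using A_moment_int A_moment by (simp_all add: prob_space)
  show int: "integrable M (\<lambda>w. A w powr \<theta>)"
    using le by (intro Bochner_Integration.integrable_bound[OF g(1)]) (auto intro: order_trans[OF _ abs_ge_self])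
  have "expectation (\<lambda>w. A w powr \<theta>) \<le> 1"
    using integral_mono[OF int g(1)] le g(2) by simp
  moreover have "expectation (\<lambda>w. A w powr \<theta>) \<noteq> 1"
  proof
    assume eq: "expectation (\<lambda>w. A w powr \<theta>) = 1"
    have "expectation (\<lambda>w. g w - A w powr \<theta>) = 0" using int g eq by simp
    then have "AE w in M. g w - A w powr \<theta> = 0"
      using int g le by (subst (asm) integral_nonneg_eq_0_iff_AE) auto
    then have "AE w in M. A w = 1"
    proof eventually_elim
      case (elim w)
      have "A w \<noteq> 0" using elim c by (auto simp: g_def)
      then have "0 < A w powr \<alpha>" by simp
      then have "A w powr \<alpha> = 1"
        using powr_less_weighted_mean[of "A w powr \<alpha>" c] c elim by (auto simp: g_def powr_powr)
      then show ?case using alpha_pos' A_nonneg[of w] \<open>A w \<noteq> 0\<close>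
        by (metis less_irrefl order_le_less powr_eq_one_iff_gen)
    qed
    then show False using A_not_AE_1 by simp
  qed
  ultimately show "expectation (\<lambda>w. A w powr \<theta>) < 1" by simp
qed

text \<open>With \<open>u = A w powr \<alpha>\<close> the function \<open>g\<close> is u ln u - u +
  1, which is nonnegative and vanishes only at u = 1; at A = 0 its value is 1. Since
  \<open>A w powr \<alpha> - 1\<close> has mean zero, the mean of \<open>g\<close> is \<alpha> times
  the quantity in question.\<close>

lemma rho_pos: "0 < expectation (\<lambda>w. A w powr \<alpha> * ln (A w))"
proof -
  define g where "g w = \<alpha> * (A w powr \<alpha> * ln (A w)) - (A w powr \<alpha> - 1)" for w
  have key: "0 \<le> g w \<and> (g w = 0 \<longrightarrow> A w = 1)" for w
  proof (cases "A w = 0")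
    case False
    then have A: "0 < A w" using A_nonneg[of w] by simp
    define u where "u = A w powr \<alpha>"
    have u: "0 < u" using A by (simp add: u_def)
    have g_eq: "g w = u * (inverse u - 1 - ln (inverse u))"
      using u A unfolding g_def u_def[symmetric]
      by (simp add: ln_inverse u_def[THEN arg_cong[where f=ln]] ln_powr right_diff_distrib
        distrib_left)
    have "0 \<le> g w" unfolding g_eq using u ln_le_minus_one[of "inverse u"] by simp
    moreover have "A w = 1" if "g w = 0"
    proof -
      have "inverse u = 1" using that u ln_eq_minus_one[of "inverse u"] by (simp add: g_eq)
      then have "A w powr \<alpha> = 1" by (simp add: u_def)
      then show ?thesis using alpha_pos' A by (metis less_irrefl powr_eq_one_iff_gen)
    qed
    ultimately show ?thesis by simp
  qed (simp add: g_def)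
  have int: "integrable M g"
    unfolding g_def using A_log A_moment_int
    by (intro Bochner_Integration.integrable_diff integrable_mult_right) auto
  have eq: "expectation g = \<alpha> * expectation (\<lambda>w. A w powr \<alpha> * ln (A w))"
    unfolding g_def using A_log A_moment_int A_moment by (simp add: prob_space)
  have "expectation g \<noteq> 0"
  proof
    assume "expectation g = 0"
    then have "AE w in M. g w = 0"
      using int key by (subst (asm) integral_nonneg_eq_0_iff_AE) auto
    then have "AE w in M. A w = 1" by eventually_elim (use key in auto)
    then show False using A_not_AE_1 by simp
  qed
  moreover have "0 \<le> expectation g" using key by (intro Bochner_Integration.integral_nonneg) auto
  ultimately have "0 < \<alpha> * expectation (\<lambda>w. A w powr \<alpha> * ln (A w))" using eq by linarith
  then show ?thesis using alpha_pos' by (simp add: zero_less_mult_iff)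
qed

text \<open>A Lyapunov argument: stationarity balances the expected loss \<open>D\<close> of \<open>V\<close> under multiplication
  by \<open>A\<close> against its gain \<open>W\<close> under addition of \<open>B\<close>.\<close>

lemma lyapunov:
  fixes V D :: "real \<Rightarrow> ennreal" and W :: "'a \<Rightarrow> 'a \<Rightarrow> ennreal"
  assumes [measurable]: "V \<in> borel_measurable borel" "D \<in> borel_measurable borel"
      "case_prod W \<in> borel_measurable (M \<Otimes>\<^sub>M M)"
    and fin: "(\<integral>\<^sup>+w. V (R w) \<partial>M) < \<infinity>"
    and loss: "\<And>z. (\<integral>\<^sup>+w. V (A w * z) \<partial>M) + D z \<le> V z"
    and gain: "\<And>w w'. V (A w * R w' + B w) \<le> V (A w * R w') + W w w'"
  shows "(\<integral>\<^sup>+w. D (R w) \<partial>M) \<le> (\<integral>\<^sup>+w. \<integral>\<^sup>+w'. W w w' \<partial>M \<partial>M)"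
proof -
  define X where "X = (\<integral>\<^sup>+w. \<integral>\<^sup>+w'. V (A w * R w') \<partial>M \<partial>M)"
  have "X = (\<integral>\<^sup>+w'. \<integral>\<^sup>+w. V (A w * R w') \<partial>M \<partial>M)"
    unfolding X_def by (rule pair.Fubini'[symmetric]) simp
  then have "X + (\<integral>\<^sup>+w. D (R w) \<partial>M)
      = (\<integral>\<^sup>+w'. (\<integral>\<^sup>+w. V (A w * R w') \<partial>M) + D (R w') \<partial>M)"
    by (subst nn_integral_add) auto
  also have "\<dots> \<le> (\<integral>\<^sup>+w. V (R w) \<partial>M)" by (intro nn_integral_mono loss)
  finally have 1: "X + (\<integral>\<^sup>+w. D (R w) \<partial>M) \<le> (\<integral>\<^sup>+w. V (R w) \<partial>M)" .
  \<comment> \<open>The a priori finite mean of \<open>V (R w)\<close> enters only here: it allows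
    \<open>X\<close> to be cancelled between the loss and the gain inequality.\<close>
  then have X: "X \<noteq> \<infinity>" using fin by (auto simp: top_unique)
  have "(\<integral>\<^sup>+w. V (R w) \<partial>M) = (\<integral>\<^sup>+w. \<integral>\<^sup>+w'. V (A w * R w' + B w) \<partial>M \<partial>M)"
    by (intro stationary) simp
  also have "\<dots> \<le> (\<integral>\<^sup>+w. \<integral>\<^sup>+w'. V (A w * R w') + W w w' \<partial>M \<partial>M)"
    by (intro nn_integral_mono gain)
  also have "\<dots> = (\<integral>\<^sup>+w. (\<integral>\<^sup>+w'. V (A w * R w') \<partial>M) + (\<integral>\<^sup>+w'. W w w' \<partial>M) \<partial>M)"
    by (intro nn_integral_cong nn_integral_add) auto
  also have "\<dots> = X + (\<integral>\<^sup>+w. \<integral>\<^sup>+w'. W w w' \<partial>M \<partial>M)"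
    unfolding X_def by (intro nn_integral_add) auto
  finally have "X + (\<integral>\<^sup>+w. D (R w) \<partial>M) \<le> X + (\<integral>\<^sup>+w. \<integral>\<^sup>+w'. W w w' \<partial>M \<partial>M)"
    using 1 by order
  then show ?thesis using X by (simp add: ennreal_add_left_cancel_le)
qed

lemma nn_integral_A_powr_le:
  assumes "0 < \<theta>" "\<theta> < \<alpha>" "0 \<le> c"
  shows "(\<integral>\<^sup>+w. ennreal (c * \<bar>A w * z\<bar> powr \<theta>) \<partial>M)
    = ennreal (expectation (\<lambda>w. A w powr \<theta>) * (c * \<bar>z\<bar> powr \<theta>))"
proof -
  have eq: "c * \<bar>A w * z\<bar> powr \<theta> = A w powr \<theta> * (c * \<bar>z\<bar> powr \<theta>)" for w
    using A_nonneg[of w] by (simp add: abs_mult powr_mult)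
  show ?thesis unfolding eq using assms
    by (subst nn_integral_eq_integral) (auto intro!: integrable_mult_left integrable_A_powr)
qed

text \<open>No moment of R is known beforehand, so the Lyapunov function is capped at
  \<open>K\<close>. Subadditivity of the power makes the gain at most
  \<open>\<bar>B w\<bar> powr \<theta>\<close> whatever \<open>K\<close> is, and the loss below the
  cap passes to the limit by monotone convergence.\<close>

lemma R_small_moment:
  assumes \<theta>: "0 < \<theta>" "\<theta> \<le> 1" "\<theta> < \<alpha>"
  shows "integrable M (\<lambda>w. \<bar>R w\<bar> powr \<theta>)"
proof -
  define \<phi> where "\<phi> = expectation (\<lambda>w. A w powr \<theta>)"
  have \<phi>: "0 \<le> \<phi>" "\<phi> < 1" using expectation_A_powr_less_1[OF \<theta>(1,3)] by (auto simp: \<phi>_def)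
  define D where "D K z = ennreal ((1 - \<phi>) * \<bar>z\<bar> powr \<theta> * indicator {z. \<bar>z\<bar> powr \<theta> \<le> K} z)" for K z
  have [measurable]: "D K \<in> borel_measurable borel" for K unfolding D_def by measurable
  define c where "c = (\<integral>\<^sup>+w. ennreal (\<bar>B w\<bar> powr \<theta>) \<partial>M)"
  have c: "c < \<infinity>" unfolding c_def using B_moment[OF \<theta>(1,3)] by (simp add: nn_integral_eq_integral)
  have bound: "(\<integral>\<^sup>+w. D (real n) (R w) \<partial>M) \<le> c" for n
  proof -
    let ?K = "real n"
    let ?V = "\<lambda>z. ennreal (min (\<bar>z\<bar> powr \<theta>) ?K)"
    have "(\<integral>\<^sup>+w. D ?K (R w) \<partial>M) \<le> (\<integral>\<^sup>+w. \<integral>\<^sup>+w'. ennreal (\<bar>B w\<bar> powr \<theta>) \<partial>M \<partial>M)"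
    proof (rule lyapunov[where V="?V"])
      have "(\<integral>\<^sup>+w. ?V (R w) \<partial>M) \<le> (\<integral>\<^sup>+w. ennreal ?K \<partial>M)"
        by (intro nn_integral_mono ennreal_leI) auto
      then show "(\<integral>\<^sup>+w. ?V (R w) \<partial>M) < \<infinity>" by (simp add: emeasure_space_1 le_less_trans)
    next
      fix z
      have "(\<integral>\<^sup>+w. ?V (A w * z) \<partial>M) \<le> (\<integral>\<^sup>+w. ennreal ?K \<partial>M)"
        by (intro nn_integral_mono ennreal_leI) auto
      then have K: "(\<integral>\<^sup>+w. ?V (A w * z) \<partial>M) \<le> ennreal ?K" by (simp add: emeasure_space_1)
      have "(\<integral>\<^sup>+w. ?V (A w * z) \<partial>M) \<le> (\<integral>\<^sup>+w. ennreal (1 * \<bar>A w * z\<bar> powr \<theta>) \<partial>M)"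
        by (intro nn_integral_mono ennreal_leI) auto
      then have p: "(\<integral>\<^sup>+w. ?V (A w * z) \<partial>M) \<le> ennreal (\<phi> * \<bar>z\<bar> powr \<theta>)"
        using nn_integral_A_powr_le[OF \<theta>(1,3), of 1 z] by (simp add: \<phi>_def)
      show "(\<integral>\<^sup>+w. ?V (A w * z) \<partial>M) + D ?K z \<le> ?V z"
      proof (cases "\<bar>z\<bar> powr \<theta> \<le> ?K")
        case True
        have "(\<integral>\<^sup>+w. ?V (A w * z) \<partial>M) + D ?K z
            \<le> ennreal (\<phi> * \<bar>z\<bar> powr \<theta>) + ennreal ((1 - \<phi>) * \<bar>z\<bar> powr \<theta>)"
          using True p by (intro add_mono) (auto simp: D_def)
        also have "\<dots> = ?V z"
          using True \<phi> by (subst ennreal_plus[symmetric]) (auto simp: left_diff_distrib mult_left_le_one_le)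
        finally show ?thesis .
      next
        case False
        then show ?thesis using K by (simp add: D_def)
      qed
    next
      fix w w'
      have "\<bar>A w * R w' + B w\<bar> powr \<theta> \<le> (\<bar>A w * R w'\<bar> + \<bar>B w\<bar>) powr \<theta>"
        using \<theta> by (intro powr_mono2) auto
      also have "\<dots> \<le> \<bar>A w * R w'\<bar> powr \<theta> + \<bar>B w\<bar> powr \<theta>"
        using \<theta> by (intro powr_add_le) auto
      finally have "min (\<bar>A w * R w' + B w\<bar> powr \<theta>) ?K
          \<le> min (\<bar>A w * R w'\<bar> powr \<theta>) ?K + \<bar>B w\<bar> powr \<theta>"
        using powr_ge_zero[of "\<bar>B w\<bar>" \<theta>] by linarith
      then show "?V (A w * R w' + B w) \<le> ?V (A w * R w') + ennreal (\<bar>B w\<bar> powr \<theta>)"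
        by (simp add: ennreal_leI flip: ennreal_plus)
    qed auto
    then show ?thesis by (simp add: c_def emeasure_space_1)
  qed
  have "(\<integral>\<^sup>+w. ennreal ((1 - \<phi>) * \<bar>R w\<bar> powr \<theta>) \<partial>M) = (\<integral>\<^sup>+w. (SUP n. D (real n) (R w)) \<partial>M)"
  proof (intro nn_integral_cong antisym)
    fix w
    obtain n :: nat where "\<bar>R w\<bar> powr \<theta> \<le> n" using real_arch_simple by blast
    then show "ennreal ((1 - \<phi>) * \<bar>R w\<bar> powr \<theta>) \<le> (SUP n. D (real n) (R w))"
      by (intro SUP_upper2[of n]) (auto simp: D_def)
    show "(SUP n. D (real n) (R w)) \<le> ennreal ((1 - \<phi>) * \<bar>R w\<bar> powr \<theta>)"
      using \<phi> by (intro SUP_least) (auto simp: D_def indicator_def)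
  qed
  also have "\<dots> = (SUP n. \<integral>\<^sup>+w. D (real n) (R w) \<partial>M)"
    using \<phi> by (intro nn_integral_monotone_convergence_SUP)
      (auto simp: incseq_def le_fun_def D_def indicator_def intro!: ennreal_leI)
  also have "\<dots> \<le> c" by (intro SUP_least bound)
  also have "\<dots> < \<infinity>" by (rule c)
  finally have "integrable M (\<lambda>w. (1 - \<phi>) * \<bar>R w\<bar> powr \<theta>)"
    using \<phi> by (intro integrableI_bounded) (auto simp: abs_mult)
  then show ?thesis using \<phi> by simp
qed

text \<open>Above 1 subadditivity is lost, and a bounded cap is replaced by a linear one,
  \<open>min (\<bar>z\<bar> powr \<theta>) (K * \<bar>z\<bar>)\<close>, whose mean is finite by the
  first moment already obtained. Both branches contract under multiplication by A, with common
  factor at most \<phi>, while adding B costs a small multiple of the function itself.\<close>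

lemma R_moment:
  assumes \<theta>: "0 < \<theta>" "\<theta> < \<alpha>"
  shows "integrable M (\<lambda>w. \<bar>R w\<bar> powr \<theta>)"
proof (cases "\<theta> \<le> 1")
  case True
  then show ?thesis using \<theta> by (intro R_small_moment)
next
  case False
  then have \<theta>1: "1 < \<theta>" "1 < \<alpha>" using \<theta> by auto
  define \<phi> where "\<phi> = max (expectation (\<lambda>w. A w powr \<theta>)) (expectation (\<lambda>w. A w powr 1))"
  have \<phi>: "0 \<le> \<phi>" "\<phi> < 1"
    using expectation_A_powr_less_1[OF \<theta>] expectation_A_powr_less_1[of 1] \<theta>1
    by (auto simp: \<phi>_def max_def)
  have \<phi>_ge: "expectation (\<lambda>w. A w powr \<theta>) \<le> \<phi>" "expectation (\<lambda>w. A w powr 1) \<le> \<phi>"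
    by (auto simp: \<phi>_def)
  \<comment> \<open>Half of the gap \<open>1 - \<phi>\<close>: the gain \<open>\<delta> * V\<close>
    then uses up only half of the loss \<open>2 * \<delta> * V\<close>. The relative size
    \<open>s\<close> of an addition is chosen so that the \<theta>-th power grows by the factor
    \<open>1 + \<delta>\<close>.\<close>
  define \<delta> where "\<delta> = (1 - \<phi>) / 2"
  define s where "s = (1 + \<delta>) powr (1 / \<theta>) - 1"
  have \<delta>: "0 < \<delta>" using \<phi> by (simp add: \<delta>_def)
  have s: "0 < s" "(1 + s) powr \<theta> = 1 + \<delta>"
    using \<delta> \<theta> powr_less_mono2[of "1 / \<theta>" 1 "1 + \<delta>"] by (auto simp: s_def powr_powr)
  define C where "C = (1 + 1 / s) powr \<theta>"
  define V where "V K z = min (\<bar>z\<bar> powr \<theta>) (K * \<bar>z\<bar>)" for K z :: real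
  have [measurable]: "V K \<in> borel_measurable borel" for K unfolding V_def by measurable
  have V_nonneg: "0 \<le> V K z" if "0 \<le> K" for K z using that by (simp add: V_def)
  define c where "c = expectation (\<lambda>w. C * \<bar>B w\<bar> powr \<theta>)"
  have c: "0 \<le> c" by (simp add: c_def C_def)
  \<comment> \<open>If \<open>b\<close> is small relative to \<open>a\<close>, both branches grow by
    at most \<open>1 + \<delta>\<close>; otherwise \<open>a\<close> is itself bounded by a multiple
    of \<open>b\<close>, and the constant \<open>C\<close> does not depend on
    \<open>K\<close>.\<close>
  have V_gain: "V K (a + b) \<le> V K a + (\<delta> * V K a + C * \<bar>b\<bar> powr \<theta>)" if K: "0 \<le> K" for K a b
  proof (cases "\<bar>b\<bar> \<le> s * \<bar>a\<bar>")
    case True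
    then have ab: "\<bar>a + b\<bar> \<le> (1 + s) * \<bar>a\<bar>" by (simp add: algebra_simps)
    have "\<bar>a + b\<bar> powr \<theta> \<le> ((1 + s) * \<bar>a\<bar>) powr \<theta>" using ab \<theta> by (intro powr_mono2) auto
    also have "\<dots> = (1 + \<delta>) * \<bar>a\<bar> powr \<theta>" using s by (simp add: powr_mult)
    finally have 1: "\<bar>a + b\<bar> powr \<theta> \<le> (1 + \<delta>) * \<bar>a\<bar> powr \<theta>" .
    have "(1 + s) powr 1 \<le> (1 + s) powr \<theta>" using s \<theta>1 by (intro powr_mono) auto
    then have "1 + s \<le> 1 + \<delta>" using s by simp
    then have "(1 + s) * \<bar>a\<bar> \<le> (1 + \<delta>) * \<bar>a\<bar>" by (intro mult_right_mono) auto
    then have 2: "K * \<bar>a + b\<bar> \<le> (1 + \<delta>) * (K * \<bar>a\<bar>)"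
      using mult_left_mono[of "\<bar>a + b\<bar>" "(1 + \<delta>) * \<bar>a\<bar>" K] ab K by (simp add: mult_ac)
    have "V K (a + b) \<le> (1 + \<delta>) * V K a"
      unfolding V_def using 1 2 \<delta> by (subst min_mult_distrib_left) (auto simp: min_le_iff_disj min_def)
    moreover have "0 \<le> C * \<bar>b\<bar> powr \<theta>" by (simp add: C_def)
    ultimately show ?thesis by (simp add: algebra_simps)
  next
    case False
    then have "\<bar>a\<bar> \<le> \<bar>b\<bar> / s" using s by (simp add: field_simps)
    then have "\<bar>a + b\<bar> \<le> (1 + 1 / s) * \<bar>b\<bar>"
      using abs_triangle_ineq[of a b] unfolding distrib_right by simp
    then have "\<bar>a + b\<bar> powr \<theta> \<le> ((1 + 1 / s) * \<bar>b\<bar>) powr \<theta>" using \<theta> by (intro powr_mono2) auto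
    also have "\<dots> = C * \<bar>b\<bar> powr \<theta>" using s by (simp add: powr_mult C_def)
    finally have "V K (a + b) \<le> C * \<bar>b\<bar> powr \<theta>" by (simp add: V_def min_le_iff_disj)
    moreover have "0 \<le> V K a" "0 \<le> \<delta> * V K a" using V_nonneg[OF K] \<delta> by auto
    ultimately show ?thesis by linarith
  qed
  have V_loss: "(\<integral>\<^sup>+w. ennreal (V K (A w * z)) \<partial>M) \<le> ennreal (\<phi> * V K z)" if K: "0 \<le> K" for K z
  proof -
    have "(\<integral>\<^sup>+w. ennreal (V K (A w * z)) \<partial>M) \<le> (\<integral>\<^sup>+w. ennreal (1 * \<bar>A w * z\<bar> powr \<theta>) \<partial>M)"
      by (intro nn_integral_mono ennreal_leI) (auto simp: V_def)
    also have "\<dots> \<le> ennreal (\<phi> * \<bar>z\<bar> powr \<theta>)"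
      using \<phi>_ge by (subst nn_integral_A_powr_le[OF \<theta>]) (auto intro!: ennreal_leI mult_right_mono)
    finally have 1: "(\<integral>\<^sup>+w. ennreal (V K (A w * z)) \<partial>M) \<le> ennreal (\<phi> * \<bar>z\<bar> powr \<theta>)" .
    have "(\<integral>\<^sup>+w. ennreal (V K (A w * z)) \<partial>M) \<le> (\<integral>\<^sup>+w. ennreal (K * \<bar>A w * z\<bar> powr 1) \<partial>M)"
      by (intro nn_integral_mono ennreal_leI) (auto simp: V_def)
    also have "\<dots> \<le> ennreal (\<phi> * (K * \<bar>z\<bar>))"
      using \<phi>_ge \<theta>1 K
      by (subst nn_integral_A_powr_le) (auto intro!: ennreal_leI mult_right_mono)
    finally have 2: "(\<integral>\<^sup>+w. ennreal (V K (A w * z)) \<partial>M) \<le> ennreal (\<phi> * (K * \<bar>z\<bar>))" .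
    show ?thesis using 1 2 by (auto simp: V_def min_def)
  qed
  have bound: "(\<integral>\<^sup>+w. ennreal (V (real n) (R w)) \<partial>M) \<le> ennreal (c / \<delta>)" for n
  proof -
    let ?K = "real n"
    have "integrable M (\<lambda>w. \<bar>R w\<bar> powr 1)" using \<theta>1 by (intro R_small_moment) auto
    then have "integrable M (\<lambda>w. ?K * \<bar>R w\<bar>)" by (intro integrable_mult_right) simp
    then have V_int: "integrable M (\<lambda>w. V ?K (R w))"
      by (rule Bochner_Integration.integrable_bound) (auto simp: V_def)
    define v where "v = expectation (\<lambda>w. V ?K (R w))"
    have v: "(\<integral>\<^sup>+w. ennreal (V ?K (R w)) \<partial>M) = ennreal v"
      unfolding v_def using V_int V_nonneg by (intro nn_integral_eq_integral) auto
    have v_nonneg: "0 \<le> v" unfolding v_def using V_nonneg by (intro Bochner_Integration.integral_nonneg) auto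
    have "(\<integral>\<^sup>+w. ennreal ((1 - \<phi>) * V ?K (R w)) \<partial>M)
      \<le> (\<integral>\<^sup>+w. \<integral>\<^sup>+w'. ennreal (\<delta> * V ?K (A w * R w')) + ennreal (C * \<bar>B w\<bar> powr \<theta>) \<partial>M \<partial>M)"
    proof (rule lyapunov[where V="\<lambda>z. ennreal (V ?K z)"])
      show "(\<integral>\<^sup>+w. ennreal (V ?K (R w)) \<partial>M) < \<infinity>" using v by simp
      fix z
      have "(\<integral>\<^sup>+w. ennreal (V ?K (A w * z)) \<partial>M) + ennreal ((1 - \<phi>) * V ?K z)
          \<le> ennreal (\<phi> * V ?K z) + ennreal ((1 - \<phi>) * V ?K z)"
        by (intro add_mono V_loss) auto
      also have "\<dots> = ennreal (V ?K z)"
        using \<phi> V_nonneg[of ?K z] by (subst ennreal_plus[symmetric])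
          (auto simp: left_diff_distrib mult_left_le_one_le)
      finally show "(\<integral>\<^sup>+w. ennreal (V ?K (A w * z)) \<partial>M) + ennreal ((1 - \<phi>) * V ?K z)
          \<le> ennreal (V ?K z)" .
    next
      fix w w'
      show "ennreal (V ?K (A w * R w' + B w))
          \<le> ennreal (V ?K (A w * R w')) + (ennreal (\<delta> * V ?K (A w * R w')) + ennreal (C * \<bar>B w\<bar> powr \<theta>))"
        using V_gain[of ?K "A w * R w'" "B w"] V_nonneg[of ?K] \<delta>
        by (subst ennreal_plus[symmetric] | force simp: C_def intro!: ennreal_leI)+
    qed auto
    also have "\<dots> = (\<integral>\<^sup>+w. \<integral>\<^sup>+w'. ennreal (\<delta> * V ?K (A w * R w')) \<partial>M \<partial>M)
        + (\<integral>\<^sup>+w. ennreal (C * \<bar>B w\<bar> powr \<theta>) \<partial>M)"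
      by (simp add: nn_integral_add emeasure_space_1)
    also have "(\<integral>\<^sup>+w. ennreal (C * \<bar>B w\<bar> powr \<theta>) \<partial>M) = ennreal c"
      unfolding c_def by (intro nn_integral_eq_integral integrable_mult_right B_moment \<theta>) (simp add: C_def)
    also have "(\<integral>\<^sup>+w. \<integral>\<^sup>+w'. ennreal (\<delta> * V ?K (A w * R w')) \<partial>M \<partial>M) \<le> ennreal (\<delta> * v)"
    proof -
      have "(\<integral>\<^sup>+w. \<integral>\<^sup>+w'. ennreal (\<delta> * V ?K (A w * R w')) \<partial>M \<partial>M)
          = (\<integral>\<^sup>+w'. \<integral>\<^sup>+w. ennreal (\<delta> * V ?K (A w * R w')) \<partial>M \<partial>M)"
        by (rule pair.Fubini'[symmetric]) simp
      also have "\<dots> = (\<integral>\<^sup>+w'. ennreal \<delta> * (\<integral>\<^sup>+w. ennreal (V ?K (A w * R w')) \<partial>M) \<partial>M)"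
        using \<delta> V_nonneg[of ?K] by (simp add: ennreal_mult nn_integral_cmult)
      also have "\<dots> \<le> (\<integral>\<^sup>+w'. ennreal \<delta> * ennreal (V ?K (R w')) \<partial>M)"
      proof (intro nn_integral_mono mult_left_mono)
        fix w'
        have "\<phi> * V ?K (R w') \<le> 1 * V ?K (R w')" using \<phi> V_nonneg[of ?K] by (intro mult_right_mono) auto
        then show "(\<integral>\<^sup>+w. ennreal (V ?K (A w * R w')) \<partial>M) \<le> ennreal (V ?K (R w'))"
          using V_loss[of ?K "R w'"] by (auto intro: order_trans ennreal_leI)
      qed simp
      also have "\<dots> = ennreal (\<delta> * v)"
        using \<delta> v v_nonneg by (simp add: nn_integral_cmult ennreal_mult)
      finally show ?thesis .
    qed
    finally have "(\<integral>\<^sup>+w. ennreal ((1 - \<phi>) * V ?K (R w)) \<partial>M) \<le> ennreal (\<delta> * v) + ennreal c"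
      by (simp add: add_right_mono)
    also have "(\<integral>\<^sup>+w. ennreal ((1 - \<phi>) * V ?K (R w)) \<partial>M) = ennreal (2 * \<delta> * v)"
    proof -
      have "1 - \<phi> = 2 * \<delta>" by (simp add: \<delta>_def)
      then show ?thesis
        using \<delta> v v_nonneg V_nonneg[of ?K] by (simp add: nn_integral_cmult ennreal_mult)
    qed
    also have "ennreal (\<delta> * v) + ennreal c = ennreal (\<delta> * v + c)"
      using \<delta> v_nonneg c by (subst ennreal_plus) auto
    finally have "2 * \<delta> * v \<le> \<delta> * v + c" using \<delta> v_nonneg c by (subst (asm) ennreal_le_iff) auto
    then have "v \<le> c / \<delta>" using \<delta> by (simp add: field_simps)
    then show ?thesis using v by (simp add: ennreal_leI)
  qed
  have "(\<integral>\<^sup>+w. ennreal (\<bar>R w\<bar> powr \<theta>) \<partial>M) = (\<integral>\<^sup>+w. (SUP n. ennreal (V (real n) (R w))) \<partial>M)"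
  proof (intro nn_integral_cong antisym)
    fix w
    obtain n :: nat where n: "\<bar>R w\<bar> powr (\<theta> - 1) \<le> n" using real_arch_simple by blast
    have "\<bar>R w\<bar> powr \<theta> = \<bar>R w\<bar> powr (\<theta> - 1) * \<bar>R w\<bar>"
      by (cases "R w = 0") (auto simp: powr_diff)
    also have "\<dots> \<le> n * \<bar>R w\<bar>" using n by (intro mult_right_mono) auto
    finally show "ennreal (\<bar>R w\<bar> powr \<theta>) \<le> (SUP n. ennreal (V (real n) (R w)))"
      by (intro SUP_upper2[of n]) (auto simp: V_def)
    show "(SUP n. ennreal (V (real n) (R w))) \<le> ennreal (\<bar>R w\<bar> powr \<theta>)"
      by (intro SUP_least ennreal_leI) (auto simp: V_def)
  qed
  also have "\<dots> = (SUP n. \<integral>\<^sup>+w. ennreal (V (real n) (R w)) \<partial>M)"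
    by (intro nn_integral_monotone_convergence_SUP)
      (auto simp: incseq_def le_fun_def V_def min_le_iff_disj intro!: ennreal_leI mult_right_mono)
  also have "\<dots> \<le> ennreal (c / \<delta>)" by (intro SUP_least bound)
  also have "\<dots> < \<infinity>" by simp
  finally show ?thesis by (intro integrableI_bounded) auto
qed

end

subsection \<open>Tails and truncated moments\<close>

text \<open>Differentiability is asked only in the open interval: powers below 1 are not
  differentiable at 0, and the truncated moment of B is later integrated from 0.\<close>

lemma nn_integral_FTC_interior:
  fixes F f :: "real \<Rightarrow> real"
  assumes "u \<le> v" "continuous_on {u..v} F"
    and deriv: "\<And>t. u < t \<Longrightarrow> t < v \<Longrightarrow> (F has_real_derivative f t) (at t)"
    and nonneg: "\<And>t. u \<le> t \<Longrightarrow> t \<le> v \<Longrightarrow> 0 \<le> f t"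
  shows "(\<integral>\<^sup>+t. ennreal (indicator {u..v} t * f t) \<partial>lborel) = ennreal (F v - F u)"
proof -
  have "(f has_integral (F v - F u)) {u..v}"
    using assms by (intro fundamental_theorem_of_calculus_interior)
      (auto simp: has_real_derivative_iff_has_vector_derivative)
  then show ?thesis
    using nonneg by (intro nn_integral_has_integral_lebesgue) auto
qed

text \<open>The layer-cake formula at a single point: \<open>w\<close> is \<open>x\<close> clamped
  to [u, v], and the integrand lives on [u, w] up to end points.\<close>

lemma min_powr_eq_nn_integral:
  fixes u v x \<beta> :: real
  assumes "0 \<le> u" "u \<le> v" "0 < \<beta>"
  shows "ennreal (min (max x 0) v powr \<beta> - min (max x 0) u powr \<beta>)
    = (\<integral>\<^sup>+t. ennreal (indicator {u..v} t * (\<beta> * t powr (\<beta> - 1)) * indicator {..<x} t) \<partial>lborel)"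
proof -
  define w where "w = max u (min x v)"
  have w: "u \<le> w" "w \<le> v" using assms by (auto simp: w_def)
  have "(\<integral>\<^sup>+t. ennreal (indicator {u..v} t * (\<beta> * t powr (\<beta> - 1)) * indicator {..<x} t) \<partial>lborel)
      = (\<integral>\<^sup>+t. ennreal (indicator {u..w} t * (\<beta> * t powr (\<beta> - 1))) \<partial>lborel)"
  proof (intro nn_integral_cong_AE)
    have "AE t in lborel. t \<noteq> x \<and> t \<noteq> u" by (simp add: AE_lborel_singleton)
    then show "AE t in lborel. ennreal (indicator {u..v} t * (\<beta> * t powr (\<beta> - 1)) * indicator {..<x} t)
      = ennreal (indicator {u..w} t * (\<beta> * t powr (\<beta> - 1)))"
      by eventually_elim (auto simp: indicator_def w_def min_def max_def)
  qed
  also have "\<dots> = ennreal (w powr \<beta> - u powr \<beta>)"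
  proof -
    have "continuous_on {u..w} (\<lambda>t. t powr \<beta>)"
      using assms by (intro continuous_on_powr' continuous_intros) auto
    then show ?thesis
      using assms w by (intro nn_integral_FTC_interior) (auto intro!: derivative_eq_intros)
  qed
  also have "w powr \<beta> - u powr \<beta> = min (max x 0) v powr \<beta> - min (max x 0) u powr \<beta>"
    using assms by (cases "x \<le> u") (auto simp: w_def min_def max_def)
  finally show ?thesis by simp
qed

context prob_space
begin

lemma nn_integral_min_powr:
  fixes u v \<beta> :: real
  assumes [measurable]: "X \<in> borel_measurable M" and "0 \<le> u" "u \<le> v" "0 < \<beta>"
  shows "(\<integral>\<^sup>+w. ennreal (min (max (X w) 0) v powr \<beta> - min (max (X w) 0) u powr \<beta>) \<partial>M)
    = (\<integral>\<^sup>+t. ennreal (indicator {u..v} t * (\<beta> * t powr (\<beta> - 1)) * prob {w \<in> space M. t < X w}) \<partial>lborel)"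
proof -
  let ?k = "\<lambda>t. indicator {u..v} t * (\<beta> * t powr (\<beta> - 1))"
  interpret P: pair_sigma_finite M lborel ..
  have "(\<integral>\<^sup>+w. ennreal (min (max (X w) 0) v powr \<beta> - min (max (X w) 0) u powr \<beta>) \<partial>M)
      = (\<integral>\<^sup>+w. \<integral>\<^sup>+t. ennreal (?k t * indicator {..<X w} t) \<partial>lborel \<partial>M)"
    using assms by (intro nn_integral_cong min_powr_eq_nn_integral)
  also have "\<dots> = (\<integral>\<^sup>+t. \<integral>\<^sup>+w. ennreal (?k t * indicator {..<X w} t) \<partial>M \<partial>lborel)"
  proof (rule P.Fubini'[symmetric])
    have "(\<lambda>(w, t). ennreal (?k t * (if t < X w then 1 else 0)))
        \<in> borel_measurable (M \<Otimes>\<^sub>M lborel)"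
      by measurable
    then show "(\<lambda>(w, t). ennreal (?k t * indicator {..<X w} t))
        \<in> borel_measurable (M \<Otimes>\<^sub>M lborel)"
      by (simp add: indicator_def)
  qed
  also have "\<dots> = (\<integral>\<^sup>+t. ennreal (?k t * prob {w \<in> space M. t < X w}) \<partial>lborel)"
  proof (intro nn_integral_cong)
    fix t :: real
    have nn: "0 \<le> ?k t" using assms by simp
    have "(\<integral>\<^sup>+w. ennreal (?k t * indicator {..<X w} t) \<partial>M)
        = (\<integral>\<^sup>+w. ennreal (?k t) * indicator {w \<in> space M. t < X w} w \<partial>M)"
      by (intro nn_integral_cong) (auto simp: indicator_def)
    also have "\<dots> = ennreal (?k t) * ennreal (prob {w \<in> space M. t < X w})"
      by (subst nn_integral_cmult_indicator) (auto simp: emeasure_eq_measure)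
    finally show "(\<integral>\<^sup>+w. ennreal (?k t * indicator {..<X w} t) \<partial>M)
        = ennreal (?k t * prob {w \<in> space M. t < X w})"
      using nn by (simp add: ennreal_mult)
  qed
  finally show ?thesis .
qed

text \<open>Under a tail bound of order t^(-\<alpha>) the layer-cake formula leaves the integral of
  t^(\<beta> - \<alpha> - 1). Keeping its bound \<open>I\<close> as a parameter serves both cases: a
  logarithm for \<beta> = \<alpha>, and a power of the lower end point for \<beta> <
  \<alpha>.\<close>

lemma expectation_min_powr_diff_le:
  fixes u v \<beta> c I :: real and f :: "real \<Rightarrow> real"
  assumes X [measurable]: "X \<in> borel_measurable M" and uv: "0 < u" "u \<le> v" and "0 < \<beta>" "0 \<le> I"
    and tail: "\<And>t. u \<le> t \<Longrightarrow> t \<le> v \<Longrightarrow> t powr \<alpha> * prob {w \<in> space M. t < X w} \<le> c"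
    and I: "(\<integral>\<^sup>+t. ennreal (indicator {u..v} t * t powr (\<beta> - \<alpha> - 1)) \<partial>lborel) \<le> ennreal I"
  shows "expectation (\<lambda>w. min (max (X w) 0) v powr \<beta> - min (max (X w) 0) u powr \<beta>) \<le> \<beta> * c * I"
proof -
  have "0 \<le> u powr \<alpha> * prob {w \<in> space M. u < X w}" by simp
  then have c: "0 \<le> c" using tail[of u] uv by linarith
  have "(\<integral>\<^sup>+w. ennreal (min (max (X w) 0) v powr \<beta> - min (max (X w) 0) u powr \<beta>) \<partial>M)
      = (\<integral>\<^sup>+t. ennreal (indicator {u..v} t * (\<beta> * t powr (\<beta> - 1)) * prob {w \<in> space M. t < X w}) \<partial>lborel)"
    using assms by (intro nn_integral_min_powr) auto
  also have "\<dots> \<le> (\<integral>\<^sup>+t. ennreal (\<beta> * c) * ennreal (indicator {u..v} t * t powr (\<beta> - \<alpha> - 1)) \<partial>lborel)"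
  proof (intro nn_integral_mono)
    fix t :: real
    have "indicator {u..v} t * (\<beta> * t powr (\<beta> - 1)) * prob {w \<in> space M. t < X w}
        \<le> \<beta> * c * (indicator {u..v} t * t powr (\<beta> - \<alpha> - 1))"
    proof (cases "t \<in> {u..v}")
      case True
      have eq: "t powr (\<beta> - 1) = t powr (\<beta> - \<alpha> - 1) * t powr \<alpha>" by (simp flip: powr_add)
      have "\<beta> * t powr (\<beta> - \<alpha> - 1) * (t powr \<alpha> * prob {w \<in> space M. t < X w}) \<le> \<beta> * t powr (\<beta> - \<alpha> - 1) * c"
        using True tail \<open>0 < \<beta>\<close> by (intro mult_left_mono) auto
      then show ?thesis using True unfolding eq by (simp add: mult_ac)
    qed simp
    then show "ennreal (indicator {u..v} t * (\<beta> * t powr (\<beta> - 1)) * prob {w \<in> space M. t < X w})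
        \<le> ennreal (\<beta> * c) * ennreal (indicator {u..v} t * t powr (\<beta> - \<alpha> - 1))"
      using c \<open>0 < \<beta>\<close> by (subst ennreal_mult[symmetric]) (auto intro: ennreal_leI)
  qed
  also have "\<dots> = ennreal (\<beta> * c) * (\<integral>\<^sup>+t. ennreal (indicator {u..v} t * t powr (\<beta> - \<alpha> - 1)) \<partial>lborel)"
    by (intro nn_integral_cmult) simp
  also have "\<dots> \<le> ennreal (\<beta> * c) * ennreal I" by (intro mult_left_mono I) simp
  also have "\<dots> = ennreal (\<beta> * c * I)" using c \<open>0 < \<beta>\<close> \<open>0 \<le> I\<close> by (simp add: ennreal_mult)
  finally have le: "(\<integral>\<^sup>+w. ennreal (min (max (X w) 0) v powr \<beta> - min (max (X w) 0) u powr \<beta>) \<partial>M)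
      \<le> ennreal (\<beta> * c * I)" .
  have nn: "0 \<le> min (max (X w) 0) v powr \<beta> - min (max (X w) 0) u powr \<beta>" for w
    using uv \<open>0 < \<beta>\<close> powr_mono2[of \<beta> "min (max (X w) 0) u" "min (max (X w) 0) v"] by simp
  show ?thesis
    using le c nn \<open>0 < \<beta>\<close> \<open>0 \<le> I\<close>
    by (subst integral_eq_nn_integral) (auto intro!: enn2real_leI)
qed

lemma expectation_trunc_powr_diff_le_ln:
  assumes [measurable]: "X \<in> borel_measurable M" and uv: "0 < u" "u \<le> v" and \<alpha>: "0 < \<alpha>"
    and tail: "\<And>t. u \<le> t \<Longrightarrow> t \<le> v \<Longrightarrow> t powr \<alpha> * prob {w \<in> space M. t < X w} \<le> c"
  shows "expectation (\<lambda>w. trunc_powr \<alpha> v (X w) - trunc_powr \<alpha> u (X w)) \<le> \<alpha> * c * ln (v / u)"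
  unfolding trunc_powr_def
proof (rule expectation_min_powr_diff_le[OF _ uv \<alpha> _ tail])
  have "(\<integral>\<^sup>+t. ennreal (indicator {u..v} t * t powr (\<alpha> - \<alpha> - 1)) \<partial>lborel) = ennreal (ln v - ln u)"
    using uv by (intro nn_integral_FTC_interior)
      (auto intro!: continuous_intros derivative_eq_intros simp: powr_minus_divide)
  then show "(\<integral>\<^sup>+t. ennreal (indicator {u..v} t * t powr (\<alpha> - \<alpha> - 1)) \<partial>lborel) \<le> ennreal (ln (v / u))"
    using uv by (simp add: ln_div)
qed (use uv in auto)

lemma expectation_min_powr_diff_le_powr:
  assumes [measurable]: "X \<in> borel_measurable M" and uv: "0 < u" "u \<le> v" and \<beta>: "0 < \<beta>" "\<beta> < \<alpha>"
    and tail: "\<And>t. u \<le> t \<Longrightarrow> t \<le> v \<Longrightarrow> t powr \<alpha> * prob {w \<in> space M. t < X w} \<le> c"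
  shows "expectation (\<lambda>w. min (max (X w) 0) v powr \<beta> - min (max (X w) 0) u powr \<beta>)
    \<le> \<beta> * c * (u powr (\<beta> - \<alpha>) / (\<alpha> - \<beta>))"
proof (rule expectation_min_powr_diff_le[OF _ uv \<beta>(1) _ tail])
  have "(\<integral>\<^sup>+t. ennreal (indicator {u..v} t * t powr (\<beta> - \<alpha> - 1)) \<partial>lborel)
      = ennreal (v powr (\<beta> - \<alpha>) / (\<beta> - \<alpha>) - u powr (\<beta> - \<alpha>) / (\<beta> - \<alpha>))"
    using uv \<beta> by (intro nn_integral_FTC_interior)
      (auto intro!: continuous_intros derivative_eq_intros)
  also have "\<dots> \<le> ennreal (u powr (\<beta> - \<alpha>) / (\<alpha> - \<beta>))"
  proof (intro ennreal_leI)
    define d where "d = \<alpha> - \<beta>"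
    have "0 < d" "\<beta> - \<alpha> = - d" using \<beta> by (auto simp: d_def)
    then show "v powr (\<beta> - \<alpha>) / (\<beta> - \<alpha>) - u powr (\<beta> - \<alpha>) / (\<beta> - \<alpha>) \<le> u powr (\<beta> - \<alpha>) / (\<alpha> - \<beta>)"
      unfolding d_def[symmetric] by (simp only: minus_divide_right[symmetric]) simp
  qed
  finally show "(\<integral>\<^sup>+t. ennreal (indicator {u..v} t * t powr (\<beta> - \<alpha> - 1)) \<partial>lborel)
    \<le> ennreal (u powr (\<beta> - \<alpha>) / (\<alpha> - \<beta>))" .
qed (use uv \<beta> in auto)

end

subsection \<open>The order of the tail of a perpetuity\<close>

locale slow_perpetuity = perpetuity M A B R \<alpha> + slow_tail M B \<alpha>
  for M :: "'a measure" and A B R :: "'a \<Rightarrow> real" and \<alpha> :: real +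
  fixes \<eta> :: real
  assumes eta: "0 < \<eta>" "\<eta> < \<alpha>" "\<eta> \<le> 1"
    and mixed: "integrable M (\<lambda>w. A w powr \<eta> * max (B w) 0 powr (\<alpha> - \<eta>))"
begin

text \<open>The exponent for B_+ where it is smaller than A |R|: at most 1 for the increment
  estimates, and at most \<open>\<alpha> - \<eta>\<close> so that \<open>mixed'\<close> follows from
  \<open>mixed\<close>.\<close>

definition \<zeta> :: real where "\<zeta> = min 1 (\<alpha> - \<eta>)"

lemma zeta: "0 < \<zeta>" "\<zeta> < \<alpha>" "\<zeta> \<le> 1" "\<zeta> \<le> \<alpha> - \<eta>"
  using eta by (auto simp: \<zeta>_def)

text \<open>For B_+ at most A the product is at most A^\<alpha>. Otherwise the ratio B_+/A exceeds
  1, and raising its exponent from \<zeta> to \<open>\<alpha> - \<eta>\<close> gives the assumed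
  mixed moment.\<close>

lemma mixed': "integrable M (\<lambda>w. max (B w) 0 powr \<zeta> * A w powr (\<alpha> - \<zeta>))"
proof (rule Bochner_Integration.integrable_bound[OF Bochner_Integration.integrable_add[OF A_moment_int mixed]])
  have "max b 0 powr \<zeta> * a powr (\<alpha> - \<zeta>) \<le> a powr \<alpha> + a powr \<eta> * max b 0 powr (\<alpha> - \<eta>)"
    if a: "0 \<le> a" for a b
  proof (cases "max b 0 \<le> a")
    case True
    then have "max b 0 powr \<zeta> * a powr (\<alpha> - \<zeta>) \<le> a powr \<zeta> * a powr (\<alpha> - \<zeta>)"
      using zeta by (intro mult_right_mono powr_mono2) auto
    also have "\<dots> = a powr \<alpha>" by (simp flip: powr_add)
    finally show ?thesis by (simp add: add_increasing2)
  next
    case False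
    show ?thesis
    proof (cases "a = 0")
      case False
      define b' where "b' = max b 0"
      have b: "0 < b'" "a < b'" using \<open>\<not> max b 0 \<le> a\<close> a by (auto simp: b'_def)
      have "b' powr \<zeta> * a powr (\<alpha> - \<zeta>) = a powr \<alpha> * (b' / a) powr \<zeta>"
        using b a False by (simp add: powr_divide powr_diff)
      also have "\<dots> \<le> a powr \<alpha> * (b' / a) powr (\<alpha> - \<eta>)"
        using b a False zeta by (intro mult_left_mono powr_mono) auto
      also have "\<dots> = a powr \<eta> * b' powr (\<alpha> - \<eta>)"
        using b a False by (simp add: powr_divide powr_diff)
      finally show ?thesis by (simp add: b'_def add_increasing)
    qed simp
  qed
  then show "AE w in M. norm (max (B w) 0 powr \<zeta> * A w powr (\<alpha> - \<zeta>))
      \<le> norm (A w powr \<alpha> + A w powr \<eta> * max (B w) 0 powr (\<alpha> - \<eta>))"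
    using A_nonneg by (intro AE_I2) (simp add: abs_mult)
qed simp

definition S :: "real \<Rightarrow> real" where
  "S x = expectation (\<lambda>w. V x (R w))"

definition r :: "real \<Rightarrow> real" where
  "r x = x powr \<alpha> * prob {w \<in> space M. x < R w}"

section \<open>The bent Lyapunov function and the order of the tail\<close>

definition bend :: "real \<Rightarrow> real \<Rightarrow> real" where
  "bend x z = min (max z 0 powr \<alpha>) (x powr (\<alpha>/2) * max z 0 powr (\<alpha>/2))"

lemma bend_measurable [measurable]:
  "(\<lambda>z. bend x (g z)) \<in> borel_measurable N" if [measurable]: "g \<in> borel_measurable N"
  unfolding bend_def by measurable

lemma bend_nonneg: "0 \<le> bend x z" by (simp add: bend_def)

lemma bend_mono: "z \<le> w \<Longrightarrow> bend x z \<le> bend x w"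
  unfolding bend_def using alpha_pos by (intro min.mono powr_mono2 mult_left_mono) auto

lemma bend_scale:
  assumes "1 \<le> c" "0 \<le> z"
  shows "bend x (c * z) \<le> c powr \<alpha> * bend x z"
proof -
  have z: "max (c * z) 0 = c * z" "max z 0 = z" using assms by auto
  have "c powr (\<alpha>/2) \<le> c powr \<alpha>" using assms alpha_pos by (intro powr_mono) auto
  then have "x powr (\<alpha>/2) * (c * z) powr (\<alpha>/2) \<le> c powr \<alpha> * (x powr (\<alpha>/2) * z powr (\<alpha>/2))"
    using mult_right_mono[of "c powr (\<alpha>/2)" "c powr \<alpha>" "x powr (\<alpha>/2) * z powr (\<alpha>/2)"]
    by (simp add: powr_mult mult_ac)
  then show ?thesis
    unfolding bend_def z by (subst min_mult_distrib_left) (auto simp: powr_mult min_le_iff_disj)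
qed

text \<open>If the added part dominates, doubling it costs \<open>2 powr \<alpha>\<close>. If the
  old part dominates, \<open>bend\<close> grows by no larger a factor than the \<alpha>-th power, so
  its increment is at most that of the \<alpha>-th power, which is a product term independent of
  \<open>x\<close>.\<close>

lemma bend_gain:
  "bend x (a + b) \<le> bend x a + (2 powr \<alpha> * bend x b + exp \<alpha> * (max b 0 powr \<zeta> * \<bar>a\<bar> powr (\<alpha> - \<zeta>)))"
proof -
  define p q where "p = max a 0" and "q = max b 0"
  have pq: "0 \<le> p" "0 \<le> q" "a + b \<le> p + q" "p \<le> \<bar>a\<bar>" by (auto simp: p_def q_def)
  have eq: "bend x a = bend x p" "bend x b = bend x q" by (auto simp: bend_def p_def q_def)
  have le: "bend x (a + b) \<le> bend x (p + q)" using pq by (intro bend_mono)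
  have nn: "0 \<le> exp \<alpha> * (q powr \<zeta> * \<bar>a\<bar> powr (\<alpha> - \<zeta>))" "0 \<le> 2 powr \<alpha> * bend x q" "0 \<le> bend x p"
    by (auto simp: bend_nonneg)
  show ?thesis
  proof (cases "p \<le> q")
    case True
    then have "bend x (p + q) \<le> bend x (2 * q)" by (intro bend_mono) simp
    also have "\<dots> \<le> 2 powr \<alpha> * bend x q" using pq by (intro bend_scale) auto
    finally show ?thesis using le nn unfolding eq q_def[symmetric] by linarith
  next
    case False
    then have p: "0 < p" "q \<le> p" using pq by auto
    define c where "c = (p + q) / p"
    have c: "1 \<le> c" "p + q = c * p" using p pq by (auto simp: c_def)
    have "bend x (p + q) - bend x p \<le> (c powr \<alpha> - 1) * bend x p"
      unfolding c(2) using bend_scale[of c p x] c p by (simp add: algebra_simps)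
    also have "\<dots> \<le> (c powr \<alpha> - 1) * p powr \<alpha>"
      using c p alpha_pos ge_one_powr_ge_zero[of c \<alpha>] by (intro mult_left_mono) (auto simp: bend_def)
    also have "\<dots> = (p + q) powr \<alpha> - p powr \<alpha>"
      unfolding c(2) using c p by (simp add: powr_mult left_diff_distrib)
    also have "\<dots> \<le> exp \<alpha> * (q powr \<zeta> * p powr (\<alpha> - \<zeta>))"
      using p pq zeta alpha_pos by (intro powr_add_diff_le) auto
    also have "\<dots> \<le> exp \<alpha> * (q powr \<zeta> * \<bar>a\<bar> powr (\<alpha> - \<zeta>))"
      using pq zeta by (intro mult_left_mono powr_mono2) auto
    finally show ?thesis using le nn unfolding eq q_def[symmetric] by linarith
  qed
qed

text \<open>Neither branch of the minimum grows in mean: the exponent \<alpha> is preserved and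
  \<alpha>/2 contracts by \<phi>. Above \<open>x\<close> the second branch is active and at least
  \<open>x powr \<alpha>\<close>, so a fraction \<open>1 - \<phi>\<close> of that amount is
  lost.\<close>

lemma bend_loss:
  assumes x: "0 < x"
  shows "(\<integral>\<^sup>+w. ennreal (bend x (A w * z)) \<partial>M)
      + ennreal ((1 - expectation (\<lambda>w. A w powr (\<alpha>/2))) * x powr \<alpha> * indicator {x<..} z)
      \<le> ennreal (bend x z)"
proof (cases "0 < z")
  case False
  then have "bend x (A w * z) = 0" for w
    using A_nonneg[of w] by (auto simp: bend_def max_def mult_le_0_iff)
  then show ?thesis using False x by simp
next
  case z: True
  define \<phi> where "\<phi> = expectation (\<lambda>w. A w powr (\<alpha>/2))"
  have \<phi>: "0 \<le> \<phi>" "\<phi> < 1" using expectation_A_powr_less_1[of "\<alpha>/2"] alpha_pos by (auto simp: \<phi>_def)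
  have max: "max (A w * z) 0 = A w * z" for w using A_nonneg[of w] z by simp
  have "(\<integral>\<^sup>+w. ennreal (bend x (A w * z)) \<partial>M) \<le> (\<integral>\<^sup>+w. ennreal (A w powr \<alpha> * z powr \<alpha>) \<partial>M)"
    by (intro nn_integral_mono ennreal_leI) (simp add: bend_def max powr_mult)
  also have "\<dots> = ennreal (z powr \<alpha>)"
    using A_moment_int A_moment by (subst nn_integral_eq_integral) auto
  finally have 1: "(\<integral>\<^sup>+w. ennreal (bend x (A w * z)) \<partial>M) \<le> ennreal (z powr \<alpha>)" .
  have "(\<integral>\<^sup>+w. ennreal (bend x (A w * z)) \<partial>M) \<le> (\<integral>\<^sup>+w. ennreal (x powr (\<alpha>/2) * \<bar>A w * z\<bar> powr (\<alpha>/2)) \<partial>M)"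
    using A_nonneg z by (intro nn_integral_mono ennreal_leI) (simp add: bend_def max)
  also have "\<dots> = ennreal (\<phi> * (x powr (\<alpha>/2) * z powr (\<alpha>/2)))"
    unfolding \<phi>_def using alpha_pos z by (subst nn_integral_A_powr_le) auto
  finally have 2: "(\<integral>\<^sup>+w. ennreal (bend x (A w * z)) \<partial>M) \<le> ennreal (\<phi> * (x powr (\<alpha>/2) * z powr (\<alpha>/2)))" .
  show ?thesis
  proof (cases "x < z")
    case False
    have "\<phi> * (x powr (\<alpha>/2) * z powr (\<alpha>/2)) \<le> x powr (\<alpha>/2) * z powr (\<alpha>/2)"
      using \<phi> by (intro mult_left_le_one_le) auto
    then have "(\<integral>\<^sup>+w. ennreal (bend x (A w * z)) \<partial>M) \<le> ennreal (x powr (\<alpha>/2) * z powr (\<alpha>/2))"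
      using 2 by (auto intro: order_trans ennreal_leI)
    then show ?thesis using 1 False z by (simp add: bend_def min_def)
  next
    case True
    have "x powr \<alpha> = x powr (\<alpha>/2) * x powr (\<alpha>/2)" by (simp flip: powr_add)
    also have "\<dots> \<le> x powr (\<alpha>/2) * z powr (\<alpha>/2)"
      using True x alpha_pos by (intro mult_left_mono powr_mono2) auto
    finally have le: "x powr \<alpha> \<le> x powr (\<alpha>/2) * z powr (\<alpha>/2)" .
    have "z powr \<alpha> = z powr (\<alpha>/2) * z powr (\<alpha>/2)" by (simp flip: powr_add)
    moreover have "x powr (\<alpha>/2) * z powr (\<alpha>/2) \<le> z powr (\<alpha>/2) * z powr (\<alpha>/2)"
      using True x alpha_pos by (intro mult_right_mono powr_mono2) auto
    ultimately have bend: "bend x z = x powr (\<alpha>/2) * z powr (\<alpha>/2)" using z by (simp add: bend_def)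
    have "(1 - \<phi>) * x powr \<alpha> \<le> (1 - \<phi>) * (x powr (\<alpha>/2) * z powr (\<alpha>/2))"
      using le \<phi> by (intro mult_left_mono) auto
    then have "(\<integral>\<^sup>+w. ennreal (bend x (A w * z)) \<partial>M) + ennreal ((1 - \<phi>) * x powr \<alpha> * indicator {x<..} z)
        \<le> ennreal (\<phi> * (x powr (\<alpha>/2) * z powr (\<alpha>/2))) + ennreal ((1 - \<phi>) * (x powr (\<alpha>/2) * z powr (\<alpha>/2)))"
      using 2 True by (intro add_mono) (auto intro: ennreal_leI)
    also have "\<dots> = ennreal (bend x z)"
      unfolding bend using \<phi> by (subst ennreal_plus[symmetric]) (auto simp: left_diff_distrib mult_left_le_one_le)
    finally show ?thesis by (simp add: \<phi>_def)
  qed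
qed

text \<open>The mean loss of \<open>bend\<close> is \<open>(1 - \<phi>) * r x\<close>, so the
  Lyapunov inequality bounds the tail directly. The gain from B is of order \<open>T x\<close> by
  the dyadic estimate; the cross term is a constant, absorbed through
  \<open>T x \<ge> T x\<^sub>0 > 0\<close>.\<close>

lemma r_le_T: "\<exists>C>0. \<exists>x\<^sub>0\<ge>1. \<forall>x\<ge>x\<^sub>0. r x \<le> C * T x"
proof -
  define \<phi> where "\<phi> = expectation (\<lambda>w. A w powr (\<alpha>/2))"
  have \<phi>: "0 \<le> \<phi>" "\<phi> < 1" using expectation_A_powr_less_1[of "\<alpha>/2"] alpha_pos by (auto simp: \<phi>_def)
  obtain C x\<^sub>0 where C: "0 < C" and x0: "1 \<le> x\<^sub>0" and CT: "\<And>x. x\<^sub>0 \<le> x \<Longrightarrow>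
      (\<integral>\<^sup>+w. ennreal (bend x (B w)) \<partial>M) \<le> ennreal (C * T x)"
    using truncated_moment_le_T[of "\<alpha>/2"] alpha_pos unfolding bend_def by auto
  define c where "c = expectation (\<lambda>w. max (B w) 0 powr \<zeta> * A w powr (\<alpha> - \<zeta>))
    * expectation (\<lambda>w. \<bar>R w\<bar> powr (\<alpha> - \<zeta>))"
  have c: "0 \<le> c" unfolding c_def by (intro mult_nonneg_nonneg Bochner_Integration.integral_nonneg) auto
  define C' where "C' = (2 powr \<alpha> * C + exp \<alpha> * c / T x\<^sub>0) / (1 - \<phi>)"
  have T0: "0 < T x\<^sub>0" using T_pos x0 by simp
  have "0 < C'" unfolding C'_def using C c T0 \<phi> by (intro divide_pos_pos add_pos_nonneg) auto
  have "r x \<le> C' * T x" if x: "x\<^sub>0 \<le> x" for x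
  proof -
    have x_pos: "0 < x" using x x0 by simp
    have bend_R: "(\<integral>\<^sup>+w. ennreal (bend x (R w)) \<partial>M) < \<infinity>"
    proof -
      have "(\<integral>\<^sup>+w. ennreal (bend x (R w)) \<partial>M) \<le> (\<integral>\<^sup>+w. ennreal (x powr (\<alpha>/2) * \<bar>R w\<bar> powr (\<alpha>/2)) \<partial>M)"
        using alpha_pos unfolding bend_def
        by (intro nn_integral_mono ennreal_leI min.coboundedI2 mult_left_mono powr_mono2) auto
      also have "\<dots> < \<infinity>"
        using integrable_mult_right[OF R_moment[of "\<alpha>/2"], of "x powr (\<alpha>/2)"] alpha_pos
        by (simp add: nn_integral_eq_integral)
      finally show ?thesis .
    qed
    have "(\<integral>\<^sup>+w. ennreal ((1 - \<phi>) * x powr \<alpha> * indicator {x<..} (R w)) \<partial>M)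
      \<le> (\<integral>\<^sup>+w. \<integral>\<^sup>+w'. ennreal (2 powr \<alpha> * bend x (B w))
          + ennreal (exp \<alpha> * (max (B w) 0 powr \<zeta> * \<bar>A w * R w'\<bar> powr (\<alpha> - \<zeta>))) \<partial>M \<partial>M)"
    proof (rule lyapunov[where V="\<lambda>z. ennreal (bend x z)"])
      show "(\<integral>\<^sup>+w. ennreal (bend x (A w * z)) \<partial>M) + ennreal ((1 - \<phi>) * x powr \<alpha> * indicator {x<..} z)
          \<le> ennreal (bend x z)" for z
        unfolding \<phi>_def by (rule bend_loss[OF x_pos])
      show "ennreal (bend x (A w * R w' + B w)) \<le> ennreal (bend x (A w * R w'))
        + (ennreal (2 powr \<alpha> * bend x (B w))
          + ennreal (exp \<alpha> * (max (B w) 0 powr \<zeta> * \<bar>A w * R w'\<bar> powr (\<alpha> - \<zeta>))))" for w w'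
        using bend_gain[of x "A w * R w'" "B w"]
        by (simp add: bend_nonneg ennreal_leI flip: ennreal_plus)
    qed (use bend_R in auto)
    also have "\<dots> = (\<integral>\<^sup>+w. ennreal (2 powr \<alpha> * bend x (B w)) \<partial>M) + ennreal (exp \<alpha> * c)"
    proof -
      have split: "exp \<alpha> * (max (B w) 0 powr \<zeta> * \<bar>A w * R w'\<bar> powr (\<alpha> - \<zeta>))
          = exp \<alpha> * (max (B w) 0 powr \<zeta> * A w powr (\<alpha> - \<zeta>)) * \<bar>R w'\<bar> powr (\<alpha> - \<zeta>)" for w w'
        using A_nonneg[of w] by (simp add: abs_mult powr_mult)
      have RI: "integrable M (\<lambda>w. \<bar>R w\<bar> powr (\<alpha> - \<zeta>))" using zeta by (intro R_moment) auto
      have inner: "(\<integral>\<^sup>+w'. ennreal (exp \<alpha> * (max (B w) 0 powr \<zeta> * \<bar>A w * R w'\<bar> powr (\<alpha> - \<zeta>))) \<partial>M)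
          = ennreal (exp \<alpha> * (max (B w) 0 powr \<zeta> * A w powr (\<alpha> - \<zeta>))
              * expectation (\<lambda>w. \<bar>R w\<bar> powr (\<alpha> - \<zeta>)))" for w
        unfolding split using RI by (subst nn_integral_eq_integral) auto
      have "(\<integral>\<^sup>+w. ennreal (exp \<alpha> * (max (B w) 0 powr \<zeta> * A w powr (\<alpha> - \<zeta>))
              * expectation (\<lambda>w. \<bar>R w\<bar> powr (\<alpha> - \<zeta>))) \<partial>M) = ennreal (exp \<alpha> * c)"
      proof -
        define m where "m w = max (B w) 0 powr \<zeta> * A w powr (\<alpha> - \<zeta>)" for w
        have m: "integrable M m" "\<And>w. 0 \<le> m w" using mixed' by (auto simp: m_def[abs_def])
        have "(\<integral>\<^sup>+w. ennreal (exp \<alpha> * m w * expectation (\<lambda>w. \<bar>R w\<bar> powr (\<alpha> - \<zeta>))) \<partial>M)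
            = ennreal (exp \<alpha> * (expectation m * expectation (\<lambda>w. \<bar>R w\<bar> powr (\<alpha> - \<zeta>))))"
          using m by (subst nn_integral_eq_integral) auto
        then show ?thesis by (simp add: m_def[abs_def] c_def)
      qed
      then show ?thesis
        by (simp add: nn_integral_add emeasure_space_1 inner)
    qed
    also have "(\<integral>\<^sup>+w. ennreal (2 powr \<alpha> * bend x (B w)) \<partial>M) \<le> ennreal (2 powr \<alpha> * (C * T x))"
      using CT[OF x] C T_nonneg[of x]
      by (simp add: ennreal_mult bend_nonneg nn_integral_cmult mult_left_mono)
    also have "ennreal (2 powr \<alpha> * (C * T x)) + ennreal (exp \<alpha> * c)
        = ennreal (2 powr \<alpha> * (C * T x) + exp \<alpha> * c)"
      using C T_nonneg[of x] c by (subst ennreal_plus) auto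
    also have "(\<integral>\<^sup>+w. ennreal ((1 - \<phi>) * x powr \<alpha> * indicator {x<..} (R w)) \<partial>M)
        = ennreal ((1 - \<phi>) * r x)"
    proof -
      have "(\<integral>\<^sup>+w. ennreal ((1 - \<phi>) * x powr \<alpha> * indicator {x<..} (R w)) \<partial>M)
          = (\<integral>\<^sup>+w. ennreal ((1 - \<phi>) * x powr \<alpha>) * indicator {w \<in> space M. x < R w} w \<partial>M)"
        by (intro nn_integral_cong) (auto simp: indicator_def)
      then show ?thesis
        using \<phi> by (subst (asm) nn_integral_cmult_indicator)
          (auto simp: emeasure_eq_measure r_def ennreal_mult mult.assoc)
    qed
    finally have "(1 - \<phi>) * r x \<le> 2 powr \<alpha> * (C * T x) + exp \<alpha> * c"
      using C T_nonneg[of x] c by (simp add: ennreal_le_iff add_right_mono flip: ennreal_plus)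
    also have "\<dots> \<le> 2 powr \<alpha> * (C * T x) + exp \<alpha> * c * (T x / T x\<^sub>0)"
      using T_mono[of x\<^sub>0 x] x x0 T0 c
      mult_left_mono[of 1 "T x / T x\<^sub>0" "exp \<alpha> * c"] by simp
    also have "\<dots> = (1 - \<phi>) * (C' * T x)"
      using \<phi> by (simp add: C'_def distrib_right)
    finally show ?thesis using \<phi> by simp
  qed
  then show ?thesis using \<open>0 < C'\<close> x0 by blast
qed

lemma r_le: "\<exists>C>0. \<forall>x>0. r x \<le> C * (1 + T x)"
proof -
  obtain C x\<^sub>0 where C: "0 < C" and x0: "1 \<le> x\<^sub>0" and le: "\<And>x. x\<^sub>0 \<le> x \<Longrightarrow> r x \<le> C * T x"
    using r_le_T by auto
  define C' where "C' = C + x\<^sub>0 powr \<alpha>"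
  have C': "C \<le> C'" "x\<^sub>0 powr \<alpha> \<le> C'" using C by (auto simp: C'_def)
  have "r x \<le> C' * (1 + T x)" if "0 < x" for x
  proof (cases "x\<^sub>0 \<le> x")
    case True
    have "C * T x \<le> C' * (1 + T x)"
      using C C' T_nonneg[of x] by (intro mult_mono) auto
    then show ?thesis using le[OF True] by simp
  next
    case False
    have "r x \<le> x\<^sub>0 powr \<alpha> * 1"
      unfolding r_def using False that alpha_pos by (intro mult_mono powr_mono2) auto
    also have "\<dots> \<le> C' * (1 + T x)"
      using C C' T_nonneg[of x] by (intro mult_mono) auto
    finally show ?thesis .
  qed
  then show ?thesis using C C' by (intro exI[of _ C']) auto
qed

section \<open>Growth and logarithmic regularity of the truncated moment of R\<close>

lemma S_diff_le:
  assumes "0 < x" "1 \<le> c"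
  shows "S (c * x) - S x \<le> (c powr \<alpha> - 1) * r x"
    and "(c powr \<alpha> - 1) / c powr \<alpha> * r (c * x) \<le> S (c * x) - S x"
proof -
  have c: "0 < c powr \<alpha>" using assms by simp
  have "(c powr \<alpha> - 1) / c powr \<alpha> * r (c * x)
      = ((c * x) powr \<alpha> - x powr \<alpha>) * prob {w \<in> space M. c * x < R w}"
    using c assms by (simp add: r_def powr_mult field_simps)
  then show "(c powr \<alpha> - 1) / c powr \<alpha> * r (c * x) \<le> S (c * x) - S x"
    using expectation_trunc_powr_diff(2)[OF R_meas, of x "c * x"] assms by (simp add: S_def)
  show "S (c * x) - S x \<le> (c powr \<alpha> - 1) * r x"
    using expectation_trunc_powr_diff(1)[OF R_meas, of x "c * x"] assms
    by (simp add: S_def r_def powr_mult left_diff_distrib mult.assoc)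
qed

lemma S_mono: "0 \<le> x \<Longrightarrow> x \<le> y \<Longrightarrow> S x \<le> S y"
  unfolding S_def using alpha_pos
  by (intro integral_mono integrable_trunc_powr trunc_powr_mono) auto

lemma S_nonneg: "0 \<le> S x"
  by (simp add: S_def)

text \<open>S is an integral of r(t)/t up to the factor \<alpha>, and monotonicity of
  \<open>T\<close> bounds \<open>r\<close> on [u, v] by its bound at \<open>v\<close>. This is the
  source of the equicontinuity.\<close>

lemma S_diff_le_ln: "\<exists>C>0. \<forall>u v. 0 < u \<and> u \<le> v \<longrightarrow> S v - S u \<le> C * (1 + T v) * ln (v / u)"
proof -
  obtain C where C: "0 < C" and le: "\<And>x. 0 < x \<Longrightarrow> r x \<le> C * (1 + T x)" using r_le by auto
  have "S v - S u \<le> \<alpha> * C * (1 + T v) * ln (v / u)" if uv: "0 < u" "u \<le> v" for u v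
  proof -
    have "r t \<le> C * (1 + T v)" if "u \<le> t" "t \<le> v" for t
    proof -
      have "C * (1 + T t) \<le> C * (1 + T v)"
        using T_mono[of t v] that uv C by (intro mult_left_mono) auto
      then show ?thesis using le[of t] that uv by simp
    qed
    then have "expectation (\<lambda>w. V v (R w) - V u (R w))
        \<le> \<alpha> * (C * (1 + T v)) * ln (v / u)"
      using uv alpha_pos by (intro expectation_trunc_powr_diff_le_ln) (auto simp: r_def)
    then show ?thesis
      using uv integrable_trunc_powr[OF R_meas, of u] integrable_trunc_powr[OF R_meas, of v]
      by (simp add: S_def mult.assoc)
  qed
  then show ?thesis using C alpha_pos by (intro exI[of _ "\<alpha> * C"]) auto
qed

lemma S_le: "\<exists>C>0. \<forall>x>0. S x \<le> C * (1 + T x) * (1 + max 0 (ln x))"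
proof -
  obtain C where C: "0 < C" and le: "\<And>u v. 0 < u \<Longrightarrow> u \<le> v \<Longrightarrow> S v - S u \<le> C * (1 + T v) * ln (v / u)"
    using S_diff_le_ln by auto
  have S1: "S 1 \<le> 1"
    unfolding S_def using trunc_powr_le[of \<alpha> 1] alpha_pos
    by (intro integral_le_const integrable_trunc_powr) auto
  have "S x \<le> (C + 1) * (1 + T x) * (1 + max 0 (ln x))" if x: "0 < x" for x
  proof -
    have "S x \<le> 1 + C * (1 + T x) * max 0 (ln x)"
    proof (cases "1 \<le> x")
      case True
      then show ?thesis using le[of 1 x] S1 by simp
    next
      case False
      then have "S x \<le> 1" using S_mono[of x 1] S1 x by simp
      moreover have "0 \<le> C * (1 + T x) * max 0 (ln x)" using C T_nonneg[of x] by simp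
      ultimately show ?thesis by linarith
    qed
    also have "\<dots> \<le> (C + 1) * (1 + T x) * 1 + (C + 1) * (1 + T x) * max 0 (ln x)"
    proof (intro add_mono mult_right_mono)
      have "1 * 1 \<le> (C + 1) * (1 + T x)" using C T_nonneg[of x] by (intro mult_mono) auto
      then show "1 \<le> (C + 1) * (1 + T x) * 1" by simp
    qed (use C T_nonneg[of x] in auto)
    finally show ?thesis by (simp only: distrib_left)
  qed
  then show ?thesis using C by (intro exI[of _ "C + 1"]) auto
qed

text \<open>Potter's bound for \<open>c \<ge> 1\<close>, monotonicity for \<open>c < 1\<close>, and
  1 absorbed into a multiple of \<open>T x\<close>. Being valid for all \<open>c > 0\<close>, it can
  be applied with \<open>c\<close> a random multiple of 1/A.\<close>

lemma T_scale_le: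
  assumes "0 < \<epsilon>"
  shows "\<exists>C>0. \<exists>x\<^sub>0\<ge>1. \<forall>x\<ge>x\<^sub>0. \<forall>c>0. 1 + T (c * x) \<le> C * (1 + c powr \<epsilon>) * T x"
proof -
  obtain x\<^sub>0 where x0: "1 \<le> x\<^sub>0"
    and potter: "\<And>x c. x\<^sub>0 \<le> x \<Longrightarrow> 1 \<le> c \<Longrightarrow> T (c * x) \<le> 2 powr \<epsilon> * c powr \<epsilon> * T x"
    using T_potter[OF assms] by auto
  have T0: "0 < T x\<^sub>0" using T_pos x0 by simp
  define C where "C = 1 / T x\<^sub>0 + (1 + 2 powr \<epsilon>)"
  have C: "0 < C" using T0 by (auto simp: C_def intro!: add_pos_pos)
  have "1 + T (c * x) \<le> C * (1 + c powr \<epsilon>) * T x" if x: "x\<^sub>0 \<le> x" and c: "0 < c" for x c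
  proof -
    have Tx: "0 < T x" "T x\<^sub>0 \<le> T x" using T_pos T_mono[of x\<^sub>0 x] x x0 by auto
    have "1 \<le> 1 / T x\<^sub>0 * T x" using Tx T0 by simp
    also have "\<dots> \<le> 1 / T x\<^sub>0 * ((1 + c powr \<epsilon>) * T x)"
      using Tx T0 by (intro mult_left_mono) (auto simp: algebra_simps)
    finally have 1: "1 \<le> 1 / T x\<^sub>0 * ((1 + c powr \<epsilon>) * T x)" .
    have 2: "T (c * x) \<le> (1 + 2 powr \<epsilon>) * ((1 + c powr \<epsilon>) * T x)"
    proof (cases "1 \<le> c")
      case True
      have "T (c * x) \<le> 2 powr \<epsilon> * (c powr \<epsilon> * T x)" using potter[OF x True] by (simp add: mult.assoc)
      also have "\<dots> \<le> (1 + 2 powr \<epsilon>) * ((1 + c powr \<epsilon>) * T x)"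
        using Tx by (intro mult_mono) auto
      finally show ?thesis .
    next
      case False
      have "T (c * x) \<le> 1 * (1 * T x)" using T_mono[of "c * x" x] False c x x0 by simp
      also have "\<dots> \<le> (1 + 2 powr \<epsilon>) * ((1 + c powr \<epsilon>) * T x)"
        using Tx by (intro mult_mono) auto
      finally show ?thesis .
    qed
    show ?thesis using add_mono[OF 1 2]
      by (simp only: C_def mult.assoc
        distrib_right[of "1 / T x\<^sub>0" "1 + 2 powr \<epsilon>" "(1 + c powr \<epsilon>) * T x"])
  qed
  then show ?thesis using C x0 by blast
qed

end

subsection \<open>The truncated moments of the shifted perpetuity\<close>

context slow_perpetuity
begin

text \<open>The mean loss of the truncated power when R is lowered by \<open>q\<close>. It measures
  the effect of B_-: after scaling out A, the shift is
  \<open>q = max (- B w) 0 / A w\<close>.\<close>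

definition J :: "real \<Rightarrow> real \<Rightarrow> real" where
  "J z q = expectation (\<lambda>w. V z (R w) - V z (R w - q))"

lemma J_integrable:
  "0 < z \<Longrightarrow> integrable M (\<lambda>w. V z (R w) - V z (R w - q))"
  by (intro Bochner_Integration.integrable_diff integrable_trunc_powr) auto

lemma J_nonneg: "0 < z \<Longrightarrow> 0 \<le> q \<Longrightarrow> 0 \<le> J z q"
  unfolding J_def using trunc_powr_mono[of \<alpha> z z] alpha_pos
  by (intro Bochner_Integration.integral_nonneg) simp

lemma J_0 [simp]: "J z 0 = 0"
  by (simp add: J_def)

text \<open>Uniform in \<open>z\<close>, but with a power of \<open>q\<close> that need not be
  integrable once \<open>q\<close> is B_-/A. It serves for the limit at a fixed outcome, while a
  logarithmic bound provides the domination.\<close>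

lemma J_le_powr:
  assumes "0 < z" "0 \<le> q"
  shows "J z q \<le> (1 + \<alpha>) * (q powr \<eta> * expectation (\<lambda>w. \<bar>R w\<bar> powr (\<alpha> - \<eta>)))"
proof -
  have RI: "integrable M (\<lambda>w. \<bar>R w\<bar> powr (\<alpha> - \<eta>))" using eta by (intro R_moment) auto
  have "J z q \<le> expectation (\<lambda>w. (1 + \<alpha>) * (q powr \<eta> * \<bar>R w\<bar> powr (\<alpha> - \<eta>)))"
    unfolding J_def
  proof (intro integral_mono J_integrable)
    fix w
    show "V z (R w) - V z (R w - q) \<le> (1 + \<alpha>) * (q powr \<eta> * \<bar>R w\<bar> powr (\<alpha> - \<eta>))"
    proof (cases "0 \<le> R w")
      case True
      then show ?thesis using trunc_powr_shift_le[of q "R w" \<alpha> z \<eta>] assms eta alpha_pos by simp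
    next
      case False
      have "0 \<le> (1 + \<alpha>) * (q powr \<eta> * \<bar>R w\<bar> powr (\<alpha> - \<eta>))" using alpha_pos by simp
      then show ?thesis using False assms by simp
    qed
  qed (use assms RI in auto)
  also have "\<dots> = (1 + \<alpha>) * (q powr \<eta> * expectation (\<lambda>w. \<bar>R w\<bar> powr (\<alpha> - \<eta>)))"
    using RI by simp
  finally show ?thesis .
qed

text \<open>Values of \<open>R\<close> below \<open>q\<close> contribute the logarithm; between \<open>q\<close> and \<open>2 z\<close> the shift by \<open>q\<close>
  is relatively small and contributes only a convergent integral of the tail.\<close>

lemma J_le_ln: "\<exists>C>0. \<forall>z>0. \<forall>q>0. J z q \<le> C * (1 + T (2 * z)) * (1 + max 0 (ln q))"
proof -
  obtain C where C: "0 < C" and S_le: "\<And>x. 0 < x \<Longrightarrow> S x \<le> C * (1 + T x) * (1 + max 0 (ln x))"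
    using S_le by auto
  obtain D where D: "0 < D" and r_le: "\<And>x. 0 < x \<Longrightarrow> r x \<le> D * (1 + T x)" using r_le by auto
  define \<beta> where "\<beta> = \<alpha> - \<eta>"
  have \<beta>: "0 < \<beta>" "\<beta> < \<alpha>" "\<alpha> - \<beta> = \<eta>" "\<beta> - \<alpha> = - \<eta>" using eta by (auto simp: \<beta>_def)
  define E where "E = (1 + \<alpha>) * (\<beta> * D / \<eta> + D)"
  have E: "0 < E" unfolding E_def using alpha_pos D eta \<beta> by (intro mult_pos_pos add_nonneg_pos) auto
  have J_le_S: "J z q \<le> S z" if "0 < z" for z q
  proof -
    have "J z q \<le> expectation (\<lambda>w. V z (R w))"
      unfolding J_def using that
      by (intro integral_mono J_integrable integrable_trunc_powr) auto
    then show ?thesis by (simp add: S_def)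
  qed
  have "J z q \<le> (C + E) * (1 + T (2 * z)) * (1 + max 0 (ln q))" if z: "0 < z" and q: "0 < q" for z q
  proof -
    have S_bound: "S v \<le> C * (1 + T (2 * z)) * (1 + max 0 (ln q))" if "0 < v" "v \<le> z" "v \<le> q" for v
    proof -
      have "S v \<le> C * (1 + T v) * (1 + max 0 (ln v))" using that by (intro S_le)
      also have "\<dots> \<le> C * (1 + T (2 * z)) * (1 + max 0 (ln q))"
      proof -
        have "max 0 (ln v) \<le> max 0 (ln q)" using that by (intro max.mono) auto
        then show ?thesis
          using that C T_mono[of v "2 * z"] T_nonneg[of v] by (intro mult_mono) auto
      qed
      finally show ?thesis .
    qed
    have nonneg: "0 \<le> E * (1 + T (2 * z)) * (1 + max 0 (ln q))" using E T_nonneg[of "2 * z"] by simp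
    show ?thesis
    proof (cases "z \<le> q")
      case True
      then have "J z q \<le> C * (1 + T (2 * z)) * (1 + max 0 (ln q))"
        using J_le_S[of z q] S_bound[of z] z by simp
      then show ?thesis using nonneg unfolding distrib_right by linarith
    next
      case False
      \<comment> \<open>The sum of \<open>m w\<close> and \<open>q powr \<beta>\<close> equals
        \<open>R w powr \<beta>\<close> for R between \<open>q\<close> and \<open>2 * z\<close>, a
        form to which the layer-cake bound applies. Beyond \<open>2 * z\<close> the shifted value
        still exceeds \<open>z\<close>, as \<open>q < z\<close>, so both truncated powers
        agree.\<close>
      define m where "m w = min (max (R w) 0) (2 * z) powr \<beta> - min (max (R w) 0) q powr \<beta>" for w
      define g where "g w = V q (R w)
          + (1 + \<alpha>) * (q powr \<eta> * (m w + q powr \<beta> * indicator {q<..} (R w)))" for w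
      have mint: "integrable M m"
      proof -
        have "integrable M (\<lambda>w. min (max (R w) 0) v powr \<beta>)" if "0 < v" for v
          using that \<beta> by (intro integrable_const_bound[where B="v powr \<beta>"])
            (auto intro!: powr_mono2)
        then show ?thesis unfolding m_def[abs_def] using z q by auto
      qed
      have iint: "integrable M (\<lambda>w. indicator {q<..} (R w) :: real)"
        by (intro integrable_const_bound[where B=1]) (auto simp: indicator_def)
      have tint: "integrable M (\<lambda>w. V q (R w))" using q by (intro integrable_trunc_powr) auto
      have "J z q \<le> expectation g"
        unfolding J_def
      proof (intro integral_mono J_integrable z)
        show "integrable M g" unfolding g_def[abs_def] using mint iint tint by auto
        fix w
        consider "R w \<le> q" | "q < R w" "R w \<le> 2 * z" | "2 * z < R w" by linarith
        then show "V z (R w) - V z (R w - q) \<le> g w"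
        proof cases
          case 1
          then have "V z (R w) = V q (R w)" "m w = 0"
            using False q z by (auto simp: trunc_powr_def m_def min_def max_def)
          then show ?thesis using 1 q by (simp add: g_def)
        next
          case 2
          have "V z (R w) - V z (R w - q) \<le> (1 + \<alpha>) * (q powr \<eta> * R w powr (\<alpha> - \<eta>))"
            using 2 q z eta alpha_pos by (intro trunc_powr_shift_le) auto
          moreover have "m w + q powr \<beta> * indicator {q<..} (R w) = R w powr \<beta>"
            using 2 q by (simp add: m_def)
          ultimately show ?thesis by (simp add: g_def \<beta>_def add_increasing)
        next
          case 3
          then have "V z (R w) = V z (R w - q)"
            using False z by (simp add: trunc_powr_def)
          moreover have "0 \<le> m w" unfolding m_def using False q z \<beta> by (auto intro!: powr_mono2)
          ultimately show ?thesis using alpha_pos by (simp add: g_def)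
        qed
      qed
      also have "expectation g = S q + (1 + \<alpha>) * (q powr \<eta> * (expectation m
          + q powr \<beta> * prob {w \<in> space M. q < R w}))"
      proof -
        have "expectation (\<lambda>w. indicator {q<..} (R w) :: real)
            = expectation (indicator {w \<in> space M. q < R w})"
          by (intro Bochner_Integration.integral_cong) (auto simp: indicator_def)
        then show ?thesis unfolding g_def[abs_def] using mint iint tint by (simp add: S_def)
      qed
      also have "\<dots> \<le> C * (1 + T (2 * z)) * (1 + max 0 (ln q)) + E * (1 + T (2 * z)) * 1"
      proof (intro add_mono)
        show "S q \<le> C * (1 + T (2 * z)) * (1 + max 0 (ln q))" using q False by (intro S_bound) auto
        have tail: "t powr \<alpha> * prob {w \<in> space M. t < R w} \<le> D * (1 + T (2 * z))"
          if "q \<le> t" "t \<le> 2 * z" for t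
        proof -
          have "r t \<le> D * (1 + T t)" using that q by (intro r_le) auto
          also have "\<dots> \<le> D * (1 + T (2 * z))"
            using T_mono[of t "2 * z"] that q D by (intro mult_left_mono) auto
          finally show ?thesis by (simp add: r_def)
        qed
        have "expectation m \<le> \<beta> * (D * (1 + T (2 * z))) * (q powr (\<beta> - \<alpha>) / (\<alpha> - \<beta>))"
          unfolding m_def[abs_def] using q False \<beta> tail
          by (intro expectation_min_powr_diff_le_powr) auto
        then have "q powr \<eta> * expectation m
            \<le> q powr \<eta> * (\<beta> * (D * (1 + T (2 * z))) * (q powr (\<beta> - \<alpha>) / (\<alpha> - \<beta>)))"
          by (intro mult_left_mono) auto
        also have "\<dots> = (q powr \<eta> * q powr (- \<eta>)) * (\<beta> * D / \<eta> * (1 + T (2 * z)))"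
          unfolding \<beta>(3,4) by (simp add: mult_ac)
        also have "q powr \<eta> * q powr (- \<eta>) = 1" using q by (simp flip: powr_add)
        finally have 1: "q powr \<eta> * expectation m \<le> \<beta> * D / \<eta> * (1 + T (2 * z))" by simp
        have "q powr \<eta> * (q powr \<beta> * prob {w \<in> space M. q < R w})
            = q powr \<alpha> * prob {w \<in> space M. q < R w}"
          by (simp add: \<beta>_def mult.assoc[symmetric] flip: powr_add)
        also have "\<dots> \<le> D * (1 + T (2 * z))" using False z q by (intro tail) auto
        finally have 2: "q powr \<eta> * (q powr \<beta> * prob {w \<in> space M. q < R w}) \<le> D * (1 + T (2 * z))" .
        have "(1 + \<alpha>) * (q powr \<eta> * (expectation m + q powr \<beta> * prob {w \<in> space M. q < R w}))
            \<le> (1 + \<alpha>) * (\<beta> * D / \<eta> * (1 + T (2 * z)) + D * (1 + T (2 * z)))"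
          using 1 2 alpha_pos unfolding distrib_left[of "q powr \<eta>"] by (intro mult_left_mono add_mono) auto
        then show "(1 + \<alpha>) * (q powr \<eta> * (expectation m + q powr \<beta> * prob {w \<in> space M. q < R w}))
            \<le> E * (1 + T (2 * z)) * 1"
          by (simp only: E_def distrib_right[of "\<beta> * D / \<eta>" D] mult.assoc mult_1_right)
      qed
      also have "E * (1 + T (2 * z)) * 1 \<le> E * (1 + T (2 * z)) * (1 + max 0 (ln q))"
        using E T_nonneg[of "2 * z"] by (intro mult_left_mono) auto
      finally show ?thesis by (simp add: distrib_right)
    qed
  qed
  then show ?thesis using C E by (intro exI[of _ "C + E"]) auto
qed

lemma ln_le_powr_div: "max 0 (ln t) \<le> t powr s / s" if "0 < s" "0 \<le> t" for s t :: real
proof (cases "1 \<le> t")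
  case True
  then show ?thesis using ln_powr_bound[OF True that(1)] that by simp
next
  case False
  then have "ln t \<le> 0" using that by (cases "t = 0") auto
  then show ?thesis using that by simp
qed

text \<open>The exponent \<alpha>/2 enters through the Potter-type bound on
  \<open>T (c * x)\<close>. Above 1 it is dominated by \<alpha>, where \<open>A_log\<close> applies;
  below 1 the product of a^(\<alpha>/2) and |ln a| is at most 2/\<alpha>.\<close>

lemma integrable_A_powr_ln:
  "integrable M (\<lambda>w. (A w powr \<alpha> + A w powr (\<alpha>/2)) * (1 + \<bar>ln (A w)\<bar>))"
proof -
  have half: "integrable M (\<lambda>w. A w powr (\<alpha>/2))" using alpha_pos by (intro integrable_A_powr) auto
  have "integrable M (\<lambda>w. A w powr \<alpha> + A w powr (\<alpha>/2) + 2 * \<bar>A w powr \<alpha> * ln (A w)\<bar> + 2 * (2 / \<alpha>))"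
    using A_moment_int A_log half by auto
  then show ?thesis
  proof (rule Bochner_Integration.integrable_bound)
    have "(a powr \<alpha> + a powr (\<alpha>/2)) * (1 + \<bar>ln a\<bar>)
        \<le> a powr \<alpha> + a powr (\<alpha>/2) + 2 * \<bar>a powr \<alpha> * ln a\<bar> + 2 * (2 / \<alpha>)" if "0 \<le> a" for a
    proof (cases "1 \<le> a")
      case True
      then have "a powr (\<alpha>/2) \<le> a powr \<alpha>" using alpha_pos by (intro powr_mono) auto
      then have "a powr (\<alpha>/2) * \<bar>ln a\<bar> \<le> a powr \<alpha> * \<bar>ln a\<bar>" by (intro mult_right_mono) auto
      moreover have "0 \<le> 2 * (2 / \<alpha>)" using alpha_pos by simp
      moreover have "\<bar>a powr \<alpha> * ln a\<bar> = a powr \<alpha> * \<bar>ln a\<bar>" by (simp add: abs_mult)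
      ultimately show ?thesis unfolding distrib_left distrib_right mult_1_left mult_1_right by linarith
    next
      case False
      show ?thesis
      proof (cases "a = 0")
        case False
        then have a: "0 < a" "a < 1" using that \<open>\<not> 1 \<le> a\<close> by auto
        then have "a powr \<alpha> \<le> a powr (\<alpha>/2)" using alpha_pos by (intro powr_mono') auto
        then have le: "a powr \<alpha> * \<bar>ln a\<bar> \<le> a powr (\<alpha>/2) * \<bar>ln a\<bar>" by (intro mult_right_mono) auto
        have "\<bar>ln a\<bar> = max 0 (ln (1 / a))" using a by (simp add: ln_div)
        also have "\<dots> \<le> (1 / a) powr (\<alpha>/2) / (\<alpha>/2)" using a alpha_pos by (intro ln_le_powr_div) auto
        finally have "a powr (\<alpha>/2) * \<bar>ln a\<bar> \<le> a powr (\<alpha>/2) * ((1 / a) powr (\<alpha>/2) / (\<alpha>/2))"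
          by (intro mult_left_mono) auto
        also have "\<dots> = 2 / \<alpha>" using a by (simp add: powr_divide)
        finally have "a powr (\<alpha>/2) * \<bar>ln a\<bar> \<le> 2 / \<alpha>" .
        moreover have "0 \<le> a powr \<alpha> * \<bar>ln a\<bar>" by simp
        moreover have "\<bar>a powr \<alpha> * ln a\<bar> = a powr \<alpha> * \<bar>ln a\<bar>" by (simp add: abs_mult)
        ultimately show ?thesis using le
          unfolding distrib_left distrib_right mult_1_left mult_1_right by linarith
      qed (use alpha_pos in simp)
    qed
    then show "AE w in M. norm ((A w powr \<alpha> + A w powr (\<alpha>/2)) * (1 + \<bar>ln (A w)\<bar>))
      \<le> norm (A w powr \<alpha> + A w powr (\<alpha>/2) + 2 * \<bar>A w powr \<alpha> * ln (A w)\<bar> + 2 * (2 / \<alpha>))"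
      using A_nonneg by (intro AE_I2) (auto simp: abs_mult intro: order_trans[OF _ abs_ge_self])
  qed simp
qed

text \<open>Either \<open>B\<^sub>- \<le> A\<^sup>4\<close>, and then \<open>ln\<^sup>+ B\<^sub>-\<close> is at most \<open>4 ln\<^sup>+ A\<close>, or \<open>A\<^sup>\<alpha>\<close> is at most a small power
  of \<open>B\<^sub>-\<close>.\<close>

lemma integrable_A_powr_ln_B:
  "integrable M (\<lambda>w. (A w powr \<alpha> + A w powr (\<alpha>/2)) * (1 + max 0 (ln (max (- B w) 0 / A w))))"
proof -
  have Bint: "integrable M (\<lambda>w. \<bar>B w\<bar> powr (\<alpha>/2))" using alpha_pos by (intro B_moment) auto
  have "integrable M (\<lambda>w. 5 * ((A w powr \<alpha> + A w powr (\<alpha>/2)) * (1 + \<bar>ln (A w)\<bar>))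
      + (8 / \<alpha>) * \<bar>B w\<bar> powr (\<alpha>/2))"
    using integrable_A_powr_ln Bint by auto
  then show ?thesis
  proof (rule Bochner_Integration.integrable_bound)
    have main: "(a powr \<alpha> + a powr (\<alpha>/2)) * (1 + max 0 (ln (b / a)))
        \<le> 5 * ((a powr \<alpha> + a powr (\<alpha>/2)) * (1 + \<bar>ln a\<bar>)) + (8 / \<alpha>) * b powr (\<alpha>/2)"
      if "0 \<le> a" "0 \<le> b" for a b
    proof (cases "a = 0 \<or> b = 0")
      case True
      have "x \<le> 5 * (x * (1 + \<bar>ln a\<bar>))" if "0 \<le> x" for x :: real
        using that mult_nonneg_nonneg[OF that, of "\<bar>ln a\<bar>"] unfolding distrib_left by linarith
      then show ?thesis using True alpha_pos by (auto simp: add_increasing2)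
    next
      case False
      then have ab: "0 < a" "0 < b" using that by auto
      define P where "P = a powr \<alpha> + a powr (\<alpha>/2)"
      have P: "0 \<le> P" by (simp add: P_def)
      have "max 0 (ln (b / a)) \<le> max 0 (ln b) + \<bar>ln a\<bar>" using ab by (simp add: ln_div)
      then have "P * (1 + max 0 (ln (b / a))) \<le> P * (1 + (max 0 (ln b) + \<bar>ln a\<bar>))"
        using P by (intro mult_left_mono) auto
      also have "\<dots> = P * (1 + \<bar>ln a\<bar>) + P * max 0 (ln b)" by (simp add: algebra_simps)
      also have "P * max 0 (ln b) \<le> 4 * (P * (1 + \<bar>ln a\<bar>)) + (8 / \<alpha>) * b powr (\<alpha>/2)"
      \<comment> \<open>In the second case \<open>a \<le> b powr (1/4)\<close>, so \<open>P\<close>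
        is at most a multiple of b^(\<alpha>/4); bounding the logarithm by the same power leaves
        b^(\<alpha>/2), a moment of B of order below \<alpha>.\<close>
      proof (cases "max 0 (ln b) \<le> 4 * \<bar>ln a\<bar>")
        case True
        then have "P * max 0 (ln b) \<le> P * (4 * (1 + \<bar>ln a\<bar>))" using P by (intro mult_left_mono) auto
        moreover have "0 \<le> (8 / \<alpha>) * b powr (\<alpha>/2)" using alpha_pos by simp
        moreover have "P * (4 * (1 + \<bar>ln a\<bar>)) = 4 * (P * (1 + \<bar>ln a\<bar>))" by simp
        ultimately show ?thesis by linarith
      next
        case False
        then have b1: "1 < b" using ab by (cases "1 < b") auto
        then have "4 * ln a < ln b" using False by simp
        then have "ln a \<le> (1/4) * ln b" by simp
        then have "ln a \<le> ln (b powr (1/4))" using ab by (simp add: ln_powr)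
        then have a: "a \<le> b powr (1/4)" using ab by (subst (asm) ln_le_cancel_iff) auto
        have pw: "a powr s \<le> b powr (\<alpha>/4)" if "0 < s" "s \<le> \<alpha>" for s
        proof -
          have "a powr s \<le> (b powr (1/4)) powr s" using a ab that by (intro powr_mono2) auto
          also have "\<dots> \<le> b powr (\<alpha>/4)" using b1 that by (simp add: powr_powr)
          finally show ?thesis .
        qed
        have "P \<le> 2 * b powr (\<alpha>/4)" unfolding P_def using pw[of \<alpha>] pw[of "\<alpha>/2"] alpha_pos by simp
        moreover have "max 0 (ln b) \<le> b powr (\<alpha>/4) / (\<alpha>/4)" using ab alpha_pos by (intro ln_le_powr_div) auto
        ultimately have "P * max 0 (ln b) \<le> (2 * b powr (\<alpha>/4)) * (b powr (\<alpha>/4) / (\<alpha>/4))"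
          using P by (intro mult_mono) auto
        also have "\<dots> = (8 / \<alpha>) * b powr (\<alpha>/2)" by (simp flip: powr_add)
        finally show ?thesis using P by (simp add: add_increasing)
      qed
      finally show ?thesis unfolding P_def[symmetric] by simp
    qed
    have "(A w powr \<alpha> + A w powr (\<alpha>/2)) * (1 + max 0 (ln (max (- B w) 0 / A w)))
      \<le> 5 * ((A w powr \<alpha> + A w powr (\<alpha>/2)) * (1 + \<bar>ln (A w)\<bar>)) + (8 / \<alpha>) * \<bar>B w\<bar> powr (\<alpha>/2)" for w
    proof -
      have "(8 / \<alpha>) * max (- B w) 0 powr (\<alpha>/2) \<le> (8 / \<alpha>) * \<bar>B w\<bar> powr (\<alpha>/2)"
        using alpha_pos by (intro mult_left_mono powr_mono2) auto
      then show ?thesis using main[of "A w" "max (- B w) 0"] A_nonneg[of w] by simp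
    qed
    then show "AE w in M. norm ((A w powr \<alpha> + A w powr (\<alpha>/2)) * (1 + max 0 (ln (max (- B w) 0 / A w))))
      \<le> norm (5 * ((A w powr \<alpha> + A w powr (\<alpha>/2)) * (1 + \<bar>ln (A w)\<bar>)) + (8 / \<alpha>) * \<bar>B w\<bar> powr (\<alpha>/2))"
      by (intro AE_I2) (auto simp: abs_mult intro: order_trans[OF _ abs_ge_self])
  qed simp
qed

end

subsection \<open>The defect of stationarity\<close>

context slow_perpetuity
begin

definition U :: "real \<Rightarrow> real" where
  "U x = expectation (\<lambda>w. A w powr \<alpha> * S (x / A w))"

abbreviation E2 :: "('a \<Rightarrow> 'a \<Rightarrow> real) \<Rightarrow> real" where
  "E2 f \<equiv> \<integral>p. f (fst p) (snd p) \<partial>(M \<Otimes>\<^sub>M M)"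

lemma integrable_pair_trunc_powr:
  assumes "(\<lambda>p. f (fst p) (snd p)) \<in> borel_measurable (M \<Otimes>\<^sub>M M)" and "0 \<le> x"
  shows "integrable (M \<Otimes>\<^sub>M M) (\<lambda>p. V x (f (fst p) (snd p)))"
  using assms alpha_pos trunc_powr_le[of \<alpha> x]
  by (intro pair.P.integrable_const_bound[where B="x powr \<alpha>"]) auto

lemma S_stationary:
  assumes x: "0 \<le> x"
  shows "S x = E2 (\<lambda>w w'. V x (A w * R w' + B w))"
proof -
  have "S x = enn2real (\<integral>\<^sup>+w. ennreal (V x (R w)) \<partial>M)"
    unfolding S_def by (intro integral_eq_nn_integral) auto
  also have "(\<integral>\<^sup>+w. ennreal (V x (R w)) \<partial>M)
      = (\<integral>\<^sup>+w. \<integral>\<^sup>+w'. ennreal (V x (A w * R w' + B w)) \<partial>M \<partial>M)"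
    by (intro stationary) simp
  also have "\<dots> = (\<integral>\<^sup>+p. ennreal (V x (A (fst p) * R (snd p) + B (fst p))) \<partial>(M \<Otimes>\<^sub>M M))"
    by (subst nn_integral_fst[symmetric]) auto
  also have "enn2real \<dots> = E2 (\<lambda>w w'. V x (A w * R w' + B w))"
    by (intro integral_eq_nn_integral[symmetric]) auto
  finally show ?thesis .
qed

lemma E2_iterated:
  fixes f :: "'a \<Rightarrow> 'a \<Rightarrow> real"
  assumes "integrable (M \<Otimes>\<^sub>M M) (\<lambda>p. f (fst p) (snd p))"
  shows "E2 f = expectation (\<lambda>w. expectation (\<lambda>w'. f w w'))"
  using pair.integral_fst'[OF assms] by simp

lemma T_E2: "0 \<le> x \<Longrightarrow> T x = E2 (\<lambda>w w'. V x (B w))"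
  by (subst E2_iterated) (auto intro!: integrable_pair_trunc_powr simp: T_def prob_space)

lemma trunc_powr_A:
  assumes "0 < x"
  shows "V x (A w * z) = A w powr \<alpha> * V (x / A w) z"
  using trunc_powr_scale[of "A w" x \<alpha> z] assms A_nonneg[of w]
  by (cases "A w = 0") auto

lemma U_E2:
  assumes "0 < x"
  shows "U x = E2 (\<lambda>w w'. V x (A w * R w'))"
proof -
  have "E2 (\<lambda>w w'. V x (A w * R w'))
      = expectation (\<lambda>w. expectation (\<lambda>w'. V x (A w * R w')))"
    using assms by (intro E2_iterated integrable_pair_trunc_powr) auto
  then show ?thesis using trunc_powr_A[OF assms] by (simp add: U_def S_def)
qed

text \<open>The mean of \<open>V x (A R) - V x (A R - B_-)\<close> with R an independent copy,
  written so that the bounds on \<open>J\<close> apply for each fixed value of (A, B).\<close>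

definition N :: "real \<Rightarrow> real" where
  "N x = expectation (\<lambda>w. A w powr \<alpha> * J (x / A w) (max (- B w) 0 / A w))"

lemma N_E2:
  assumes x: "0 < x"
  shows "N x = U x - E2 (\<lambda>w w'. V x (A w * R w' - max (- B w) 0))"
proof -
  let ?f = "\<lambda>w w'. V x (A w * R w') - V x (A w * R w' - max (- B w) 0)"
  have eq: "?f w w' = A w powr \<alpha> * (V (x / A w) (R w')
      - V (x / A w) (R w' - max (- B w) 0 / A w))" for w w'
  proof (cases "A w = 0")
    case False
    then have "A w * R w' - max (- B w) 0 = A w * (R w' - max (- B w) 0 / A w)"
      by (simp add: right_diff_distrib)
    then have "V x (A w * R w' - max (- B w) 0)
        = A w powr \<alpha> * V (x / A w) (R w' - max (- B w) 0 / A w)"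
      using trunc_powr_A[OF x] by simp
    then show ?thesis using trunc_powr_A[OF x] by (simp add: right_diff_distrib)
  qed (use x in simp)
  have i: "integrable (M \<Otimes>\<^sub>M M) (\<lambda>p. V x (A (fst p) * R (snd p)))"
    "integrable (M \<Otimes>\<^sub>M M) (\<lambda>p. V x (A (fst p) * R (snd p) - max (- B (fst p)) 0))"
    using x by (auto intro!: integrable_pair_trunc_powr)
  have "E2 ?f = expectation (\<lambda>w. expectation (\<lambda>w'. ?f w w'))"
    using i by (intro E2_iterated) auto
  also have "\<dots> = N x" unfolding eq N_def J_def by simp
  finally show ?thesis using i by (simp add: U_E2[OF x])
qed

lemma pair_product_integrable:
  fixes f g :: "'a \<Rightarrow> real"
  assumes f: "integrable M f" and g: "integrable M g"
  shows "integrable (M \<Otimes>\<^sub>M M) (\<lambda>p. f (fst p) * g (snd p))"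
proof -
  have [measurable]: "f \<in> borel_measurable M" "g \<in> borel_measurable M" using f g by auto
  show ?thesis
  proof (rule pair.Fubini_integrable)
    have "integrable M (\<lambda>w. norm (f w) * expectation (\<lambda>w'. norm (g w')))"
      using f by (intro integrable_mult_left) auto
    then show "integrable M (\<lambda>x. \<integral>y. norm (f (fst (x, y)) * g (snd (x, y))) \<partial>M)"
      using g by (simp add: abs_mult)
  qed (use g in auto)
qed

text \<open>The combination is the mean of \<open>V x (A R + B) - V x B - V x (A R - B_-)\<close>.
  Only outcomes with B positive contribute, and there the interaction is dominated by products with
  finite mean that do not involve \<open>x\<close>.\<close>

lemma cross_terms_bounded: "\<exists>C. \<forall>x>0. \<bar>S x - U x - T x + N x\<bar> \<le> C"
proof -
  define G where "G w w' = (2 + \<alpha> + exp \<alpha>) *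
      ((A w powr \<eta> * max (B w) 0 powr (\<alpha> - \<eta>)) * \<bar>R w'\<bar> powr \<eta>
       + (max (B w) 0 powr \<zeta> * A w powr (\<alpha> - \<zeta>)) * \<bar>R w'\<bar> powr (\<alpha> - \<zeta>))" for w w'
  have Gint: "integrable (M \<Otimes>\<^sub>M M) (\<lambda>p. G (fst p) (snd p))"
    unfolding G_def using mixed mixed' eta zeta
    by (intro integrable_mult_right Bochner_Integration.integrable_add pair_product_integrable R_moment) auto
  have pw: "\<bar>V x (a + b) - V x b - V x (a - max (- b) 0)\<bar>
      \<le> (2 + \<alpha> + exp \<alpha>) * (\<bar>a\<bar> powr \<eta> * max b 0 powr (\<alpha> - \<eta>) + max b 0 powr \<zeta> * \<bar>a\<bar> powr (\<alpha> - \<zeta>))"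
      (is "_ \<le> _ * ?g") if x: "0 < x" for x a b
  proof -
    have g: "0 \<le> ?g" by simp
    have c: "0 \<le> 2 + \<alpha> + exp \<alpha>" using alpha_pos by (simp add: add_nonneg_nonneg)
    show ?thesis
    \<comment> \<open>For negative \<open>b\<close> the expression vanishes, since
      \<open>V x b = 0\<close> and \<open>a - max (- b) 0 = a + b\<close>.\<close>
    proof (cases "0 \<le> b")
      case False
      have "0 \<le> (2 + \<alpha> + exp \<alpha>) * ?g" using g c by (intro mult_nonneg_nonneg)
      then show ?thesis using False x by simp
    next
      case b: True
      show ?thesis
      proof (cases "0 \<le> a")
        case True
        have "\<bar>V x (a + b) - V x a - V x b\<bar>
            \<le> (1 + exp \<alpha>) * (a powr \<eta> * b powr (\<alpha> - \<eta>) + b powr \<zeta> * a powr (\<alpha> - \<zeta>))"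
          using True b x alpha_pos eta zeta by (intro trunc_powr_add_le) auto
        also have "\<dots> = (1 + exp \<alpha>) * ?g" using True b by simp
        also have "\<dots> \<le> (2 + \<alpha> + exp \<alpha>) * ?g" using g alpha_pos by (intro mult_right_mono) auto
        finally show ?thesis using b by (simp add: algebra_simps)
      next
        case False
        have "\<bar>V x (a + b) - V x b\<bar> = V x b - V x (b - (- a))"
          using False x alpha_pos trunc_powr_mono[of \<alpha> x x "a + b" b] by (simp add: add.commute)
        also have "\<dots> \<le> (1 + \<alpha>) * ((- a) powr \<eta> * b powr (\<alpha> - \<eta>))"
          using False b x alpha_pos eta by (intro trunc_powr_shift_le) auto
        also have "\<dots> \<le> (2 + \<alpha> + exp \<alpha>) * ?g"
          using False b alpha_pos by (intro mult_mono) (auto simp: add_nonneg_nonneg)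
        finally show ?thesis using False b x by simp
      qed
    qed
  qed
  have "\<bar>S x - U x - T x + N x\<bar> \<le> E2 G" if x: "0 < x" for x
  proof -
    let ?d = "\<lambda>w w'. V x (A w * R w' + B w) - V x (B w)
        - V x (A w * R w' - max (- B w) 0)"
    have i: "integrable (M \<Otimes>\<^sub>M M) (\<lambda>p. V x (A (fst p) * R (snd p) + B (fst p)))"
      "integrable (M \<Otimes>\<^sub>M M) (\<lambda>p. V x (B (fst p)))"
      "integrable (M \<Otimes>\<^sub>M M) (\<lambda>p. V x (A (fst p) * R (snd p) - max (- B (fst p)) 0))"
      using x by (auto intro!: integrable_pair_trunc_powr)
    have "E2 ?d = E2 (\<lambda>w w'. V x (A w * R w' + B w)) - E2 (\<lambda>w w'. V x (B w))
        - E2 (\<lambda>w w'. V x (A w * R w' - max (- B w) 0))"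
      by (simp only: Bochner_Integration.integral_diff[OF Bochner_Integration.integrable_diff[OF i(1,2)] i(3)]
          Bochner_Integration.integral_diff[OF i(1,2)])
    then have "\<bar>S x - U x - T x + N x\<bar> = \<bar>E2 ?d\<bar>"
      using N_E2[OF x] S_stationary[of x] T_E2[of x] x by linarith
    also have "\<dots> \<le> (\<integral>p. \<bar>?d (fst p) (snd p)\<bar> \<partial>(M \<Otimes>\<^sub>M M))"
      by (rule integral_abs_bound)
    also have "\<dots> \<le> E2 G"
    proof (rule integral_mono[OF _ Gint])
      show "integrable (M \<Otimes>\<^sub>M M) (\<lambda>p. \<bar>?d (fst p) (snd p)\<bar>)"
        by (rule integrable_abs[OF Bochner_Integration.integrable_diff[OF
              Bochner_Integration.integrable_diff[OF i(1,2)] i(3)]])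
      fix p
      show "\<bar>?d (fst p) (snd p)\<bar> \<le> G (fst p) (snd p)"
      proof -
        have abs_eq: "\<bar>A (fst p) * R (snd p)\<bar> powr s = A (fst p) powr s * \<bar>R (snd p)\<bar> powr s" for s
          using A_nonneg[of "fst p"] by (simp add: abs_mult powr_mult)
        have "G (fst p) (snd p) = (2 + \<alpha> + exp \<alpha>) *
            (\<bar>A (fst p) * R (snd p)\<bar> powr \<eta> * max (B (fst p)) 0 powr (\<alpha> - \<eta>)
             + max (B (fst p)) 0 powr \<zeta> * \<bar>A (fst p) * R (snd p)\<bar> powr (\<alpha> - \<zeta>))"
          unfolding G_def abs_eq by (simp only: mult.assoc mult.commute mult.left_commute)
        then show ?thesis using pw[OF x, of "A (fst p) * R (snd p)" "B (fst p)"] by (simp only:)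
      qed
    qed
    finally show ?thesis .
  qed
  then show ?thesis by blast
qed

text \<open>Dominated convergence with two different bounds on \<open>J\<close>: at a fixed outcome
  it stays bounded in \<open>x\<close> while \<open>T\<close> diverges, and the logarithmic bound
  together with \<open>T_scale_le\<close> at \<open>c = 2 / A w\<close> gives an integrable
  majorant.\<close>

lemma N_over_T: "((\<lambda>x. N x / T x) \<longlongrightarrow> 0) at_top"
proof -
  let ?n = "\<lambda>x w. A w powr \<alpha> * J (x / A w) (max (- B w) 0 / A w) / T x"
  obtain C where C: "0 < C" and J_le: "\<And>z q. 0 < z \<Longrightarrow> 0 < q \<Longrightarrow> J z q \<le> C * (1 + T (2 * z)) * (1 + max 0 (ln q))"
    using J_le_ln by auto
  obtain D x\<^sub>0 where D: "0 < D" and x0: "1 \<le> x\<^sub>0"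
    and T_le: "\<And>x c. x\<^sub>0 \<le> x \<Longrightarrow> 0 < c \<Longrightarrow> 1 + T (c * x) \<le> D * (1 + c powr (\<alpha>/2)) * T x"
    using T_scale_le[of "\<alpha>/2"] alpha_pos by auto
  define dom where "dom w = C * D * 2 powr (\<alpha>/2)
    * ((A w powr \<alpha> + A w powr (\<alpha>/2)) * (1 + max 0 (ln (max (- B w) 0 / A w))))" for w
  have dom_nonneg: "0 \<le> dom w" for w unfolding dom_def using C D by (intro mult_nonneg_nonneg) auto
  have J_meas: "(\<lambda>w. J (x / A w) (max (- B w) 0 / A w)) \<in> borel_measurable M" for x
    unfolding J_def by measurable
  have "((\<lambda>x. expectation (?n x)) \<longlongrightarrow> expectation (\<lambda>w. 0)) at_top"
  proof (rule integral_dominated_convergence_at_top)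
    show "integrable M dom" unfolding dom_def by (intro integrable_mult_right integrable_A_powr_ln_B)
    show "?n x \<in> borel_measurable M" for x using J_meas[of x] by measurable
    show "\<forall>\<^sub>F x in at_top. AE w in M. norm (?n x w) \<le> dom w"
      using eventually_ge_at_top[of x\<^sub>0]
    proof eventually_elim
      case (elim x)
      have x: "0 < x" and Tx: "0 < T x" using elim x0 T_pos[of x] by auto
      have "norm (?n x w) \<le> dom w" for w
      proof (cases "A w = 0 \<or> max (- B w) 0 = 0")
        case True
        then show ?thesis using dom_nonneg by auto
      next
        case False
        define a q where "a = A w" and "q = max (- B w) 0 / A w"
        have "0 < A w" "0 < max (- B w) 0" using False A_nonneg[of w] by linarith+
        then have a: "0 < a" and q: "0 < q" unfolding a_def q_def by (blast intro: divide_pos_pos)+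
        have "J (x / a) q \<le> C * (1 + T ((2 / a) * x)) * (1 + max 0 (ln q))"
          using J_le[of "x / a" q] a q x by simp
        also have "\<dots> \<le> C * (D * (1 + (2 / a) powr (\<alpha>/2)) * T x) * (1 + max 0 (ln q))"
          using C T_le[OF elim, of "2 / a"] a by (intro mult_right_mono mult_left_mono) auto
        finally have "a powr \<alpha> * J (x / a) q
            \<le> a powr \<alpha> * (C * (D * (1 + (2 / a) powr (\<alpha>/2)) * T x) * (1 + max 0 (ln q)))"
          by (intro mult_left_mono) auto
        also have "\<dots> = C * D * ((a powr \<alpha> * (1 + (2 / a) powr (\<alpha>/2))) * (1 + max 0 (ln q))) * T x"
          by (simp add: mult_ac)
        finally have "a powr \<alpha> * J (x / a) q / T x
            \<le> C * D * ((a powr \<alpha> * (1 + (2 / a) powr (\<alpha>/2))) * (1 + max 0 (ln q)))"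
          using Tx by (simp add: field_simps)
        also have "a powr \<alpha> * (1 + (2 / a) powr (\<alpha>/2)) \<le> 2 powr (\<alpha>/2) * (a powr \<alpha> + a powr (\<alpha>/2))"
        proof -
          have "a powr \<alpha> = a powr (\<alpha>/2) * a powr (\<alpha>/2)" by (simp flip: powr_add)
          then have "a powr \<alpha> * (2 / a) powr (\<alpha>/2) = 2 powr (\<alpha>/2) * a powr (\<alpha>/2)"
            using a by (simp add: powr_divide)
          moreover have "1 * a powr \<alpha> \<le> 2 powr (\<alpha>/2) * a powr \<alpha>"
            using alpha_pos by (intro mult_right_mono ge_one_powr_ge_zero) auto
          ultimately show ?thesis by (simp add: distrib_left)
        qed
        finally have "a powr \<alpha> * J (x / a) q / T x
            \<le> C * D * ((2 powr (\<alpha>/2) * (a powr \<alpha> + a powr (\<alpha>/2))) * (1 + max 0 (ln q)))"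
          using C D by (simp add: mult_left_mono mult_right_mono)
        then have "?n x w \<le> dom w" by (simp add: dom_def a_def q_def mult.assoc)
        moreover have "0 \<le> ?n x w" using J_nonneg[of "x / a" q] a q x Tx by (simp add: a_def q_def)
        ultimately show ?thesis by simp
      qed
      then show ?case by simp
    qed
    show "AE w in M. ((\<lambda>x. ?n x w) \<longlongrightarrow> 0) at_top"
    proof (intro AE_I2)
      fix w
      define c where "c = A w powr \<alpha> * ((1 + \<alpha>) * ((max (- B w) 0 / A w) powr \<eta>
          * expectation (\<lambda>w. \<bar>R w\<bar> powr (\<alpha> - \<eta>))))"
      show "((\<lambda>x. ?n x w) \<longlongrightarrow> 0) at_top"
      proof (cases "A w = 0")
        case False
        then have A: "0 < A w" using A_nonneg[of w] by simp
        show ?thesis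
        proof (rule tendsto_sandwich)
          show "\<forall>\<^sub>F x in at_top. 0 \<le> ?n x w"
            using eventually_gt_at_top[of 0]
            by eventually_elim (use A T_nonneg in \<open>auto intro!: divide_nonneg_nonneg mult_nonneg_nonneg J_nonneg\<close>)
          show "\<forall>\<^sub>F x in at_top. ?n x w \<le> c / T x"
            using eventually_gt_at_top[of 0]
          proof eventually_elim
            case (elim x)
            then have "J (x / A w) (max (- B w) 0 / A w) \<le> (1 + \<alpha>) * ((max (- B w) 0 / A w) powr \<eta>
                * expectation (\<lambda>w. \<bar>R w\<bar> powr (\<alpha> - \<eta>)))"
              using A by (intro J_le_powr) auto
            from mult_left_mono[OF this, of "A w powr \<alpha>"]
            show ?case unfolding c_def using T_pos[OF elim]
              by (intro divide_right_mono) simp_all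
          qed
          show "((\<lambda>x. c / T x) \<longlongrightarrow> 0) at_top"
            by (rule tendsto_divide_0[OF tendsto_const filterlim_at_top_imp_at_infinity[OF T_at_top]])
        qed simp
      qed simp
    qed
  qed simp
  then show ?thesis by (simp add: N_def)
qed

lemma S_minus_U_over_T: "((\<lambda>x. (S x - U x) / T x) \<longlongrightarrow> 1) at_top"
proof -
  obtain C where C: "\<And>x. 0 < x \<Longrightarrow> \<bar>S x - U x - T x + N x\<bar> \<le> C" using cross_terms_bounded by auto
  have "((\<lambda>x. (S x - U x - T x + N x) / T x) \<longlongrightarrow> 0) at_top"
  proof (rule Lim_null_comparison)
    show "\<forall>\<^sub>F x in at_top. norm ((S x - U x - T x + N x) / T x) \<le> C / T x"
      using eventually_gt_at_top[of 0]
    proof eventually_elim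
      case (elim x)
      then show ?case using divide_right_mono[OF C[OF elim], of "T x"] T_pos[OF elim] by simp
    qed
    show "((\<lambda>x. C / T x) \<longlongrightarrow> 0) at_top"
      by (rule tendsto_divide_0[OF tendsto_const filterlim_at_top_imp_at_infinity[OF T_at_top]])
  qed
  from tendsto_diff[OF this N_over_T]
  have "((\<lambda>x. 1 + ((S x - U x - T x + N x) / T x - N x / T x)) \<longlongrightarrow> 1) at_top"
    using tendsto_add[OF tendsto_const[of 1 at_top]] by force
  then show ?thesis
  proof (rule Lim_transform_eventually)
    show "\<forall>\<^sub>F x in at_top. 1 + ((S x - U x - T x + N x) / T x - N x / T x) = (S x - U x) / T x"
      using eventually_gt_at_top[of 0]
    proof eventually_elim
      case (elim x)
      then show ?case using T_pos[OF elim] by (simp add: diff_divide_distrib add_divide_distrib)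
    qed
  qed
qed

end

subsection \<open>Limits of the normalised truncated moment\<close>

text \<open>The pointwise part of Arzela-Ascoli, sufficient for dominated convergence: a diagonal
  subsequence converges on the rationals, and the local Lipschitz bound carries the Cauchy property
  to every point.\<close>

lemma equicontinuous_subseq:
  fixes f :: "nat \<Rightarrow> real \<Rightarrow> real"
  assumes bound: "\<And>n y. \<bar>f n y\<bar> \<le> b y"
    and equicont: "\<And>m n y z. \<bar>y\<bar> \<le> m \<Longrightarrow> \<bar>z\<bar> \<le> m \<Longrightarrow> \<bar>f n y - f n z\<bar> \<le> K m * \<bar>y - z\<bar>"
  obtains k F where "strict_mono (k :: nat \<Rightarrow> nat)" "\<And>y. (\<lambda>n. f (k n) y) \<longlonglongrightarrow> F y"
proof -
  have b: "0 \<le> b y" for y using bound[of 0 y] by linarith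
  obtain k :: "nat \<Rightarrow> nat" where k: "strict_mono k"
    and conv: "\<And>q. q \<in> \<rat> \<Longrightarrow> \<exists>l. (\<lambda>n. f (k n) q / (1 + b q)) \<longlonglongrightarrow> l"
  \<comment> \<open>Division by \<open>1 + b q\<close> turns the bound depending on the point into
    the uniform bound 1.\<close>
  proof (rule function_convergent_subsequence[of "\<rat>" "\<lambda>n q. f n q / (1 + b q)" 1])
    show "norm (f n q / (1 + b q)) \<le> 1" for n q using bound[of n q] b[of q] by simp
  qed (use countable_rat in auto)
  have "convergent (\<lambda>n. f (k n) y)" for y
  proof (subst Cauchy_convergent_iff[symmetric], rule metric_CauchyI)
    fix e :: real assume e: "0 < e"
    define m where "m = \<bar>y\<bar> + 1"
    define K' where "K' = \<bar>K m\<bar> + 1"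
    have K': "0 < K'" "K m \<le> K'" by (auto simp: K'_def)
    define d where "d = min 1 (e / (3 * K'))"
    have d: "0 < d" "d \<le> 1" "K' * d \<le> e / 3"
      using e K' by (auto simp: d_def min_def field_simps)
    obtain q where q: "q \<in> \<rat>" "y < q" "q < y + d" using Rats_dense_in_real[of y "y + d"] d by auto
    have near: "\<bar>f n y - f n q\<bar> \<le> e / 3" for n
    proof -
      have "\<bar>f n y - f n q\<bar> \<le> K m * \<bar>y - q\<bar>" using q d by (intro equicont) (auto simp: m_def)
      also have "\<dots> \<le> K' * d" using q K' by (intro mult_mono) auto
      finally show ?thesis using d by simp
    qed
    obtain l where "(\<lambda>n. f (k n) q / (1 + b q)) \<longlonglongrightarrow> l" using conv[OF q(1)] by blast
    from tendsto_mult_right[OF this, of "1 + b q"]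
    have "(\<lambda>n. f (k n) q) \<longlonglongrightarrow> l * (1 + b q)" using b[of q] by (simp add: add_nonneg_eq_0_iff)
    then have "Cauchy (\<lambda>n. f (k n) q)" by (rule LIMSEQ_imp_Cauchy)
    then obtain N where N: "\<And>i j. N \<le> i \<Longrightarrow> N \<le> j \<Longrightarrow> dist (f (k i) q) (f (k j) q) < e / 3"
      using e unfolding Cauchy_def by (meson divide_pos_pos zero_less_numeral)
    show "\<exists>N. \<forall>i\<ge>N. \<forall>j\<ge>N. dist (f (k i) y) (f (k j) y) < e"
    proof (intro exI[of _ N] allI impI)
      fix i j assume "N \<le> i" "N \<le> j"
      then show "dist (f (k i) y) (f (k j) y) < e"
        using N[of i j] near[of "k i"] near[of "k j"] unfolding dist_real_def by linarith
    qed
  qed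
  then have "\<And>y. (\<lambda>n. f (k n) y) \<longlonglongrightarrow> lim (\<lambda>n. f (k n) y)" by (simp add: convergent_LIMSEQ_iff)
  with k show thesis by (rule that)
qed

text \<open>Subtracting the linear function through \<open>F 1\<close> leaves an additive
  \<open>G\<close> that vanishes on the integers. It is then periodic, hence bounded by its values
  on the unit interval, and a bounded additive function is zero.\<close>

lemma additive_bounded_imp_linear:
  fixes F :: "real \<Rightarrow> real"
  assumes add: "\<And>x y. F (x + y) = F x + F y" and bound: "\<And>y. \<bar>F y\<bar> \<le> C * \<bar>y\<bar>"
  shows "F y = y * F 1"
proof -
  define G where "G y = F y - y * F 1" for y
  have G_add: "G (x + y) = G x + G y" for x y by (simp add: G_def add algebra_simps)
  have G_nat: "G (real n * y) = real n * G y" for n y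
  proof (induction n)
    case 0
    show ?case using G_add[of 0 0] by simp
  next
    case (Suc n)
    then show ?case using G_add[of "real n * y" y] by (simp add: algebra_simps)
  qed
  have G_minus: "G (- y) = - G y" for y using G_add[of y "- y"] G_nat[of 0] by simp
  have G_1: "G 1 = 0" by (simp add: G_def)
  have G_int: "G (of_int k) = 0" for k
    by (cases k rule: int_cases2) (use G_nat[of _ 1] G_1 G_minus in auto)
  define D where "D = \<bar>C\<bar> + \<bar>F 1\<bar>"
  have G_bound: "\<bar>G y\<bar> \<le> D" for y
  proof -
    have "G y = G (frac y)" using G_add[of "of_int \<lfloor>y\<rfloor>" "frac y"] G_int by (simp add: frac_def)
    moreover have "\<bar>G (frac y)\<bar> \<le> D"
    proof -
      have f: "0 \<le> frac y" "frac y \<le> 1" using frac_lt_1[of y] by auto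
      have "\<bar>G (frac y)\<bar> \<le> \<bar>F (frac y)\<bar> + \<bar>frac y * F 1\<bar>" unfolding G_def by (rule abs_triangle_ineq4)
      also have "\<bar>frac y * F 1\<bar> \<le> \<bar>F 1\<bar>" using f by (simp add: abs_mult mult_left_le_one_le)
      also have "\<bar>F (frac y)\<bar> \<le> \<bar>C\<bar>"
      proof -
        have "\<bar>F (frac y)\<bar> \<le> C * frac y" using bound[of "frac y"] f by simp
        also have "\<dots> \<le> \<bar>C\<bar> * 1" using f by (intro mult_mono) auto
        finally show ?thesis by simp
      qed
      finally show ?thesis by (simp add: D_def)
    qed
    ultimately show ?thesis by simp
  qed
  have "G y = 0"
  proof (rule ccontr)
    assume "G y \<noteq> 0"
    then obtain n :: nat where "D < n * \<bar>G y\<bar>" using reals_Archimedean3[of "\<bar>G y\<bar>"] by auto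
    then show False using G_bound[of "n * y"] by (simp add: G_nat abs_mult)
  qed
  then show ?thesis by (simp add: G_def)
qed

context slow_perpetuity
begin

definition \<rho> :: real where "\<rho> = expectation (\<lambda>w. A w powr \<alpha> * ln (A w))"

definition \<Phi> :: "real \<Rightarrow> real \<Rightarrow> real" where
  "\<Phi> x y = (S (x * exp y) - S x) / T x"

lemma Phi_0 [simp]: "\<Phi> x 0 = 0"
  by (simp add: \<Phi>_def)

lemma Phi_mono: "0 < x \<Longrightarrow> a \<le> b \<Longrightarrow> \<Phi> x a \<le> \<Phi> x b"
  unfolding \<Phi>_def using T_nonneg[of x] by (intro divide_right_mono) (auto intro!: S_mono)

lemma Phi_diff_le:
  "\<exists>C>0. \<forall>x>0. \<forall>a b. a \<le> b \<longrightarrow> \<Phi> x b - \<Phi> x a \<le> C * ((1 + T (exp b * x)) / T x) * (b - a)"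
proof -
  obtain C where C: "0 < C" and le: "\<And>u v. 0 < u \<Longrightarrow> u \<le> v \<Longrightarrow> S v - S u \<le> C * (1 + T v) * ln (v / u)"
    using S_diff_le_ln by auto
  have "\<Phi> x b - \<Phi> x a \<le> C * ((1 + T (exp b * x)) / T x) * (b - a)" if "0 < x" "a \<le> b" for x a b
  proof -
    have "ln (x * exp b / (x * exp a)) = b - a" using that by (simp flip: exp_diff)
    then have "S (x * exp b) - S (x * exp a) \<le> C * (1 + T (exp b * x)) * (b - a)"
      using le[of "x * exp a" "x * exp b"] that by (simp add: mult.commute)
    then have "(S (x * exp b) - S (x * exp a)) / T x \<le> C * (1 + T (exp b * x)) * (b - a) / T x"
      using T_nonneg[of x] by (rule divide_right_mono)
    then show ?thesis by (simp add: \<Phi>_def flip: diff_divide_distrib)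
  qed
  then show ?thesis using C by blast
qed

text \<open>One estimate for two purposes: on bounded ranges of \<open>a\<close> and
  \<open>b\<close> it gives equicontinuity, and its growth exponent \<alpha>/2 keeps it integrable
  against A^\<alpha> when an argument is shifted by ln A.\<close>

lemma Phi_bound:
  "\<exists>C>0. \<exists>x\<^sub>0\<ge>1. \<forall>x\<ge>x\<^sub>0. \<forall>a b. \<bar>\<Phi> x b - \<Phi> x a\<bar> \<le> C * (1 + exp (\<alpha>/2 * max a b)) * \<bar>b - a\<bar>"
proof -
  obtain C where C: "0 < C" and le: "\<And>x a b. 0 < x \<Longrightarrow> a \<le> b \<Longrightarrow>
      \<Phi> x b - \<Phi> x a \<le> C * ((1 + T (exp b * x)) / T x) * (b - a)"
    using Phi_diff_le by auto
  obtain D x\<^sub>0 where D: "0 < D" and x0: "1 \<le> x\<^sub>0"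
    and T_le: "\<And>x c. x\<^sub>0 \<le> x \<Longrightarrow> 0 < c \<Longrightarrow> 1 + T (c * x) \<le> D * (1 + c powr (\<alpha>/2)) * T x"
    using T_scale_le[of "\<alpha>/2"] alpha_pos by auto
  have *: "\<bar>\<Phi> x b - \<Phi> x a\<bar> \<le> C * D * (1 + exp (\<alpha>/2 * b)) * (b - a)" if x: "x\<^sub>0 \<le> x" and ab: "a \<le> b" for x a b
  proof -
    have x_pos: "0 < x" using x x0 by simp
    have "(1 + T (exp b * x)) / T x \<le> D * (1 + exp b powr (\<alpha>/2))"
      using T_le[OF x, of "exp b"] T_pos[OF x_pos] by (simp add: field_simps)
    also have "exp b powr (\<alpha>/2) = exp (\<alpha>/2 * b)" by (simp add: powr_def)
    finally have "C * ((1 + T (exp b * x)) / T x) * (b - a) \<le> C * (D * (1 + exp (\<alpha>/2 * b))) * (b - a)"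
      using C ab by (intro mult_right_mono mult_left_mono) auto
    then show ?thesis using le[OF x_pos ab] Phi_mono[OF x_pos ab] by (simp add: mult.assoc)
  qed
  have "\<bar>\<Phi> x b - \<Phi> x a\<bar> \<le> C * D * (1 + exp (\<alpha>/2 * max a b)) * \<bar>b - a\<bar>" if x: "x\<^sub>0 \<le> x" for x a b
    using *[OF x, of a b] *[OF x, of b a] by (cases "a \<le> b") (auto simp: max_def abs_minus_commute)
  then show ?thesis using C D x0 by (intro exI[of _ "C * D"]) auto
qed

lemma Phi_A:
  assumes "0 < A w"
  shows "\<Phi> x y - \<Phi> x (y - ln (A w)) = (S (x * exp y) - S (x * exp y / A w)) / T x"
  using assms by (simp add: \<Phi>_def exp_diff flip: diff_divide_distrib)

lemma S_le_powr: "0 \<le> x \<Longrightarrow> S x \<le> x powr \<alpha>"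
  unfolding S_def using trunc_powr_le[of \<alpha> x] alpha_pos
  by (intro integral_le_const integrable_trunc_powr) auto

lemma S_measurable [measurable]: "S \<in> borel_measurable borel"
  unfolding S_def by measurable

lemma Phi_identity:
  assumes x: "0 < x"
  shows "expectation (\<lambda>w. A w powr \<alpha> * (\<Phi> x y - \<Phi> x (y - ln (A w))))
    = (S (x * exp y) - U (x * exp y)) / T x"
proof -
  let ?z = "x * exp y"
  have z: "0 < ?z" using x by simp
  have i: "integrable M (\<lambda>w. A w powr \<alpha> * S (?z / A w))"
  proof (rule integrable_const_bound[where B="?z powr \<alpha>"])
    have "A w powr \<alpha> * S (?z / A w) \<le> ?z powr \<alpha>" for w
    proof (cases "A w = 0")
      case False
      then have A: "0 < A w" using A_nonneg[of w] by simp
      have "A w powr \<alpha> * S (?z / A w) \<le> A w powr \<alpha> * (?z / A w) powr \<alpha>"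
        using A z by (intro mult_left_mono S_le_powr) auto
      also have "\<dots> = ?z powr \<alpha>" using A z by (simp add: powr_divide)
      finally show ?thesis .
    qed simp
    then show "AE w in M. norm (A w powr \<alpha> * S (?z / A w)) \<le> ?z powr \<alpha>"
      using S_nonneg by simp
  qed measurable
  have "A w powr \<alpha> * (\<Phi> x y - \<Phi> x (y - ln (A w)))
      = (A w powr \<alpha> * S ?z - A w powr \<alpha> * S (?z / A w)) / T x" for w
  proof (cases "A w = 0")
    case False
    then have "0 < A w" using A_nonneg[of w] by simp
    then show ?thesis by (simp add: Phi_A right_diff_distrib)
  qed simp
  then show ?thesis
    using i A_moment_int A_moment by (simp add: U_def)
qed

lemma Phi_limit:
  assumes "filterlim X at_top sequentially"
  shows "(\<lambda>n. (S (X n * exp y) - U (X n * exp y)) / T (X n)) \<longlonglongrightarrow> 1"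
proof -
  have lim: "filterlim (\<lambda>x. exp y * x) at_top at_top"
    by (simp add: filterlim_tendsto_pos_mult_at_top[OF tendsto_const _ filterlim_ident])
  have "((\<lambda>x. (S (exp y * x) - U (exp y * x)) / T (exp y * x) * (T (exp y * x) / T x)) \<longlongrightarrow> 1 * 1) at_top"
    by (intro tendsto_mult filterlim_compose[OF S_minus_U_over_T lim] T_slow) simp
  then have "((\<lambda>x. (S (x * exp y) - U (x * exp y)) / T x) \<longlongrightarrow> 1 * 1) at_top"
  proof (rule Lim_transform_eventually)
    show "\<forall>\<^sub>F x in at_top. (S (exp y * x) - U (exp y * x)) / T (exp y * x) * (T (exp y * x) / T x)
        = (S (x * exp y) - U (x * exp y)) / T x"
      using eventually_gt_at_top[of 0]
    proof eventually_elim
      case (elim x)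
      then show ?case using T_pos[of "exp y * x"] by (simp add: mult.commute)
    qed
  qed
  then show ?thesis using filterlim_compose[OF _ assms] by simp
qed

lemma Phi_subseq_limit:
  assumes X: "filterlim X at_top sequentially" "\<And>n. x\<^sub>0 \<le> X n" and "0 < C" "1 \<le> x\<^sub>0"
    and C: "\<And>x a b. x\<^sub>0 \<le> x \<Longrightarrow> \<bar>\<Phi> x b - \<Phi> x a\<bar> \<le> C * (1 + exp (\<alpha>/2 * max a b)) * \<bar>b - a\<bar>"
    and F: "\<And>y. (\<lambda>n. \<Phi> (X n) y) \<longlonglongrightarrow> F y"
  shows "F y = y / \<rho>"
proof -
  have X_pos: "0 < X n" for n using X(2)[of n] \<open>1 \<le> x\<^sub>0\<close> by linarith
  have F_0: "F 0 = 0" using F[of 0] by (simp add: LIMSEQ_const_iff)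
  obtain D where D: "0 < D" and D_le: "\<And>x a b. 0 < x \<Longrightarrow> a \<le> b \<Longrightarrow>
      \<Phi> x b - \<Phi> x a \<le> D * ((1 + T (exp b * x)) / T x) * (b - a)"
    using Phi_diff_le by auto
  have F_mono: "F a \<le> F b" if "a \<le> b" for a b
    by (rule LIMSEQ_le[OF F F]) (use that X_pos in \<open>auto intro: Phi_mono\<close>)
  \<comment> \<open>At finite \<open>x\<close> the Lipschitz constant contains
    \<open>(1 + T (exp b * x)) / T x\<close>; slow variation and divergence of \<open>T\<close> send
    this ratio to 1, so the limit has a constant independent of \<open>b\<close>.\<close>
  have F_lip1: "F b - F a \<le> D * (b - a)" if ab: "a \<le> b" for a b
  proof (rule LIMSEQ_le)
    show "(\<lambda>n. \<Phi> (X n) b - \<Phi> (X n) a) \<longlonglongrightarrow> F b - F a" by (intro tendsto_diff F)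
    have "((\<lambda>x. 1 / T x + T (exp b * x) / T x) \<longlongrightarrow> 0 + 1) at_top"
      by (intro tendsto_add T_slow tendsto_divide_0[OF tendsto_const filterlim_at_top_imp_at_infinity[OF T_at_top]]) simp
    then have "((\<lambda>x. D * ((1 + T (exp b * x)) / T x) * (b - a)) \<longlongrightarrow> D * 1 * (b - a)) at_top"
      by (intro tendsto_mult tendsto_const) (simp add: add_divide_distrib)
    then show "(\<lambda>n. D * ((1 + T (exp b * X n)) / T (X n)) * (b - a)) \<longlonglongrightarrow> D * (b - a)"
      using filterlim_compose[OF _ X(1)] by fastforce
    show "\<exists>N. \<forall>n\<ge>N. \<Phi> (X n) b - \<Phi> (X n) a \<le> D * ((1 + T (exp b * X n)) / T (X n)) * (b - a)"
      using D_le[OF X_pos ab] by blast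
  qed
  have F_lip: "\<bar>F b - F a\<bar> \<le> D * \<bar>b - a\<bar>" for a b
    using F_lip1[of a b] F_lip1[of b a] F_mono[of a b] F_mono[of b a] by (cases "a \<le> b") auto
  have F_cont: "continuous_on UNIV F"
  proof (rule continuous_onI)
    fix x e :: real assume "0 < e"
    then show "\<exists>d>0. \<forall>x'\<in>UNIV. dist x' x < d \<longrightarrow> dist (F x') (F x) \<le> e"
    proof (intro exI[of _ "e / D"] conjI ballI impI)
      fix x' assume "dist x' x < e / D"
      then have "D * \<bar>x' - x\<bar> \<le> e" using D by (simp add: dist_real_def field_simps)
      then show "dist (F x') (F x) \<le> e" using F_lip[of x' x] by (simp add: dist_real_def)
    qed (use D in auto)
  qed
  then have F_meas [measurable]: "F \<in> borel_measurable borel" by (rule borel_measurable_continuous_onI)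
  \<comment> \<open>The shift by ln A costs a factor at most
    \<open>1 + a powr (- (\<alpha>/2))\<close>; multiplied by the weight
    \<open>a powr \<alpha>\<close> it yields the two powers of A here.\<close>
  define dom where "dom y w = C * (1 + exp (\<alpha>/2 * y))
      * ((A w powr \<alpha> + A w powr (\<alpha>/2)) * (1 + \<bar>ln (A w)\<bar>))" for y w
  have dom_int: "integrable M (dom y)" for y
    unfolding dom_def by (intro integrable_mult_right integrable_A_powr_ln)
  have dom_le: "\<bar>A w powr \<alpha> * (\<Phi> (X n) y - \<Phi> (X n) (y - ln (A w)))\<bar> \<le> dom y w" for n y w
  proof (cases "A w = 0")
    case True
    then show ?thesis using \<open>0 < C\<close> by (simp add: dom_def)
  next
    case False
    define a where "a = A w"
    have a: "0 < a" using False A_nonneg[of w] by (simp add: a_def)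
    have "max (y - ln a) y = y + max 0 (- ln a)" by simp
    then have "exp (\<alpha>/2 * max (y - ln a) y) = exp (\<alpha>/2 * y) * exp (\<alpha>/2 * max 0 (- ln a))"
      by (simp only: distrib_left exp_add)
    also have "exp (\<alpha>/2 * max 0 (- ln a)) \<le> 1 + exp (\<alpha>/2 * (- ln a))" by (simp add: max_def)
    also have "exp (\<alpha>/2 * (- ln a)) = a powr (- (\<alpha>/2))" using a by (simp add: powr_def)
    finally have e: "exp (\<alpha>/2 * max (y - ln a) y) \<le> exp (\<alpha>/2 * y) * (1 + a powr (- (\<alpha>/2)))" by simp
    have "1 + exp (\<alpha>/2 * y) * (1 + a powr (- (\<alpha>/2))) \<le> (1 + exp (\<alpha>/2 * y)) * (1 + a powr (- (\<alpha>/2)))"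
      by (simp add: algebra_simps)
    then have e': "1 + exp (\<alpha>/2 * max (y - ln a) y) \<le> (1 + exp (\<alpha>/2 * y)) * (1 + a powr (- (\<alpha>/2)))"
      using e by linarith
    have "\<bar>\<Phi> (X n) y - \<Phi> (X n) (y - ln a)\<bar> \<le> C * (1 + exp (\<alpha>/2 * max (y - ln a) y)) * \<bar>ln a\<bar>"
      using C[OF X(2)[of n], of y "y - ln a"] by simp
    also have "\<dots> \<le> C * ((1 + exp (\<alpha>/2 * y)) * (1 + a powr (- (\<alpha>/2)))) * (1 + \<bar>ln a\<bar>)"
      using e' \<open>0 < C\<close> by (intro mult_mono mult_left_mono) (auto intro!: mult_nonneg_nonneg add_nonneg_nonneg)
    finally have "a powr \<alpha> * \<bar>\<Phi> (X n) y - \<Phi> (X n) (y - ln a)\<bar>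
        \<le> a powr \<alpha> * (C * ((1 + exp (\<alpha>/2 * y)) * (1 + a powr (- (\<alpha>/2)))) * (1 + \<bar>ln a\<bar>))"
      by (intro mult_left_mono) auto
    also have "\<dots> = C * (1 + exp (\<alpha>/2 * y)) * ((a powr \<alpha> * (1 + a powr (- (\<alpha>/2)))) * (1 + \<bar>ln a\<bar>))"
      by (simp only: mult.assoc mult.commute mult.left_commute)
    also have "a powr \<alpha> * (1 + a powr (- (\<alpha>/2))) = a powr \<alpha> + a powr (\<alpha>/2)"
      by (simp add: distrib_left flip: powr_add)
    finally show ?thesis by (simp add: dom_def a_def abs_mult)
  qed
  have id: "expectation (\<lambda>w. A w powr \<alpha> * (F y - F (y - ln (A w)))) = 1"
    and id_int: "integrable M (\<lambda>w. A w powr \<alpha> * (F y - F (y - ln (A w))))" for y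
  proof -
    have Phi_meas: "\<Phi> x \<in> borel_measurable borel" for x unfolding \<Phi>_def by measurable
    have meas: "(\<lambda>w. A w powr \<alpha> * (\<Phi> (X n) y - \<Phi> (X n) (y - ln (A w)))) \<in> borel_measurable M" for n
      using Phi_meas[of "X n"] by measurable
    have lim: "(\<lambda>n. A w powr \<alpha> * (\<Phi> (X n) y - \<Phi> (X n) (y - ln (A w))))
        \<longlonglongrightarrow> A w powr \<alpha> * (F y - F (y - ln (A w)))" for w
      by (intro tendsto_intros F)
    have "(\<lambda>n. expectation (\<lambda>w. A w powr \<alpha> * (\<Phi> (X n) y - \<Phi> (X n) (y - ln (A w)))))
        \<longlonglongrightarrow> expectation (\<lambda>w. A w powr \<alpha> * (F y - F (y - ln (A w))))"
      by (rule integral_dominated_convergence[where w="dom y" and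
            s="\<lambda>n w. A w powr \<alpha> * (\<Phi> (X n) y - \<Phi> (X n) (y - ln (A w)))"])
        (use meas dom_int lim dom_le in auto)
    moreover have "(\<lambda>n. expectation (\<lambda>w. A w powr \<alpha> * (\<Phi> (X n) y - \<Phi> (X n) (y - ln (A w))))) \<longlonglongrightarrow> 1"
      using Phi_limit[OF X(1), of y] by (simp add: Phi_identity X_pos)
    ultimately show "expectation (\<lambda>w. A w powr \<alpha> * (F y - F (y - ln (A w)))) = 1"
      by (rule LIMSEQ_unique)
    show "integrable M (\<lambda>w. A w powr \<alpha> * (F y - F (y - ln (A w))))"
      by (rule integrable_dominated_convergence[where w="dom y" and
            s="\<lambda>n w. A w powr \<alpha> * (\<Phi> (X n) y - \<Phi> (X n) (y - ln (A w)))"])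
        (use meas dom_int lim dom_le in auto)
  qed
  \<comment> \<open>A probability because A^\<alpha> has mean 1. It gives no mass to A = 0, so the
    value of \<open>ln 0\<close> does not matter.\<close>
  define N where "N = density M (\<lambda>w. ennreal (A w powr \<alpha>))"
  have N_int: "(\<integral>w. f w \<partial>N) = expectation (\<lambda>w. A w powr \<alpha> * f w)"
    if "f \<in> borel_measurable M" for f :: "'a \<Rightarrow> real"
    unfolding N_def using that by (subst integral_density) auto
  have "emeasure N (space N) = 1"
    unfolding N_def using A_moment_int A_moment
    by (simp add: emeasure_density nn_integral_eq_integral cong: nn_integral_cong)
  then interpret N: prob_space N by (rule prob_spaceI)
  have add: "F (y + h) = F y + F h" for y h
  proof -
    define H where "H y = F (y + h) - F y" for y
    have "H y = H 0"
    proof (rule N.bounded_continuous_harmonic_const[where \<xi>="\<lambda>w. ln (A w)" and C="D * \<bar>h\<bar>"])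
      show "(\<lambda>w. ln (A w)) \<in> borel_measurable N" by (simp add: N_def)
      show cont: "continuous_on UNIV H" unfolding H_def
        by (intro continuous_intros F_cont continuous_on_compose2[OF F_cont]) auto
      have [measurable]: "H \<in> borel_measurable borel" using cont by (rule borel_measurable_continuous_onI)
      show "\<bar>H y\<bar> \<le> D * \<bar>h\<bar>" for y using F_lip[of "y + h" y] by (simp add: H_def)
      show "H y = (\<integral>w. H (y - ln (A w)) \<partial>N)" for y
      proof -
        \<comment> \<open>Harmonicity of the increment: the identity for \<open>F\<close> has the
          value 1 at both \<open>y + h\<close> and \<open>y\<close>, and the two values
          cancel.\<close>
        have eq: "A w powr \<alpha> * H (y - ln (A w)) = A w powr \<alpha> * H y
            - (A w powr \<alpha> * (F (y + h) - F (y + h - ln (A w))) - A w powr \<alpha> * (F y - F (y - ln (A w))))" for w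
          by (simp add: H_def algebra_simps)
        have "(\<integral>w. H (y - ln (A w)) \<partial>N) = expectation (\<lambda>w. A w powr \<alpha> * H (y - ln (A w)))"
          by (rule N_int) measurable
        also have "\<dots> = H y - (1 - 1)"
          unfolding eq using id_int[of "y + h"] id_int[of y] id[of "y + h"] id[of y] A_moment_int A_moment
          by simp
        finally show ?thesis by simp
      qed
      show "\<not> (AE w in N. \<exists>k::int. ln (A w) = d * of_int k)" if "0 < d" for d
      proof -
        have "(AE w in N. \<exists>k::int. ln (A w) = d * of_int k)
            \<longleftrightarrow> (AE w in M. 0 < A w \<longrightarrow> (\<exists>k::int. ln (A w) = d * of_int k))"
          unfolding N_def using A_nonneg
          by (subst AE_density) (auto simp: order_less_le intro!: AE_cong)
        then show ?thesis using non_lattice[OF that] by simp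
      qed
    qed
    then show ?thesis by (simp add: H_def F_0 algebra_simps)
  qed
  have lin: "F y = y * F 1" for y
    using F_lip[of _ 0] F_0 by (intro additive_bounded_imp_linear[of F D] add) simp
  \<comment> \<open>For linear \<open>F\<close> the identity at 0 reads
    \<open>F 1 * \<rho> = 1\<close>, which fixes the slope.\<close>
  have "A w powr \<alpha> * (F 0 - F (0 - ln (A w))) = F 1 * (A w powr \<alpha> * ln (A w))" for w
    using lin[of "0 - ln (A w)"] F_0 by simp
  then have "expectation (\<lambda>w. F 1 * (A w powr \<alpha> * ln (A w))) = 1" using id[of 0] by (simp only:)
  then have "F 1 * \<rho> = 1" by (simp add: \<rho>_def)
  then have "F 1 = 1 / \<rho>" by (metis mult_zero_right nonzero_eq_divide_eq zero_neq_one)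
  then show ?thesis using lin[of y] by simp
qed

text \<open>If convergence failed, points tending to infinity would keep a distance \<open>e\<close>
  from the claimed limit. Equicontinuity gives a subsequence that converges for every argument, and
  its limit is already identified.\<close>

lemma Phi_tendsto: "((\<lambda>x. \<Phi> x y) \<longlongrightarrow> y / \<rho>) at_top"
proof (rule tendstoI, rule ccontr)
  fix e :: real assume e: "0 < e" and not: "\<not> (\<forall>\<^sub>F x in at_top. dist (\<Phi> x y) (y / \<rho>) < e)"
  obtain C x\<^sub>0 where C: "0 < C" and x0: "1 \<le> x\<^sub>0" and bound: "\<And>x a b. x\<^sub>0 \<le> x \<Longrightarrow>
      \<bar>\<Phi> x b - \<Phi> x a\<bar> \<le> C * (1 + exp (\<alpha>/2 * max a b)) * \<bar>b - a\<bar>"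
    using Phi_bound by blast
  have "\<forall>n. \<exists>x\<ge>max x\<^sub>0 (real n). e \<le> dist (\<Phi> x y) (y / \<rho>)"
    using not unfolding eventually_at_top_linorder by (meson not_less)
  then obtain X where X: "\<And>n. max x\<^sub>0 (real n) \<le> X n" "\<And>n. e \<le> dist (\<Phi> (X n) y) (y / \<rho>)"
    by metis
  have X0: "x\<^sub>0 \<le> X n" for n using X(1)[of n] by simp
  have lim: "filterlim X at_top sequentially"
    using X(1) by (intro filterlim_at_top_mono[OF filterlim_real_sequentially]) auto
  obtain k F where k: "strict_mono (k :: nat \<Rightarrow> nat)" and F: "\<And>y. (\<lambda>n. \<Phi> (X (k n)) y) \<longlonglongrightarrow> F y"
  proof (rule equicontinuous_subseq[of "\<lambda>n. \<Phi> (X n)" "\<lambda>y. C * (1 + exp (\<alpha>/2 * max 0 y)) * \<bar>y\<bar>"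
        "\<lambda>m. C * (1 + exp (\<alpha>/2 * m))"])
    show "\<bar>\<Phi> (X n) y\<bar> \<le> C * (1 + exp (\<alpha>/2 * max 0 y)) * \<bar>y\<bar>" for n y
      using bound[OF X0, of n y 0] by simp
    show "\<bar>\<Phi> (X n) y - \<Phi> (X n) z\<bar> \<le> C * (1 + exp (\<alpha>/2 * m)) * \<bar>y - z\<bar>"
      if "\<bar>y\<bar> \<le> m" "\<bar>z\<bar> \<le> m" for n y z m
    proof -
      have "\<bar>\<Phi> (X n) y - \<Phi> (X n) z\<bar> \<le> C * (1 + exp (\<alpha>/2 * max z y)) * \<bar>y - z\<bar>" by (rule bound[OF X0])
      also have "\<dots> \<le> C * (1 + exp (\<alpha>/2 * m)) * \<bar>y - z\<bar>"
        using C that alpha_pos by (intro mult_right_mono mult_left_mono add_left_mono) auto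
      finally show ?thesis .
    qed
  qed blast
  have "F y = y / \<rho>"
    using filterlim_compose[OF lim filterlim_subseq[OF k]] X0 C x0 bound F
    by (intro Phi_subseq_limit[of "\<lambda>n. X (k n)" x\<^sub>0 C F]) (auto simp: o_def)
  then have "\<forall>\<^sub>F n in sequentially. dist (\<Phi> (X (k n)) y) (y / \<rho>) < e"
    using tendstoD[OF F[of y] e] by simp
  then show False using X(2) by (auto simp: eventually_sequentially not_less[symmetric])
qed

text \<open>A monotone density argument: increments of S over [x, x e^h] and [x e^(-h), x] bound
  \<open>r x\<close> from below and above, and the quotients of these increments by
  \<open>T x\<close> have known limits. A small \<open>h\<close> brings both bounds close to
  1/(\<alpha> \<rho>).\<close>

lemma r_over_T: "((\<lambda>x. r x / T x) \<longlongrightarrow> 1 / (\<alpha> * \<rho>)) at_top"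
proof -
  have \<rho>: "0 < \<rho>" using rho_pos by (simp add: \<rho>_def)
  have lower: "\<forall>\<^sub>F x in at_top. l < r x / T x" if l: "l < 1 / (\<alpha> * \<rho>)" for l
  proof -
    have "((\<lambda>h. exp (- (\<alpha> * h)) / (\<alpha> * \<rho>)) \<longlongrightarrow> exp (- (\<alpha> * 0)) / (\<alpha> * \<rho>)) (at_right 0)"
      using alpha_pos \<rho> by (intro tendsto_intros) auto
    then have "\<forall>\<^sub>F h in at_right 0. l < exp (- (\<alpha> * h)) / (\<alpha> * \<rho>)"
      using l by (intro order_tendstoD(1)) auto
    then have "\<forall>\<^sub>F h in at_right 0. l < exp (- (\<alpha> * h)) / (\<alpha> * \<rho>) \<and> 0 < h"
      using eventually_at_right_less[of 0] by eventually_elim auto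
    then obtain h where h: "0 < h" "l < exp (- (\<alpha> * h)) / (\<alpha> * \<rho>)"
      using eventually_happens[of _ "at_right (0::real)"] trivial_limit_at_right_real[of 0] by auto
    \<comment> \<open>The factor \<open>c powr \<alpha> - 1\<close> of the increment bound at
      \<open>c = exp h\<close>. The inequality
      \<open>d \<le> \<alpha> * h * exp (\<alpha> * h)\<close> is what places
      \<open>(h / \<rho>) / d\<close> above the value compared with \<open>l\<close>.\<close>
    define d where "d = exp (\<alpha> * h) - 1"
    have "0 < \<alpha> * h" using h alpha_pos by simp
    then have d: "0 < d" by (simp add: d_def)
    have "1 + - (\<alpha> * h) \<le> exp (- (\<alpha> * h))" by (rule exp_ge_add_one_self)
    then have "exp (\<alpha> * h) * (1 - \<alpha> * h) \<le> exp (\<alpha> * h) * exp (- (\<alpha> * h))" by (intro mult_left_mono) auto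
    then have "d \<le> \<alpha> * h * exp (\<alpha> * h)" by (simp add: d_def algebra_simps flip: exp_add)
    then have "exp (- (\<alpha> * h)) / (\<alpha> * \<rho>) \<le> (h / \<rho>) / d"
      using d \<rho> alpha_pos h by (simp add: field_simps exp_minus)
    then have "l < (h / \<rho>) / d" using h by simp
    moreover have "((\<lambda>x. \<Phi> x h / d) \<longlongrightarrow> (h / \<rho>) / d) at_top" using d by (intro tendsto_intros Phi_tendsto) auto
    ultimately have "\<forall>\<^sub>F x in at_top. l < \<Phi> x h / d" by (rule order_tendstoD(1)[rotated])
    then show ?thesis using eventually_gt_at_top[of 0]
    proof eventually_elim
      case (elim x)
      have "S (exp h * x) - S x \<le> d * r x"
        using S_diff_le(1)[of x "exp h"] elim h by (simp add: d_def powr_def)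
      then have "\<Phi> x h \<le> d * r x / T x"
        unfolding \<Phi>_def using T_nonneg[of x] by (intro divide_right_mono) (auto simp: mult.commute)
      then have "\<Phi> x h / d \<le> r x / T x" using d by (simp add: field_simps)
      then show ?case using elim by simp
    qed
  qed
  have upper: "\<forall>\<^sub>F x in at_top. r x / T x < u" if u: "1 / (\<alpha> * \<rho>) < u" for u
  proof -
    have "((\<lambda>h. exp (\<alpha> * h) / (\<alpha> * \<rho>)) \<longlongrightarrow> exp (\<alpha> * 0) / (\<alpha> * \<rho>)) (at_right 0)"
      using alpha_pos \<rho> by (intro tendsto_intros) auto
    then have "\<forall>\<^sub>F h in at_right 0. exp (\<alpha> * h) / (\<alpha> * \<rho>) < u"
      using u by (intro order_tendstoD(2)) auto
    then have "\<forall>\<^sub>F h in at_right 0. exp (\<alpha> * h) / (\<alpha> * \<rho>) < u \<and> 0 < h"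
      using eventually_at_right_less[of 0] by eventually_elim auto
    then obtain h where h: "0 < h" "exp (\<alpha> * h) / (\<alpha> * \<rho>) < u"
      using eventually_happens[of _ "at_right (0::real)"] trivial_limit_at_right_real[of 0] by auto
    define d where "d = (exp (\<alpha> * h) - 1) / exp (\<alpha> * h)"
    have ah: "0 < \<alpha> * h" using h alpha_pos by simp
    then have d: "0 < d" by (simp add: d_def)
    have "\<alpha> * h \<le> exp (\<alpha> * h) - 1" using exp_ge_add_one_self[of "\<alpha> * h"] by linarith
    then have "\<alpha> * h \<le> d * exp (\<alpha> * h)" by (simp add: d_def)
    then have "(h / \<rho>) / d \<le> exp (\<alpha> * h) / (\<alpha> * \<rho>)"
      using d \<rho> alpha_pos h by (simp add: field_simps)
    then have "(h / \<rho>) / d < u" using h by simp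
    moreover have "((\<lambda>x. - \<Phi> x (- h) / d) \<longlongrightarrow> - (- h / \<rho>) / d) at_top"
      using d by (intro tendsto_intros Phi_tendsto) auto
    ultimately have "\<forall>\<^sub>F x in at_top. - \<Phi> x (- h) / d < u" by (intro order_tendstoD(2)) auto
    then show ?thesis using eventually_gt_at_top[of 0]
    proof eventually_elim
      case (elim x)
      \<comment> \<open>The increment is taken backwards from \<open>x\<close>, so that the lower
        bound on it involves \<open>r\<close> at \<open>x\<close> itself and no change of normaliser
        is required.\<close>
      have x: "exp h * (x * exp (- h)) = x" by (simp add: exp_minus)
      have "d * r x \<le> S x - S (x * exp (- h))"
        using S_diff_le(2)[of "x * exp (- h)" "exp h"] elim h unfolding x by (simp add: d_def powr_def)
      then have "d * r x / T x \<le> - \<Phi> x (- h)"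
        unfolding \<Phi>_def minus_divide_left minus_diff_eq using T_nonneg[of x] by (intro divide_right_mono)
      then have "r x / T x \<le> - \<Phi> x (- h) / d" using d by (simp add: field_simps)
      then show ?case using elim by simp
    qed
  qed
  show ?thesis using lower upper by (intro order_tendstoI)
qed

text \<open>The layer-cake formula started at 0; passing to the open interval changes only a null
  set. The factor \<alpha> cancels the one in the limit of \<open>r x / T x\<close>.\<close>

lemma T_eq_integral:
  assumes x: "0 < x"
  shows "T x = \<alpha> * (LBINT t:{0<..<x}. L t / t)"
proof -
  have "T x = enn2real (\<integral>\<^sup>+w. ennreal (V x (B w)) \<partial>M)"
    unfolding T_def by (intro integral_eq_nn_integral) auto
  also have "(\<integral>\<^sup>+w. ennreal (V x (B w)) \<partial>M)
      = (\<integral>\<^sup>+w. ennreal (min (max (B w) 0) x powr \<alpha> - min (max (B w) 0) 0 powr \<alpha>) \<partial>M)"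
    by (intro nn_integral_cong) (simp add: trunc_powr_def)
  also have "\<dots> = (\<integral>\<^sup>+t. ennreal (indicator {0..x} t * (\<alpha> * t powr (\<alpha> - 1)) * prob {w \<in> space M. t < B w}) \<partial>lborel)"
    using x alpha_pos by (intro nn_integral_min_powr) auto
  also have "\<dots> = (\<integral>\<^sup>+t. ennreal (indicator {0<..<x} t * (\<alpha> * (L t / t))) \<partial>lborel)"
  proof (intro nn_integral_cong_AE)
    have "AE t in lborel. t \<noteq> 0 \<and> t \<noteq> x" by (simp add: AE_lborel_singleton)
    then show "AE t in lborel. ennreal (indicator {0..x} t * (\<alpha> * t powr (\<alpha> - 1)) * prob {w \<in> space M. t < B w})
        = ennreal (indicator {0<..<x} t * (\<alpha> * (L t / t)))"
      by eventually_elim (auto simp: indicator_def L_def powr_diff mult.assoc)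
  qed
  also have "enn2real \<dots> = (\<integral>t. indicator {0<..<x} t * (\<alpha> * (L t / t)) \<partial>lborel)"
  proof (rule integral_eq_nn_integral[symmetric])
    have "(\<lambda>t. prob {w \<in> space M. t < B w}) \<in> borel_measurable lborel"
      by measurable
    then show "(\<lambda>t. indicator {0<..<x} t * (\<alpha> * (L t / t))) \<in> borel_measurable lborel"
      unfolding L_def by measurable
    show "AE t in lborel. 0 \<le> indicator {0<..<x} t * (\<alpha> * (L t / t))"
      using alpha_pos by (intro AE_I2) (auto simp: indicator_def L_def)
  qed
  also have "\<dots> = \<alpha> * (LBINT t:{0<..<x}. L t / t)"
    unfolding set_lebesgue_integral_def real_scaleR_def
    by (simp only: mult.left_commute[of _ \<alpha>] integral_mult_right_zero)
  finally show ?thesis .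
qed

lemma tail_asymp:
  "(\<lambda>x. x powr \<alpha> * prob {w \<in> space M. x < R w}) \<sim>[at_top] (\<lambda>x. 1 / \<rho> * (LBINT t:{0<..<x}. L t / t))"
proof (rule asymp_equivI')
  have \<rho>: "0 < \<rho>" using rho_pos by (simp add: \<rho>_def)
  have "((\<lambda>x. \<alpha> * \<rho> * (r x / T x)) \<longlongrightarrow> \<alpha> * \<rho> * (1 / (\<alpha> * \<rho>))) at_top"
    by (intro tendsto_intros r_over_T)
  then have "((\<lambda>x. \<alpha> * \<rho> * (r x / T x)) \<longlongrightarrow> 1) at_top" using \<rho> alpha_pos by simp
  then show "((\<lambda>x. x powr \<alpha> * prob {w \<in> space M. x < R w} / (1 / \<rho> * (LBINT t:{0<..<x}. L t / t))) \<longlongrightarrow> 1) at_top"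
  proof (rule Lim_transform_eventually)
    show "\<forall>\<^sub>F x in at_top. \<alpha> * \<rho> * (r x / T x)
        = x powr \<alpha> * prob {w \<in> space M. x < R w} / (1 / \<rho> * (LBINT t:{0<..<x}. L t / t))"
      using eventually_gt_at_top[of 0]
    proof eventually_elim
      case (elim x)
      show ?case using \<rho> alpha_pos by (simp add: T_eq_integral[OF elim] r_def)
    qed
  qed
qed

end

subsection \<open>The tail of a perpetuity\<close>

text \<open>\<open>indep_rv\<close> is a product rule for events. On rectangles it identifies the
  joint law with the product of the marginals, and Tonelli's theorem then integrates the variables
  separately.\<close>

lemma nn_integral_indep_pair:
  fixes f :: "'b \<Rightarrow> 'c \<Rightarrow> ennreal"
  assumes "prob_space M" and X [measurable]: "X \<in> measurable M S" and Y [measurable]: "Y \<in> measurable M T"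
    and indep: "indep_rv M S X T Y"
    and f [measurable]: "case_prod f \<in> borel_measurable (S \<Otimes>\<^sub>M T)"
  shows "(\<integral>\<^sup>+w. f (X w) (Y w) \<partial>M) = (\<integral>\<^sup>+w. \<integral>\<^sup>+w'. f (X w') (Y w) \<partial>M \<partial>M)"
proof -
  interpret prob_space M by fact
  interpret X: prob_space "distr M S X" by (rule prob_space_distr) (rule X)
  interpret Y: prob_space "distr M T Y" by (rule prob_space_distr) (rule Y)
  interpret XY: pair_sigma_finite "distr M S X" "distr M T Y" ..
  have eq: "distr M S X \<Otimes>\<^sub>M distr M T Y = distr M (S \<Otimes>\<^sub>M T) (\<lambda>w. (X w, Y w))"
  proof (rule pair_measure_eqI)
    fix U V assume U: "U \<in> sets (distr M S X)" and V: "V \<in> sets (distr M T Y)"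
    have "(\<lambda>w. (X w, Y w)) -` (U \<times> V) \<inter> space M = (X -` U \<inter> space M) \<inter> (Y -` V \<inter> space M)" by auto
    moreover have "prob ((X -` U \<inter> space M) \<inter> (Y -` V \<inter> space M))
        = prob (X -` U \<inter> space M) * prob (Y -` V \<inter> space M)"
      using indep U V unfolding indep_rv_def by (intro indep_setD) auto
    ultimately show "emeasure (distr M S X) U * emeasure (distr M T Y) V
        = emeasure (distr M (S \<Otimes>\<^sub>M T) (\<lambda>w. (X w, Y w))) (U \<times> V)"
      using U V by (simp add: emeasure_distr emeasure_eq_measure ennreal_mult)
  qed (auto intro: X.sigma_finite_measure_axioms Y.sigma_finite_measure_axioms)
  have "(\<integral>\<^sup>+w. f (X w) (Y w) \<partial>M) = (\<integral>\<^sup>+p. case_prod f p \<partial>distr M (S \<Otimes>\<^sub>M T) (\<lambda>w. (X w, Y w)))"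
    by (subst nn_integral_distr) auto
  also have "\<dots> = (\<integral>\<^sup>+y. \<integral>\<^sup>+x. f x y \<partial>distr M S X \<partial>distr M T Y)"
    unfolding eq[symmetric] by (subst XY.nn_integral_snd[symmetric]) auto
  also have "\<dots> = (\<integral>\<^sup>+w. \<integral>\<^sup>+w'. f (X w') (Y w) \<partial>M \<partial>M)"
  proof (subst nn_integral_distr, simp_all, intro nn_integral_cong)
    fix w assume "w \<in> space M"
    then have "Y w \<in> space T" by (rule measurable_space[OF Y])
    from measurable_compose[OF measurable_Pair2'[OF this] f]
    have "(\<lambda>x. f x (Y w)) \<in> borel_measurable S" by simp
    then show "(\<integral>\<^sup>+x. f x (Y w) \<partial>distr M S X) = (\<integral>\<^sup>+w'. f (X w') (Y w) \<partial>M)"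
      by (subst nn_integral_distr) auto
  qed
  finally show ?thesis .
qed

lemma perpetuity_tail:
  fixes M :: "'a measure" and A B R :: "'a \<Rightarrow> real" and \<alpha> \<rho> :: real and L :: "real \<Rightarrow> real"
  assumes "prob_space M"
    and A [measurable]: "A \<in> borel_measurable M" and B [measurable]: "B \<in> borel_measurable M"
    and "\<alpha> > 0"
    and L_eq: "\<And>x. L x = x powr \<alpha> * \<P>(w in M. B w > x)"
    and A_nonneg: "AE w in M. A w \<ge> 0"
    and non_arithmetic: "\<not> arithmetic_law
          (distr (uniform_measure M {w \<in> space M. A w > 0}) borel (\<lambda>w. ln (A w)))"
    and A_moment: "has_bochner_integral M (\<lambda>w. A w powr \<alpha>) 1"
    and rho: "has_bochner_integral M (\<lambda>w. A w powr \<alpha> * ln (A w)) \<rho>"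
    and L_sv: "slowly_varying L"
    and B_pos_inf: "(\<integral>\<^sup>+w. ennreal (pos_part (B w) powr \<alpha>) \<partial>M) = \<infinity>"
    and B_neg_fin: "\<And>\<epsilon>. 0 < \<epsilon> \<Longrightarrow> \<epsilon> < \<alpha> \<Longrightarrow>
          (\<integral>\<^sup>+w. ennreal (neg_part (B w) powr (\<alpha> - \<epsilon>)) \<partial>M) < \<infinity>"
    and mixed_pos: "\<exists>\<eta>. 0 < \<eta> \<and> \<eta> < \<alpha> \<and> \<eta> \<le> 1 \<and>
          (\<integral>\<^sup>+w. ennreal (A w powr \<eta> * pos_part (B w) powr (\<alpha> - \<eta>)) \<partial>M) < \<infinity>"
    and R: "solves_affine_eq M A B R"
  shows "(\<lambda>x. x powr \<alpha> * \<P>(w in M. R w > x)) \<sim>[at_top] (\<lambda>x. 1 / \<rho> * (LBINT t:{0<..<x}. L t / t))"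
proof -
  interpret prob_space M by fact
  have R_meas [measurable]: "R \<in> borel_measurable M"
    and indep: "indep_rv M borel R (borel \<Otimes>\<^sub>M borel) (\<lambda>w. (A w, B w))"
    and law: "distr M borel R = distr M borel (\<lambda>w. A w * R w + B w)"
    using R unfolding solves_affine_eq_def by auto
  \<comment> \<open>A modification on a null set that is nonnegative everywhere; moments,
    stationarity and the lattice condition carry over.\<close>
  define A' where "A' w = max (A w) 0" for w
  have [measurable]: "A' \<in> borel_measurable M" unfolding A'_def[abs_def] by measurable
  have A'_eq: "AE w in M. A' w = A w" using A_nonneg by eventually_elim (simp add: A'_def)
  obtain \<eta> where \<eta>: "0 < \<eta>" "\<eta> < \<alpha>" "\<eta> \<le> 1"
    and mixed: "(\<integral>\<^sup>+w. ennreal (A w powr \<eta> * pos_part (B w) powr (\<alpha> - \<eta>)) \<partial>M) < \<infinity>"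
    using mixed_pos by blast
  have A'_moment: "has_bochner_integral M (\<lambda>w. A' w powr \<alpha>) 1"
    using A_moment A'_eq by (subst has_bochner_integral_cong_AE[where g="\<lambda>w. A w powr \<alpha>"]) auto
  have A'_rho: "has_bochner_integral M (\<lambda>w. A' w powr \<alpha> * ln (A' w)) \<rho>"
    using rho A'_eq by (subst has_bochner_integral_cong_AE[where g="\<lambda>w. A w powr \<alpha> * ln (A w)"]) auto
  have stationary: "(\<integral>\<^sup>+w. f (R w) \<partial>M) = (\<integral>\<^sup>+w. \<integral>\<^sup>+w'. f (A' w * R w' + B w) \<partial>M \<partial>M)"
    if [measurable]: "f \<in> borel_measurable borel" for f :: "real \<Rightarrow> ennreal"
  proof -
    have "(\<integral>\<^sup>+w. f (R w) \<partial>M) = (\<integral>\<^sup>+z. f z \<partial>distr M borel R)" by (simp add: nn_integral_distr)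
    also have "\<dots> = (\<integral>\<^sup>+w. f (A w * R w + B w) \<partial>M)" unfolding law by (simp add: nn_integral_distr)
    also have "\<dots> = (\<integral>\<^sup>+w. \<integral>\<^sup>+w'. f (A w * R w' + B w) \<partial>M \<partial>M)"
      using nn_integral_indep_pair[OF \<open>prob_space M\<close> R_meas _ indep,
          of "\<lambda>z (a, b). f (a * z + b)"] by simp
    also have "\<dots> = (\<integral>\<^sup>+w. \<integral>\<^sup>+w'. f (A' w * R w' + B w) \<partial>M \<partial>M)"
      using A'_eq by (intro nn_integral_cong_AE) auto
    finally show ?thesis .
  qed
  have prob_pos: "0 < prob {w \<in> space M. A w > 0}"
  proof (rule ccontr)
    assume "\<not> ?thesis"
    then have "prob {w \<in> space M. A w > 0} = 0" using measure_nonneg[of M] by (simp add: not_less antisym)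
    then have "AE w in M. \<not> A w > 0" by (subst (asm) prob_eq_0) auto
    then have "AE w in M. A' w powr \<alpha> = 0" by eventually_elim (simp add: A'_def max_def)
    then have "(\<integral>w. A' w powr \<alpha> \<partial>M) = 0" by (intro integral_eq_zero_AE)
    then show False using A'_moment by (simp add: has_bochner_integral_iff)
  qed
  \<comment> \<open>A lattice property on the event A > 0 passes to the conditional measure and, the
    lattice being a countable union of points and hence Borel, to the image law under
    \<open>ln\<close>.\<close>
  have non_lattice: "\<not> (AE w in M. 0 < A' w \<longrightarrow> (\<exists>k::int. ln (A' w) = d * of_int k))" if d: "0 < d" for d
  proof
    assume AE: "AE w in M. 0 < A' w \<longrightarrow> (\<exists>k::int. ln (A' w) = d * of_int k)"
    let ?P = "\<lambda>x :: real. \<exists>k::int. x = d * of_int k"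
    have "AE w in M. w \<in> {w \<in> space M. A w > 0} \<longrightarrow> ?P (ln (A w))"
      using AE by eventually_elim (auto simp: A'_def max_def split: if_splits)
    then have "AE w in uniform_measure M {w \<in> space M. A w > 0}. ?P (ln (A w))"
      by (intro AE_uniform_measureI) auto
    moreover have "{x \<in> space borel. ?P x} \<in> sets borel"
    proof -
      have "{x \<in> space borel. ?P x} = (\<Union>k::int. {d * of_int k})" by auto
      then show ?thesis by auto
    qed
    ultimately have "AE x in distr (uniform_measure M {w \<in> space M. A w > 0}) borel (\<lambda>w. ln (A w)). ?P x"
      by (subst AE_distr_iff) auto
    then show False using non_arithmetic d unfolding arithmetic_law_def by blast
  qed
  interpret slow_tail M B \<alpha>
  proof
    show "0 < prob {w \<in> space M. x < B w}" if "0 < x" for x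
      using L_sv that unfolding slowly_varying_def L_eq by (auto simp: zero_less_mult_iff)
    show "((\<lambda>x. (c * x) powr \<alpha> * prob {w \<in> space M. c * x < B w}
        / (x powr \<alpha> * prob {w \<in> space M. x < B w})) \<longlongrightarrow> 1) at_top" if "0 < c" for c
      using L_sv that unfolding slowly_varying_def L_eq by auto
    show "(\<integral>\<^sup>+w. ennreal (max (B w) 0 powr \<alpha>) \<partial>M) = \<infinity>"
      using B_pos_inf by (simp add: pos_part_def)
  qed (use \<open>\<alpha> > 0\<close> in auto)
  interpret slow_perpetuity M A' B R \<alpha> \<eta>
  proof
    show "integrable M (\<lambda>w. \<bar>B w\<bar> powr \<theta>)" if "0 < \<theta>" "\<theta> < \<alpha>" for \<theta>
    proof -
      \<comment> \<open>Moments of |B| below order \<alpha> come from two sources: the hypothesis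
        with \<open>\<epsilon> = \<alpha> - \<theta>\<close> for B_-, and the slowly varying tail
        for B_+.\<close>
      have "integrable M (\<lambda>w. neg_part (B w) powr \<theta>)"
        using B_neg_fin[of "\<alpha> - \<theta>"] that by (intro integrableI_bounded) (auto simp: neg_part_def)
      then have "integrable M (\<lambda>w. max (B w) 0 powr \<theta> + neg_part (B w) powr \<theta>)"
        using integrable_B_plus_powr[OF that] by simp
      moreover have "\<bar>b\<bar> powr \<theta> = max b 0 powr \<theta> + neg_part b powr \<theta>" for b
        by (auto simp: neg_part_def max_def)
      ultimately show ?thesis by simp
    qed
    have "integrable M (\<lambda>w. A w powr \<eta> * max (B w) 0 powr (\<alpha> - \<eta>))"
      using mixed by (intro integrableI_bounded) (auto simp: pos_part_def abs_mult)
    moreover have "AE w in M. A' w powr \<eta> * max (B w) 0 powr (\<alpha> - \<eta>)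
        = A w powr \<eta> * max (B w) 0 powr (\<alpha> - \<eta>)"
      using A'_eq by eventually_elim simp
    ultimately show "integrable M (\<lambda>w. A' w powr \<eta> * max (B w) 0 powr (\<alpha> - \<eta>))"
      by (subst integrable_cong_AE) auto
  qed (use \<eta> \<open>\<alpha> > 0\<close> stationary non_lattice A'_moment A'_rho
        in \<open>auto simp: A'_def[abs_def] has_bochner_integral_iff\<close>)
  have "slow_perpetuity.\<rho> M A' \<alpha> = \<rho>"
    using A'_rho by (simp add: \<rho>_def has_bochner_integral_iff)
  moreover have "slow_tail.L M B \<alpha> = L" by (simp add: fun_eq_iff L_def L_eq)
  ultimately show ?thesis using tail_asymp by simp
qed

theorem corollary1p2:
  fixes M :: "'a measure" and A B R :: "'a \<Rightarrow> real" and \<alpha> \<rho> :: real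
    and L L1 :: "real \<Rightarrow> real"
  assumes "prob_space M"
    and "A \<in> borel_measurable M" and "B \<in> borel_measurable M"
    and "\<alpha> > 0"
    and L1_eq: "\<And>x. L1 x = x powr \<alpha> * \<P>(\<omega> in M. B \<omega> < - x)"
    and L_eq: "\<And>x. L x = x powr \<alpha> * \<P>(\<omega> in M. B \<omega> > x)"
    and A_nonneg: "AE \<omega> in M. A \<omega> \<ge> 0"
    and non_arithmetic: "\<not> arithmetic_law
          (distr (uniform_measure M {\<omega> \<in> space M. A \<omega> > 0}) borel (\<lambda>\<omega>. ln (A \<omega>)))"
    and A_moment: "has_bochner_integral M (\<lambda>\<omega>. A \<omega> powr \<alpha>) 1"
    and rho: "has_bochner_integral M (\<lambda>\<omega>. A \<omega> powr \<alpha> * ln (A \<omega>)) \<rho>"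
    and L1_sv: "slowly_varying L1"
    and B_neg_inf: "(\<integral>\<^sup>+\<omega>. ennreal (neg_part (B \<omega>) powr \<alpha>) \<partial>M) = \<infinity>"
    and B_pos_fin: "\<And>\<epsilon>. 0 < \<epsilon> \<Longrightarrow> \<epsilon> < \<alpha> \<Longrightarrow>
          (\<integral>\<^sup>+\<omega>. ennreal (pos_part (B \<omega>) powr (\<alpha> - \<epsilon>)) \<partial>M) < \<infinity>"
    and mixed_neg: "\<exists>\<eta>. 0 < \<eta> \<and> \<eta> < \<alpha> \<and> \<eta> \<le> 1 \<and>
          (\<integral>\<^sup>+\<omega>. ennreal (A \<omega> powr \<eta> * neg_part (B \<omega>) powr (\<alpha> - \<eta>)) \<partial>M) < \<infinity>"
    and R: "solves_affine_eq M A B R"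
  shows "(\<lambda>x. x powr \<alpha> * \<P>(\<omega> in M. R \<omega> < - x))
           \<sim>[at_top] (\<lambda>x. 1 / \<rho> * (LBINT t:{0<..<x}. L1 t / t))
       \<and> (slowly_varying L
          \<and> (\<integral>\<^sup>+\<omega>. ennreal (pos_part (B \<omega>) powr \<alpha>) \<partial>M) = \<infinity>
          \<and> (\<forall>\<epsilon>. 0 < \<epsilon> \<and> \<epsilon> < \<alpha> \<longrightarrow>
                (\<integral>\<^sup>+\<omega>. ennreal (neg_part (B \<omega>) powr (\<alpha> - \<epsilon>)) \<partial>M) < \<infinity>)
          \<and> (\<exists>\<eta>'. 0 < \<eta>' \<and> \<eta>' < \<alpha> \<and> \<eta>' \<le> 1 \<and>
                (\<integral>\<^sup>+\<omega>. ennreal (A \<omega> powr \<eta>' * pos_part (B \<omega>) powr (\<alpha> - \<eta>')) \<partial>M) < \<infinity>)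
         \<longrightarrow> (\<lambda>x. x powr \<alpha> * \<P>(\<omega> in M. R \<omega> > x))
               \<sim>[at_top] (\<lambda>x. 1 / \<rho> * (LBINT t:{0<..<x}. L t / t))
           \<and> (\<lambda>x. x powr \<alpha> * \<P>(\<omega> in M. R \<omega> < - x))
               \<sim>[at_top] (\<lambda>x. 1 / \<rho> * (LBINT t:{0<..<x}. L1 t / t)))"
proof -
  interpret prob_space M by fact
  have R_meas: "R \<in> borel_measurable M" using R by (simp add: solves_affine_eq_def)
  have neg: "solves_affine_eq M A (\<lambda>\<omega>. - B \<omega>) (\<lambda>\<omega>. - R \<omega>)"
    unfolding solves_affine_eq_def
  proof (intro conjI)
    show "(\<lambda>\<omega>. - R \<omega>) \<in> borel_measurable M" using R_meas by simp
    \<comment> \<open>Events generated by a measurable image of \<open>X\<close> are already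
      generated by \<open>X\<close>, and independence passes to smaller families; sign changes
      therefore preserve it.\<close>
    have sub: "{(\<lambda>\<omega>. g (X \<omega>)) -` U \<inter> space M | U. U \<in> sets S} \<subseteq> {X -` U \<inter> space M | U. U \<in> sets S}"
      if "g \<in> measurable S S" "X \<in> measurable M S" for g :: "'b \<Rightarrow> 'b" and X S
    proof safe
      fix U assume "U \<in> sets S"
      then have "g -` U \<inter> space S \<in> sets S" using that by (auto intro: measurable_sets)
      moreover have "(\<lambda>\<omega>. g (X \<omega>)) -` U \<inter> space M = X -` (g -` U \<inter> space S) \<inter> space M"
        using measurable_space[OF that(2)] by auto
      ultimately show "\<exists>V. (\<lambda>\<omega>. g (X \<omega>)) -` U \<inter> space M = X -` V \<inter> space M \<and> V \<in> sets S" by blast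
    qed
    have "{(\<lambda>\<omega>. - R \<omega>) -` U \<inter> space M | U. U \<in> sets borel} \<subseteq> {R -` U \<inter> space M | U. U \<in> sets borel}"
      using R_meas by (intro sub) auto
    moreover have "{(\<lambda>\<omega>. (A \<omega>, - B \<omega>)) -` U \<inter> space M | U. U \<in> sets (borel \<Otimes>\<^sub>M borel)}
        \<subseteq> {(\<lambda>\<omega>. (A \<omega>, B \<omega>)) -` U \<inter> space M | U. U \<in> sets (borel \<Otimes>\<^sub>M borel)}"
      using sub[of "\<lambda>(a, b). (a, - b)" "borel \<Otimes>\<^sub>M borel" "\<lambda>\<omega>. (A \<omega>, B \<omega>)"] assms(2,3) by simp
    ultimately show "indep_rv M borel (\<lambda>\<omega>. - R \<omega>) (borel \<Otimes>\<^sub>M borel) (\<lambda>\<omega>. (A \<omega>, - B \<omega>))"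
      using R unfolding solves_affine_eq_def indep_rv_def indep_set_def
      by (elim conjE indep_sets_mono_sets) (auto split: bool.split)
    have "distr M borel (\<lambda>\<omega>. - R \<omega>) = distr (distr M borel R) borel uminus"
      using R_meas by (subst distr_distr) (auto simp: o_def)
    also have "\<dots> = distr (distr M borel (\<lambda>\<omega>. A \<omega> * R \<omega> + B \<omega>)) borel uminus"
      using R by (simp add: solves_affine_eq_def)
    also have "\<dots> = distr M borel (\<lambda>\<omega>. A \<omega> * - R \<omega> + - B \<omega>)"
      using R_meas assms(2,3) by (subst distr_distr) (auto simp: o_def)
    finally show "distr M borel (\<lambda>\<omega>. - R \<omega>) = distr M borel (\<lambda>\<omega>. A \<omega> * - R \<omega> + - B \<omega>)" .
  qed
  have parts: "pos_part (- b) = neg_part b" "neg_part (- b) = pos_part b" for b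
    by (simp_all add: pos_part_def neg_part_def)
  have "(\<lambda>x. x powr \<alpha> * \<P>(\<omega> in M. - R \<omega> > x)) \<sim>[at_top] (\<lambda>x. 1 / \<rho> * (LBINT t:{0<..<x}. L1 t / t))"
  proof (rule perpetuity_tail[of M A "\<lambda>\<omega>. - B \<omega>"])
    show "L1 x = x powr \<alpha> * \<P>(\<omega> in M. - B \<omega> > x)" for x
      unfolding L1_eq by (simp add: less_minus_iff)
    show "slowly_varying L1" by (rule L1_sv)
  qed (use assms neg in \<open>simp_all add: parts\<close>)
  then have lower: "(\<lambda>x. x powr \<alpha> * \<P>(\<omega> in M. R \<omega> < - x))
      \<sim>[at_top] (\<lambda>x. 1 / \<rho> * (LBINT t:{0<..<x}. L1 t / t))"
    by (simp add: less_minus_iff)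
  have upper: "(\<lambda>x. x powr \<alpha> * \<P>(\<omega> in M. R \<omega> > x)) \<sim>[at_top] (\<lambda>x. 1 / \<rho> * (LBINT t:{0<..<x}. L t / t))"
    if "slowly_varying L" "(\<integral>\<^sup>+\<omega>. ennreal (pos_part (B \<omega>) powr \<alpha>) \<partial>M) = \<infinity>"
      "\<forall>\<epsilon>. 0 < \<epsilon> \<and> \<epsilon> < \<alpha> \<longrightarrow> (\<integral>\<^sup>+\<omega>. ennreal (neg_part (B \<omega>) powr (\<alpha> - \<epsilon>)) \<partial>M) < \<infinity>"
      "\<exists>\<eta>'. 0 < \<eta>' \<and> \<eta>' < \<alpha> \<and> \<eta>' \<le> 1 \<and>
        (\<integral>\<^sup>+\<omega>. ennreal (A \<omega> powr \<eta>' * pos_part (B \<omega>) powr (\<alpha> - \<eta>')) \<partial>M) < \<infinity>"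
    using perpetuity_tail[OF assms(1-4) L_eq A_nonneg non_arithmetic A_moment rho that(1,2) _ that(4) R]
      that(3)
    by blast
  show ?thesis using lower upper by blast
qed

end
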